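(* Let $u\in S_{p+1}$ be an indecomposable vexillary permutation with shape $\lambda\vdash n-1$. Then there exist a labeling $\omega_u$ of $\lambda$ and an integer $N_u\ge 0$ such that $$\sum_{j\ge 0}\nu_u(j)t^j=\frac{\displaystyle\sum_{T\in \mathrm{SYT}(\lambda)}t^{\mathrm{des}(T;\omega_u)-N_u}}{(1-t)^n}.$$
   Context: A permutation $u\in S_{p+1}$ is indecomposable if $u(\{1,\dots,i\})\ne\{1,\dots,i\}$ for $i=1,\dots,p$. It is vexillary if it avoids the pattern $2143$, i.e. there are no $i_1<i_2<i_3<i_4$ with $u(i_2)<u(i_1)<u(i_4)<u(i_3)$. The code of $u$ is $(c_1,c_2,\dots)$ with $c_i=|\{j>i : u(j)<u(i)\}|$, and the shape of $u$ is the partition obtained by sorting the nonzero entries of the code in nonincreasing order. Schubert polynomials: in $S_m$, with $w_o=m(m-1)\cdots1$, $\mathfrak{S}_{w_o}=x_1^{m-1}x_2^{m-2}\cdots x_{m-1}$, and $\mathfrak{S}_{ws_i}=\partial_i\mathfrak{S}_w$ whenever $w(i)>w(i+1)$, where $s_i=(i,i+1)$ and $\partial_i f=(f-s_i\cdot f)/(x_i-x_{i+1})$. For $j\ge0$, $1^j\times u\in S_{j+p+1}$ is the permutation fixing $1,\dots,j$ and sending $j+i\mapsto j+u(i)$, and $\nu_u(j)=\mathfrak{S}_{1^j\times u}(1,1,\dots)$. A labeling of $\lambda$ is a bijection $\omega$ from the cells of the Young diagram of $\lambda$ to $\{1,\dots,|\lambda|\}$. $\mathrm{SYT}(\lambda)$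 is the set of standard Young tableaux of shape $\lambda$. For $T\in\mathrm{SYT}(\lambda)$, an $\omega$-descent of $T$ is an entry $k<|\lambda|$ such that $\omega(T^{-1}(k))>\omega(T^{-1}(k+1))$, where $T^{-1}(k)$ is the cell containing $k$; $\mathrm{des}(T;\omega)$ is the number of $\omega$-descents of $T$. *)

theory Defs
  imports
    "HOL-Library.Poly_Mapping"
    "HOL-Library.FuncSet"
    "HOL-Combinatorics.Permutations"
    "HOL-Computational_Algebra.Formal_Power_Series"
begin

section \<open>Permutations\<close>

text \<open>An element of \<open>S\<^sub>m\<close> is a function \<open>u :: nat \<Rightarrow> nat\<close> with \<open>u permutes {1..m}\<close>; in
  particular it fixes every number outside \<open>{1..m}\<close>.\<close>

definition indecomposable :: "nat \<Rightarrow> (nat \<Rightarrow> nat) \<Rightarrow> bool" where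
  "indecomposable m u \<longleftrightarrow> (\<forall>i\<in>{1..<m}. u ` {1..i} \<noteq> {1..i})"

definition vexillary :: "nat \<Rightarrow> (nat \<Rightarrow> nat) \<Rightarrow> bool" where
  "vexillary m u \<longleftrightarrow>
     \<not> (\<exists>i1\<in>{1..m}. \<exists>i2\<in>{1..m}. \<exists>i3\<in>{1..m}. \<exists>i4\<in>{1..m}.
          i1 < i2 \<and> i2 < i3 \<and> i3 < i4 \<and> u i2 < u i1 \<and> u i1 < u i4 \<and> u i4 < u i3)"

definition code :: "nat \<Rightarrow> (nat \<Rightarrow> nat) \<Rightarrow> nat \<Rightarrow> nat" where
  "code m u i = card {j \<in> {i<..m}. u j < u i}"

definition shape :: "nat \<Rightarrow> (nat \<Rightarrow> nat) \<Rightarrow> nat list" where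
  "shape m u = rev (sort (filter (\<lambda>c. c \<noteq> 0) (map (code m u) [1..<m + 1])))"

definition longest_perm :: "nat \<Rightarrow> nat \<Rightarrow> nat" where
  "longest_perm m = (\<lambda>i. if i \<in> {1..m} then m + 1 - i else i)"

text \<open>\<open>shift_perm j u\<close> is \<open>1\<^sup>j \<times> u\<close>.\<close>

definition shift_perm :: "nat \<Rightarrow> (nat \<Rightarrow> nat) \<Rightarrow> nat \<Rightarrow> nat" where
  "shift_perm j u = (\<lambda>i. if i \<le> j then i else j + u (i - j))"


section \<open>Polynomials and divided differences\<close>

text \<open>Integer polynomials in \<open>x\<^sub>0, x\<^sub>1, \<dots>\<close>: a finitely supported map from monomials (exponent
  vectors) to coefficients, with the convolution product of \<open>Poly_Mapping\<close>.\<close>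

type_synonym int_poly = "(nat \<Rightarrow>\<^sub>0 nat) \<Rightarrow>\<^sub>0 int"

definition X :: "nat \<Rightarrow> int_poly" where
  "X i = Poly_Mapping.single (Poly_Mapping.single i 1) 1"

definition eval_poly :: "(nat \<Rightarrow> int) \<Rightarrow> int_poly \<Rightarrow> int" where
  "eval_poly a f =
     (\<Sum>e\<in>Poly_Mapping.keys f.
        Poly_Mapping.lookup f e * (\<Prod>i\<in>Poly_Mapping.keys e. a i ^ Poly_Mapping.lookup e i))"

text \<open>The action of \<open>s\<^sub>i\<close> exchanging \<open>x\<^sub>i\<close> and \<open>x\<^bsub>i+1\<^esub>\<close>. The coefficient of \<open>e\<close> in \<open>s\<^sub>i \<cdot> f\<close> is
  that of \<open>e \<circ> s\<^sub>i\<close> in \<open>f\<close>; \<open>map_key\<close> is precomposition, for injective maps.\<close>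

definition swap_vars :: "nat \<Rightarrow> int_poly \<Rightarrow> int_poly" where
  "swap_vars i f = Poly_Mapping.map_key (Poly_Mapping.map_key (transpose i (i + 1))) f"

text \<open>The quotient of \<open>f - s\<^sub>i \<cdot> f\<close> by \<open>x\<^sub>i - x\<^bsub>i+1\<^esub>\<close>, which exists and is unique.\<close>

definition divided_difference :: "nat \<Rightarrow> int_poly \<Rightarrow> int_poly" where
  "divided_difference i f = (THE g. (X i - X (i + 1)) * g = f - swap_vars i f)"


section \<open>Schubert polynomials\<close>

inductive is_schubert :: "nat \<Rightarrow> (nat \<Rightarrow> nat) \<Rightarrow> int_poly \<Rightarrow> bool" for m where
  longest: "is_schubert m (longest_perm m) (\<Prod>i\<in>{1..<m}. X i ^ (m - i))"
| descent: "is_schubert m w f \<Longrightarrow> i \<in> {1..<m} \<Longrightarrow> w i > w (i + 1) \<Longrightarrow>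
    is_schubert m (w \<circ> transpose i (i + 1)) (divided_difference i f)"

text \<open>For every \<open>w \<in> S\<^sub>m\<close> there is exactly one \<open>f\<close> with \<open>is_schubert m w f\<close>: the result does
  not depend on the descents chosen, since divided differences satisfy the braid relations.\<close>

definition schubert :: "nat \<Rightarrow> (nat \<Rightarrow> nat) \<Rightarrow> int_poly" where
  "schubert m w = (THE f. is_schubert m w f)"

text \<open>\<open>nu m u j = \<nu>\<^sub>u(j)\<close> for \<open>u \<in> S\<^sub>m\<close>.\<close>

definition nu :: "nat \<Rightarrow> (nat \<Rightarrow> nat) \<Rightarrow> nat \<Rightarrow> int" where
  "nu m u j = eval_poly (\<lambda>_. 1) (schubert (j + m) (shift_perm j u))"


section \<open>Labelings and standard Young tableaux\<close>

text \<open>Partitions are weakly decreasing lists of positive parts; a cell is a pair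
  (row, column), both counted from \<open>0\<close>.\<close>

definition cells :: "nat list \<Rightarrow> (nat \<times> nat) set" where
  "cells lam = {(r, c). r < length lam \<and> c < lam ! r}"

definition labeling :: "nat list \<Rightarrow> (nat \<times> nat \<Rightarrow> nat) \<Rightarrow> bool" where
  "labeling lam \<omega> \<longleftrightarrow> bij_betw \<omega> (cells lam) {1..sum_list lam}"

text \<open>Tableaux are extensional, i.e. \<open>undefined\<close> outside the diagram, so that each tableau is
  represented by exactly one function.\<close>

definition SYT :: "nat list \<Rightarrow> (nat \<times> nat \<Rightarrow> nat) set" where
  "SYT lam =
     {T \<in> extensional (cells lam).
        bij_betw T (cells lam) {1..sum_list lam} \<and>
        (\<forall>r c c'. c < c' \<and> (r, c) \<in> cells lam \<and> (r, c') \<in> cells lam \<longrightarrow> T (r, c) < T (r, c')) \<and>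
        (\<forall>r r' c. r < r' \<and> (r, c) \<in> cells lam \<and> (r', c) \<in> cells lam \<longrightarrow> T (r, c) < T (r', c))}"

definition des :: "nat list \<Rightarrow> (nat \<times> nat \<Rightarrow> nat) \<Rightarrow> (nat \<times> nat \<Rightarrow> nat) \<Rightarrow> nat" where
  "des lam \<omega> T =
     card {k \<in> {1..<sum_list lam}.
       \<omega> (inv_into (cells lam) T k) > \<omega> (inv_into (cells lam) T (k + 1))}"

end

theory Submission
  imports Defs "HOL-Library.Product_Lexorder"
begin

text \<open>The Schubert polynomial of a vexillary permutation is the generating function of the
  column-strict tableaux whose shape is the sorted code \<open>c\<close> and in which a row of length \<open>e\<close> has
  entries at most \<open>max {x. e \<le> c x}\<close>. This is shown by descending from the longest permutation
  along ascents that keep the code conditions: one divided difference removes a box from one row and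
  raises its flag by one. Replacing \<open>u\<close> by \<open>1\<^sup>j \<times> u\<close> raises all flags by \<open>j\<close>, so \<open>\<nu>\<^sub>u(j)\<close> counts
  tableaux with flags raised by \<open>j\<close>. Adding a suitable function of the content to the entries turns
  the flags into one common bound \<open>j + N\<close> and the tableaux into \<open>(P, \<omega>)\<close>-partitions, whose
  generating function is given by descents of linear extensions, i.e. of standard Young tableaux.
  Indecomposability makes one flag tight, so that there are no such partitions with bound below
  \<open>N\<close>.\<close>

section \<open>Divided differences\<close>

text \<open>The flags are not canonical, and the proof lives off this freedom. The flags read off
  the codes before and after a divided difference can differ in several rows, while the elementary
  computation changes one row only. In a block of rows of equal length, column-strictness makes
  large upper flags equivalent to flags growing by one from row to row; an auxiliary flag of this
  kind is equivalent to both.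

  The labeling comes from contents. A step to the right raises the content by one, a step down
  lowers it by one. Adding a function of the content with increments 0 or 1 therefore turns a weak
  or strict inequality into a weak or strict one, and the labeling only has to record the
  increments. Such a function with value minus the flag at each corner exists iff the corner flags
  satisfy a one-sided Lipschitz condition in the contents; the bound in \<open>vex_code\<close> on
  the number of smaller codes between two positions supplies it.

  The number N is the common bound at j = 0. The factor t^N can be split off because no partition
  has a smaller bound, and positivity of the coefficients then yields that every tableau has at
  least N descents.\<close>

lemma poly_mapping_single_induct [case_names zero add]:
  assumes "P 0" and "\<And>f k c. P f \<Longrightarrow> P (f + Poly_Mapping.single k c)"
  shows "P (f :: 'a \<Rightarrow>\<^sub>0 'b::comm_monoid_add)"
proof (induction f rule: update_induct)
  case (update f a b)
  have "Poly_Mapping.update a b f = f + Poly_Mapping.single a b"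
    using update.hyps
    by (intro poly_mapping_eqI)
      (auto simp: lookup_update lookup_add lookup_single when_def in_keys_iff)
  then show ?case using assms(2) update.IH by metis
qed (rule assms(1))

text \<open>Identities between compositions of ring maps, such as the braid relation for
  \<open>swap_vars\<close>, reduce in this way to a check on one variable.\<close>

lemma int_poly_induct [case_names const var add mult]:
  fixes f :: int_poly
  assumes const: "\<And>c. P (Poly_Mapping.single 0 c)" and var: "\<And>i. P (X i)"
    and add: "\<And>f g. P f \<Longrightarrow> P g \<Longrightarrow> P (f + g)" and mult: "\<And>f g. P f \<Longrightarrow> P g \<Longrightarrow> P (f * g)"
  shows "P f"
proof -
  have one: "P 1" using const[of 1] by simp
  have pow: "P (X i ^ k)" for i k
    by (induction k) (auto simp: one intro: mult var)
  have pow_eq: "Poly_Mapping.single (Poly_Mapping.single i k) 1 = X i ^ k" for i k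
  proof (induction k)
    case (Suc k)
    have "Poly_Mapping.single (Poly_Mapping.single i (Suc k)) (1::int) =
        X i * Poly_Mapping.single (Poly_Mapping.single i k) 1"
      by (simp add: X_def mult_single flip: single_add)
    then show ?case using Suc by simp
  qed (simp add: single_zero)
  have mono: "P (Poly_Mapping.single e c)" for e and c :: int
  proof (induction e rule: poly_mapping_single_induct)
    case (add e k v)
    have "Poly_Mapping.single (e + Poly_Mapping.single k v) c = Poly_Mapping.single e c * X k ^ v"
      by (simp add: mult_single flip: pow_eq)
    then show ?case using add mult pow by simp
  qed (rule const)
  show ?thesis
    by (induction f rule: poly_mapping_single_induct)
      (use const[of 0] mono add in \<open>auto simp: single_zero\<close>)
qed

text \<open>Both sides are biadditive in \<open>f\<close> and \<open>g\<close>, so monomials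
  suffice. Serves the variable exchange and the evaluation alike.\<close>

lemma additive_mult:
  fixes F :: "('a::monoid_add \<Rightarrow>\<^sub>0 'b::comm_semiring_0) \<Rightarrow> 'c::semiring_0"
  assumes zero: "F 0 = 0" and add: "\<And>f g. F (f + g) = F f + F g"
    and single: "\<And>k a l b. F (Poly_Mapping.single k a * Poly_Mapping.single l b) =
      F (Poly_Mapping.single k a) * F (Poly_Mapping.single l b)"
  shows "F (f * g) = F f * F g"
proof (induction f rule: poly_mapping_single_induct)
  case (add f k c)
  have "F (Poly_Mapping.single k c * g) = F (Poly_Mapping.single k c) * F g"
    by (induction g rule: poly_mapping_single_induct)
      (auto simp: zero single distrib_left assms(2))
  then show ?case using add by (simp add: distrib_right assms(2))
qed (simp add: zero)

section \<open>Action of adjacent transpositions on polynomials\<close>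

lemma inj_transpose: "inj (transpose a b)"
  by (metis injI transpose_involutory)

lemma lookup_map_key_transpose:
  "Poly_Mapping.lookup (Poly_Mapping.map_key (transpose a b) e) i = Poly_Mapping.lookup e (transpose a b i)"
  by (simp add: map_key.rep_eq inj_transpose)

lemma map_key_transpose_involutory:
  "Poly_Mapping.map_key (transpose a b) (Poly_Mapping.map_key (transpose a b) e) = e"
  by (rule poly_mapping_eqI) (simp add: lookup_map_key_transpose)

lemma inj_map_key_transpose:
  "inj (Poly_Mapping.map_key (transpose a b) :: ('a \<Rightarrow>\<^sub>0 'b::zero) \<Rightarrow> _)"
  by (metis injI map_key_transpose_involutory)

lemma swap_vars_add: "swap_vars i (f + g) = swap_vars i f + swap_vars i g"
  by (simp add: swap_vars_def map_key_plus inj_map_key_transpose)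

lemma swap_vars_zero [simp]: "swap_vars i 0 = 0"
  by (simp add: swap_vars_def inj_map_key_transpose)

lemma swap_vars_single:
  "swap_vars i (Poly_Mapping.single e c) =
   Poly_Mapping.single (Poly_Mapping.map_key (transpose i (i + 1)) e) c"
proof -
  have "Poly_Mapping.map_key (transpose i (i + 1)) (Poly_Mapping.map_key (transpose i (i + 1)) e) = e"
    by (rule map_key_transpose_involutory)
  then show ?thesis
    unfolding swap_vars_def by (metis map_key_single inj_map_key_transpose)
qed

lemma swap_vars_mult: "swap_vars i (f * g) = swap_vars i f * swap_vars i g"
  by (rule additive_mult)
    (simp_all add: swap_vars_add swap_vars_single mult_single map_key_plus inj_transpose)

lemma swap_vars_const [simp]: "swap_vars i (Poly_Mapping.single 0 c) = Poly_Mapping.single 0 c"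
  by (simp add: swap_vars_single inj_transpose)

lemma swap_vars_one [simp]: "swap_vars i 1 = 1"
  using swap_vars_const[of i 1] by simp

lemma swap_vars_uminus: "swap_vars i (- f) = - swap_vars i f"
  by (metis add.right_inverse add_eq_0_iff swap_vars_add swap_vars_zero)

lemma swap_vars_diff: "swap_vars i (f - g) = swap_vars i f - swap_vars i g"
  by (metis diff_conv_add_uminus swap_vars_add swap_vars_uminus)

lemma swap_vars_X [simp]: "swap_vars i (X k) = X (transpose i (i + 1) k)"
proof -
  have "Poly_Mapping.map_key (transpose i (i + 1)) (Poly_Mapping.single k (1::nat)) =
      Poly_Mapping.single (transpose i (i + 1) k) 1"
    by (rule poly_mapping_eqI)
      (auto simp: lookup_map_key_transpose lookup_single when_def transpose_def split: if_splits)
  then show ?thesis by (simp add: X_def swap_vars_single)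
qed

lemma swap_vars_involutory [simp]: "swap_vars i (swap_vars i f) = f"
  by (induction f rule: int_poly_induct) (simp_all add: swap_vars_add swap_vars_mult)

lemma swap_vars_commute:
  assumes "i + 1 < k"
  shows "swap_vars i (swap_vars k f) = swap_vars k (swap_vars i f)"
proof (induction f rule: int_poly_induct)
  case (var j)
  show ?case using assms by (simp add: transpose_def)
qed (simp_all add: swap_vars_add swap_vars_mult)

lemma swap_vars_braid:
  "swap_vars i (swap_vars (i + 1) (swap_vars i f)) =
   swap_vars (i + 1) (swap_vars i (swap_vars (i + 1) f))"
proof (induction f rule: int_poly_induct)
  case (var j)
  show ?case by (simp add: transpose_def)
qed (simp_all add: swap_vars_add swap_vars_mult)

section \<open>Divided differences and their relations\<close>

lemma X_inject [simp]: "X i = X k \<longleftrightarrow> i = k"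
proof
  assume "X i = X k"
  then have "Poly_Mapping.lookup (X i) (Poly_Mapping.single k 1) = 1"
    by (simp add: X_def)
  then have "Poly_Mapping.single i (1::nat) = Poly_Mapping.single k 1"
    by (simp add: X_def lookup_single when_def split: if_splits)
  then show "i = k"
    by (metis lookup_single_eq lookup_single_not_eq zero_neq_one)
qed simp

text \<open>Products are handled by the twisted Leibniz rule
  \<open>f * g - s f * s g = (f - s f) * g + s f * (g - s g)\<close>; for a variable the difference
  is zero or the divisor up to sign.\<close>

lemma divided_difference_exists: "(X i - X (i + 1)) dvd (f - swap_vars i f)"
proof (induction f rule: int_poly_induct)
  case (var k)
  have "(X i - X (i + 1)) dvd (X (i + 1) - X i)" by (rule dvdI[of _ _ "-1"]) simp
  then show ?case by (auto simp: transpose_def)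
next
  case (add f g)
  then have "(X i - X (i + 1)) dvd ((f - swap_vars i f) + (g - swap_vars i g))" by (rule dvd_add)
  then show ?case by (simp add: swap_vars_add algebra_simps)
next
  case (mult f g)
  then have "(X i - X (i + 1)) dvd ((f - swap_vars i f) * g + swap_vars i f * (g - swap_vars i g))"
    by (meson dvd_add dvd_mult dvd_mult2)
  then show ?case by (simp add: swap_vars_mult algebra_simps)
qed simp

text \<open>The quotient is unique because integer polynomials have no zero divisors and
  \<open>X i - X (i + 1)\<close> is nonzero.\<close>

lemma divided_difference_eqI:
  assumes "(X i - X (i + 1)) * g = f - swap_vars i f"
  shows "divided_difference i f = g"
  unfolding divided_difference_def
proof (rule the_equality)
  fix h assume "(X i - X (i + 1)) * h = f - swap_vars i f"
  then have "(X i - X (i + 1)) * h = (X i - X (i + 1)) * g" using assms by simp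
  then show "h = g" by (simp only: mult_cancel_left) simp
qed (rule assms)

lemma divided_difference_mult:
  "(X i - X (i + 1)) * divided_difference i f = f - swap_vars i f"
  using divided_difference_exists[of i f] divided_difference_eqI by (metis dvdE)

text \<open>\<open>swap_vars i\<close> negates both \<open>f - swap_vars i f\<close> and
  \<open>X i - X (i + 1)\<close>, hence fixes the quotient.\<close>

lemma swap_vars_divided_difference [simp]:
  "swap_vars i (divided_difference i f) = divided_difference i f"
proof (rule sym, rule divided_difference_eqI)
  have "swap_vars i ((X i - X (i + 1)) * divided_difference i f) = swap_vars i f - f"
    by (simp only: divided_difference_mult) (simp add: swap_vars_diff)
  then have "(X (i + 1) - X i) * swap_vars i (divided_difference i f) = swap_vars i f - f"
    by (simp add: swap_vars_mult swap_vars_diff)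
  then show "(X i - X (i + 1)) * swap_vars i (divided_difference i f) = f - swap_vars i f"
    by (simp add: algebra_simps)
qed

lemma swap_vars_divided_difference_far:
  assumes "i + 1 < k \<or> k + 1 < i"
  shows "swap_vars k (divided_difference i f) = divided_difference i (swap_vars k f)"
proof (rule sym, rule divided_difference_eqI)
  have "swap_vars k (X i - X (i + 1)) = X i - X (i + 1)"
    using assms by (auto simp: swap_vars_diff transpose_def)
  then have "(X i - X (i + 1)) * swap_vars k (divided_difference i f) =
      swap_vars k ((X i - X (i + 1)) * divided_difference i f)"
    by (simp add: swap_vars_mult)
  also have "\<dots> = swap_vars k f - swap_vars i (swap_vars k f)"
    using assms swap_vars_commute[of i k f] swap_vars_commute[of k i f]
    by (simp only: divided_difference_mult swap_vars_diff) metis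
  finally show "(X i - X (i + 1)) * swap_vars k (divided_difference i f) =
      swap_vars k f - swap_vars i (swap_vars k f)" .
qed

text \<open>Multiplied by both linear factors, either composition becomes
  \<open>f - s f - t f + s (t f)\<close>, and the distant exchanges \<open>s\<close> and
  \<open>t\<close> commute.\<close>

lemma divided_difference_commute:
  assumes "i + 1 < k"
  shows "divided_difference i (divided_difference k f) = divided_difference k (divided_difference i f)"
proof (rule divided_difference_eqI)
  let ?d = "divided_difference"
  have "(X k - X (k + 1)) * ((X i - X (i + 1)) * ?d k (?d i f)) =
      (X i - X (i + 1)) * ((X k - X (k + 1)) * ?d k (?d i f))" by (simp add: ac_simps)
  also have "\<dots> = (X i - X (i + 1)) * (?d i f - swap_vars k (?d i f))"
    by (simp only: divided_difference_mult)
  also have "\<dots> = (X i - X (i + 1)) * ?d i f - (X i - X (i + 1)) * ?d i (swap_vars k f)"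
    using assms by (simp add: swap_vars_divided_difference_far right_diff_distrib)
  also have "\<dots> = f - swap_vars i f - (swap_vars k f - swap_vars i (swap_vars k f))"
    by (simp only: divided_difference_mult)
  also have "\<dots> = (f - swap_vars k f) - (swap_vars i f - swap_vars k (swap_vars i f))"
    by (simp only: swap_vars_commute[OF assms]) (simp add: algebra_simps)
  also have "\<dots> = (X k - X (k + 1)) * ?d k f - (X k - X (k + 1)) * ?d k (swap_vars i f)"
    by (simp only: divided_difference_mult)
  also have "\<dots> = (X k - X (k + 1)) * (?d k f - swap_vars i (?d k f))"
    using assms by (simp add: swap_vars_divided_difference_far right_diff_distrib)
  finally show "(X i - X (i + 1)) * ?d k (?d i f) = ?d k f - swap_vars i (?d k f)"
    by (simp only: mult_cancel_left) simp
qed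

text \<open>Both sides of the braid relation are the antisymmetrization of \<open>f\<close> over \<open>S\<^sub>3\<close> divided by
  the Vandermonde product.\<close>

lemma divided_difference_braid:
  "divided_difference i (divided_difference (i + 1) (divided_difference i f)) =
   divided_difference (i + 1) (divided_difference i (divided_difference (i + 1) f))"
proof -
  define j where j: "j = i + 1"
  let ?d = "divided_difference" and ?s = "swap_vars i" and ?t = "swap_vars j"
  define x y z where "x = X i" and "y = X j" and "z = X (i + 2)"
  have [simp]: "?s x = y" "?s y = x" "?s z = z" "?t x = x" "?t y = z" "?t z = y"
    by (auto simp: x_def y_def z_def transpose_def j)
  have ds: "(x - y) * ?d i g = g - ?s g" for g
    using divided_difference_mult[of i g] by (simp add: x_def y_def j)
  have dt: "(y - z) * ?d j g = g - ?t g" for g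
    using divided_difference_mult[of j g] by (simp add: z_def y_def j)
  \<comment> \<open>\<open>?t\<close> carries \<open>x - y\<close> to \<open>x - z\<close>, so the
    defining equation of \<open>?d i\<close> turns into a relation with the third Vandermonde
    factor.\<close>
  have tds: "(x - z) * ?t (?d i g) = ?t g - ?t (?s g)" for g
  proof -
    have "?t ((x - y) * ?d i g) = ?t g - ?t (?s g)" by (simp only: ds swap_vars_diff)
    then show ?thesis by (simp add: swap_vars_mult swap_vars_diff)
  qed
  have sdt: "(x - z) * ?s (?d j g) = ?s g - ?s (?t g)" for g
  proof -
    have "?s ((y - z) * ?d j g) = ?s g - ?s (?t g)" by (simp only: dt swap_vars_diff)
    then show ?thesis by (simp add: swap_vars_mult swap_vars_diff)
  qed
  have 1: "(x - y) * (x - z) * (y - z) * ?d j (?d i g) =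
      (x - z) * (g - ?s g) - (x - y) * (?t g - ?t (?s g))" for g
  proof -
    have "(x - y) * (x - z) * (y - z) * ?d j (?d i g) =
        (x - y) * (x - z) * (?d i g - ?t (?d i g))" by (simp only: mult.assoc dt)
    also have "\<dots> = (x - z) * ((x - y) * ?d i g) - (x - y) * ((x - z) * ?t (?d i g))"
      by (simp add: algebra_simps)
    finally show ?thesis by (simp only: ds tds)
  qed
  have 2: "(x - y) * (x - z) * (y - z) * ?d i (?d j g) =
      (x - z) * (g - ?t g) - (y - z) * (?s g - ?s (?t g))" for g
  proof -
    have "(x - y) * (x - z) * (y - z) * ?d i (?d j g) =
        (x - z) * (y - z) * ((x - y) * ?d i (?d j g))" by (simp only: ac_simps)
    also have "\<dots> = (x - z) * (y - z) * (?d j g - ?s (?d j g))"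
      by (simp only: ds)
    also have "\<dots> = (x - z) * ((y - z) * ?d j g) - (y - z) * ((x - z) * ?s (?d j g))"
      by (simp add: algebra_simps)
    finally show ?thesis by (simp only: dt sdt)
  qed
  have sdsg: "?s (?d i g) = ?d i g" and tdtg: "?t (?d j g) = ?d j g" for g
    by (simp_all only: swap_vars_divided_difference)
  define V where "V = (x - y) * (x - z) * (y - z)"
  \<comment> \<open>Formula 2 at \<open>?d i f\<close> clears the two outer operators. The extra
    factor \<open>x - y\<close> clears the inner one; it reappears on the right and is cancelled at
    the end.\<close>
  have "(x - y) * (V * ?d i (?d j (?d i f))) =
      (x - y) * ((x - z) * (?d i f - ?t (?d i f)) - (y - z) * (?s (?d i f) - ?s (?t (?d i f))))"
    unfolding V_def by (simp only: 2)
  also have "\<dots> = (x - z) * ((x - y) * ?d i f) - (x - y) * ((x - z) * ?t (?d i f))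
      - (y - z) * ((x - y) * ?d i f) + (x - y) * ((y - z) * ?s (?t (?d i f)))"
    by (simp only: sdsg) (simp add: algebra_simps)
  also have "(y - z) * ?s (?t (?d i f)) = ?s (?t f) - ?s (?t (?s f))"
  proof -
    have "?s ((x - z) * ?t (?d i f)) = ?s (?t f) - ?s (?t (?s f))" by (simp only: tds swap_vars_diff)
    then show ?thesis by (simp add: swap_vars_mult swap_vars_diff)
  qed
  finally have A: "(x - y) * (V * ?d i (?d j (?d i f))) = (x - y) *
      (f - ?s f - ?t f + ?t (?s f) + ?s (?t f) - ?s (?t (?s f)))"
    by (simp only: ds tds) (simp add: algebra_simps)
  have "(y - z) * (V * ?d j (?d i (?d j f))) =
      (y - z) * ((x - z) * (?d j f - ?s (?d j f))
        - (x - y) * (?t (?d j f) - ?t (?s (?d j f))))"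
    unfolding V_def by (simp only: 1)
  also have "\<dots> = (x - z) * ((y - z) * ?d j f) - (y - z) * ((x - z) * ?s (?d j f))
      - (x - y) * ((y - z) * ?d j f) + (y - z) * ((x - y) * ?t (?s (?d j f)))"
    by (simp only: tdtg) (simp add: algebra_simps)
  also have "(x - y) * ?t (?s (?d j f)) = ?t (?s f) - ?t (?s (?t f))"
  proof -
    have "?t ((x - z) * ?s (?d j f)) = ?t (?s f) - ?t (?s (?t f))" by (simp only: sdt swap_vars_diff)
    then show ?thesis by (simp add: swap_vars_mult swap_vars_diff)
  qed
  finally have B: "(y - z) * (V * ?d j (?d i (?d j f))) = (y - z) *
      (f - ?s f - ?t f + ?t (?s f) + ?s (?t f) - ?t (?s (?t f)))"
    by (simp only: dt sdt) (simp add: algebra_simps)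
  have nz: "x - y \<noteq> 0" "y - z \<noteq> 0" "x - z \<noteq> 0" "V \<noteq> 0"
    by (auto simp: x_def y_def z_def V_def j)
  have "V * ?d i (?d j (?d i f)) = V * ?d j (?d i (?d j f))"
    using A B nz swap_vars_braid[of i f, folded j] by simp
  then show ?thesis using nz unfolding j[symmetric] by simp
qed

section \<open>Evaluation as a ring homomorphism\<close>

lemma eval_poly_superset:
  assumes "finite A" "Poly_Mapping.keys f \<subseteq> A"
  shows "eval_poly a f = (\<Sum>e\<in>A. Poly_Mapping.lookup f e *
    (\<Prod>i\<in>Poly_Mapping.keys e. a i ^ Poly_Mapping.lookup e i))"
  unfolding eval_poly_def
  by (rule sum.mono_neutral_left) (use assms in \<open>auto simp: in_keys_iff\<close>)

lemma eval_poly_add: "eval_poly a (f + g) = eval_poly a f + eval_poly a g"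
proof -
  let ?A = "Poly_Mapping.keys f \<union> Poly_Mapping.keys g"
  show ?thesis
    using keys_add[of f g]
    by (subst (1 2 3) eval_poly_superset[of ?A])
      (auto simp: lookup_add distrib_right sum.distrib)
qed

lemma eval_poly_zero [simp]: "eval_poly a 0 = 0"
  by (simp add: eval_poly_def)

lemma eval_poly_single:
  "eval_poly a (Poly_Mapping.single e c) =
   c * (\<Prod>i\<in>Poly_Mapping.keys e. a i ^ Poly_Mapping.lookup e i)"
  by (cases "c = 0") (auto simp: eval_poly_def)

lemma prod_keys_add:
  fixes a :: "nat \<Rightarrow> int" and d e :: "nat \<Rightarrow>\<^sub>0 nat"
  shows "(\<Prod>i\<in>Poly_Mapping.keys (d + e). a i ^ Poly_Mapping.lookup (d + e) i) =
    (\<Prod>i\<in>Poly_Mapping.keys d. a i ^ Poly_Mapping.lookup d i) *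
    (\<Prod>i\<in>Poly_Mapping.keys e. a i ^ Poly_Mapping.lookup e i)"
proof -
  let ?A = "Poly_Mapping.keys d \<union> Poly_Mapping.keys e"
  have *: "(\<Prod>i\<in>Poly_Mapping.keys h. a i ^ Poly_Mapping.lookup h i) =
      (\<Prod>i\<in>?A. a i ^ Poly_Mapping.lookup h i)" if "Poly_Mapping.keys h \<subseteq> ?A" for h
    by (rule prod.mono_neutral_left) (use that in \<open>auto simp: in_keys_iff\<close>)
  show ?thesis
    using keys_add[of d e]
    by (subst (1 2 3) *) (auto simp: lookup_add power_add prod.distrib)
qed

lemma eval_poly_mult: "eval_poly a (f * g) = eval_poly a f * eval_poly a g"
  by (rule additive_mult)
    (simp_all add: eval_poly_add eval_poly_single mult_single prod_keys_add)

lemma eval_poly_X [simp]: "eval_poly a (X i) = a i"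
  by (simp add: X_def eval_poly_single)

lemma eval_poly_one [simp]: "eval_poly a 1 = 1"
  using eval_poly_single[of a 0 1] by simp

section \<open>Existence and uniqueness of Schubert polynomials\<close>

lemma longest_perm_permutes: "longest_perm m permutes {1..m}"
proof (rule bij_imp_permutes)
  show "bij_betw (longest_perm m) {1..m} {1..m}"
    by (rule bij_betw_byWitness[where f' = "longest_perm m"]) (auto simp: longest_perm_def)
qed (auto simp: longest_perm_def)

text \<open>Strict decrease starting from \<open>w 1 \<le> m\<close> bounds \<open>w i\<close> above
  by \<open>m + 1 - i\<close>, and strict decrease ending at \<open>w m \<ge> 1\<close> bounds it
  below by the same number.\<close>

lemma longest_perm_unique:
  assumes perm: "w permutes {1..m}" and desc: "\<And>i. i \<in> {1..<m} \<Longrightarrow> w (i + 1) < w i"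
  shows "w = longest_perm m"
proof -
  have in_range: "1 \<le> w i \<and> w i \<le> m" if "1 \<le> i" "i \<le> m" for i
    using permutes_in_image[OF perm, of i] that by auto
  have upper: "w (Suc i) + Suc i \<le> m + 1" if "Suc i \<le> m" for i
    using that
  proof (induction i)
    case 0
    then show ?case using in_range[of 1] by auto
  next
    case (Suc i)
    then show ?case using desc[of "Suc i"] by auto
  qed
  have lower: "m - k \<ge> 1 \<Longrightarrow> w (m - k) \<ge> k + 1" for k
  proof (induction k)
    case 0
    then show ?case using in_range[of m] by auto
  next
    case (Suc k)
    then have "m - k = m - Suc k + 1" by auto
    then show ?case using Suc desc[of "m - Suc k"] by auto
  qed
  show ?thesis
  proof
    fix i
    show "w i = longest_perm m i"
    proof (cases "i \<in> {1..m}")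
      case True
      then show ?thesis using upper[of "i - 1"] lower[of "m - i"]
        by (auto simp: longest_perm_def)
    next
      case False
      then show ?thesis using permutes_not_in[OF perm] by (auto simp: longest_perm_def)
    qed
  qed
qed

lemma permutes_comp_adjacent:
  fixes m :: nat
  assumes "w permutes {1..m}" "i \<in> {1..<m}"
  shows "(w \<circ> transpose i (i + 1)) permutes {1..m}"
  using assms by (intro permutes_compose permutes_swap_id) auto

lemma is_schubert_permutes: "is_schubert m w f \<Longrightarrow> w permutes {1..m}"
proof (induction rule: is_schubert.induct)
  case (descent w f i)
  then show ?case by (intro permutes_comp_adjacent) auto
qed (rule longest_perm_permutes)

lemma comp_transpose_involutory [simp]: "w \<circ> transpose i k \<circ> transpose i k = w"
  by (simp add: comp_assoc)

lemma is_schubert_ascent: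
  assumes "is_schubert m (w \<circ> transpose i (i + 1)) f" "i \<in> {1..<m}" "w i < w (i + 1)"
  shows "is_schubert m w (divided_difference i f)"
  using is_schubert.descent[OF assms(1,2)] assms(3)
  by (metis comp_transpose_involutory comp_apply transpose_apply_first transpose_apply_second)

text \<open>A measure for inductions towards the longest permutation: exchanging the values at an
  ascent lowers it by \<open>w (i + 1) - w i\<close>. It stands in for the number of noninversions
  and needs no bijection between sets of pairs.\<close>

definition disorder :: "nat \<Rightarrow> (nat \<Rightarrow> nat) \<Rightarrow> nat" where
  "disorder m w = (\<Sum>i\<in>{1..m}. i * w i)"

lemma disorder_ascent:
  assumes i: "i \<in> {1..<m}" and asc: "w i < w (i + 1)"
  shows "disorder m (w \<circ> transpose i (i + 1)) < disorder m w"
proof -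
  let ?v = "w \<circ> transpose i (i + 1)"
  have split: "disorder m g = i * g i + (i + 1) * g (i + 1) + (\<Sum>k\<in>{1..m} - {i, i + 1}. k * g k)" for g
  proof -
    have "disorder m g = i * g i + (\<Sum>k\<in>{1..m} - {i}. k * g k)"
      unfolding disorder_def using i by (intro sum.remove) auto
    also have "(\<Sum>k\<in>{1..m} - {i}. k * g k) =
        (i + 1) * g (i + 1) + (\<Sum>k\<in>{1..m} - {i} - {i + 1}. k * g k)"
      using i by (intro sum.remove) auto
    finally show ?thesis by (simp add: Diff_insert2[symmetric] insert_commute)
  qed
  have "(\<Sum>k\<in>{1..m} - {i, i + 1}. k * ?v k) = (\<Sum>k\<in>{1..m} - {i, i + 1}. k * w k)"
    by (rule sum.cong) (auto simp: transpose_def)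
  then show ?thesis unfolding split[of ?v] split[of w] using asc by (simp add: algebra_simps)
qed

text \<open>A confluence argument: a polynomial for \<open>w\<close> comes from some ascent of
  \<open>w\<close>, and two different ascents are reconciled above both of them, by the braid
  relation if they are adjacent and by commutation otherwise.\<close>

lemma is_schubert_ex1:
  assumes "w permutes {1..m}"
  shows "\<exists>!f. is_schubert m w f"
  using assms
proof (induction "disorder m w" arbitrary: w rule: less_induct)
  case less
  note perm = less.prems
  let ?d = divided_difference
  have IH: "\<exists>!f. is_schubert m (w \<circ> p) f"
    if "(w \<circ> p) permutes {1..m}" "disorder m (w \<circ> p) < disorder m w" for p
    using less.hyps that by blast
  show ?case
  proof (cases "\<exists>i\<in>{1..<m}. w i < w (i + 1)")
    case False
    have "w i \<noteq> w (i + 1)" for i using permutes_inj[OF perm] by (metis injD n_not_Suc_n Suc_eq_plus1)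
    then have w: "w = longest_perm m"
      using False by (intro longest_perm_unique[OF perm]) (metis linorder_neqE_nat)
    have "f = (\<Prod>i\<in>{1..<m}. X i ^ (m - i))" if "is_schubert m w f" for f
      using that
    proof cases
      case (descent v g i)
      then have "w i < w (i + 1)" by simp
      then show ?thesis using False descent by blast
    qed simp
    then show ?thesis using is_schubert.longest[of m] w by blast
  next
    case True
    then obtain i where i: "i \<in> {1..<m}" "w i < w (i + 1)" by blast
    have ex: "\<exists>f. is_schubert m w f"
      using IH[OF permutes_comp_adjacent[OF perm i(1)] disorder_ascent[of i m w, OF i]]
        is_schubert_ascent[OF _ i] by blast
    \<comment> \<open>The last step of a derivation for \<open>w\<close> exposes an ascent of
      \<open>w\<close>; the rule \<open>longest\<close> is excluded because \<open>w\<close> has an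
      ascent.\<close>
    have inv: "\<exists>i h. i \<in> {1..<m} \<and> w i < w (i + 1) \<and>
        is_schubert m (w \<circ> transpose i (i + 1)) h \<and> f = ?d i h" if "is_schubert m w f" for f
      using that
    proof cases
      case longest
      then show ?thesis using i by (auto simp: longest_perm_def)
    next
      case (descent v g k)
      then show ?thesis by (intro exI[of _ k] exI[of _ g]) auto
    qed
    have confl: "?d i f = ?d k g"
      if i: "i \<in> {1..<m}" "w i < w (i + 1)" "is_schubert m (w \<circ> transpose i (i + 1)) f"
        and k: "k \<in> {1..<m}" "w k < w (k + 1)" "is_schubert m (w \<circ> transpose k (k + 1)) g"
        and "i < k" for i k f g
    proof (cases "k = i + 1")
      case k_eq: True
      let ?s = "transpose i (i + 1)" and ?t = "transpose k (k + 1)"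
      have perm1: "(w \<circ> ?s) permutes {1..m}" and perm2: "(w \<circ> ?t) permutes {1..m}"
        using permutes_comp_adjacent[OF perm] i k by blast+
      have perm3: "(w \<circ> ?s \<circ> ?t \<circ> ?s) permutes {1..m}"
        by (intro permutes_comp_adjacent perm i k)
      have eq: "w \<circ> ?s \<circ> ?t \<circ> ?s = w \<circ> ?t \<circ> ?s \<circ> ?t"
        by (rule ext) (simp add: k_eq transpose_def)
      have asc1: "(w \<circ> ?s) k < (w \<circ> ?s) (k + 1)" "(w \<circ> ?s \<circ> ?t) i < (w \<circ> ?s \<circ> ?t) (i + 1)"
        and asc2: "(w \<circ> ?t) i < (w \<circ> ?t) (i + 1)" "(w \<circ> ?t \<circ> ?s) k < (w \<circ> ?t \<circ> ?s) (k + 1)"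
        using i(2) k(2) by (auto simp: k_eq transpose_def)
      have d1: "disorder m (w \<circ> ?s) < disorder m w" and d2: "disorder m (w \<circ> ?t) < disorder m w"
        using disorder_ascent i k by blast+
      have "disorder m (w \<circ> ?s \<circ> ?t \<circ> ?s) < disorder m w"
        by (rule less_trans[OF disorder_ascent[OF i(1), of "w \<circ> ?s \<circ> ?t", OF asc1(2)]
              less_trans[OF disorder_ascent[OF k(1), of "w \<circ> ?s", OF asc1(1)] d1]])
      \<comment> \<open>Both ways of going up three ascents meet in one permutation with polynomial
        \<open>h\<close>. Uniqueness at \<open>w \<circ> ?s\<close> and at
        \<open>w \<circ> ?t\<close>, known by induction, expresses \<open>f\<close> and
        \<open>g\<close> through this same \<open>h\<close>.\<close>
      then obtain h where h: "is_schubert m (w \<circ> ?s \<circ> ?t \<circ> ?s) h"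
        using IH[of "?s \<circ> ?t \<circ> ?s"] perm3 unfolding comp_assoc by blast
      have "is_schubert m (w \<circ> ?s) (?d k (?d i h))"
        by (intro is_schubert_ascent h i(1) k(1) asc1)
      then have f: "f = ?d k (?d i h)" using IH[OF perm1 d1] i(3) by blast
      have "is_schubert m (w \<circ> ?t) (?d i (?d k h))"
        by (intro is_schubert_ascent i(1) k(1) asc2) (use h eq in simp)
      then have "g = ?d i (?d k h)" using IH[OF perm2 d2] k(3) by blast
      then show ?thesis using f divided_difference_braid[of i h] by (simp add: k_eq)
    next
      case False
      then have far: "i + 1 < k" using \<open>i < k\<close> by simp
      let ?s = "transpose i (i + 1)" and ?t = "transpose k (k + 1)"
      have perm1: "(w \<circ> ?s) permutes {1..m}" and perm2: "(w \<circ> ?t) permutes {1..m}"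
        using permutes_comp_adjacent[OF perm] i k by blast+
      have perm3: "(w \<circ> ?s \<circ> ?t) permutes {1..m}"
        by (intro permutes_comp_adjacent perm i k)
      have eq: "w \<circ> ?s \<circ> ?t = w \<circ> ?t \<circ> ?s"
        by (rule ext) (use far in \<open>auto simp: transpose_def\<close>)
      have asc: "(w \<circ> ?s) k < (w \<circ> ?s) (k + 1)" "(w \<circ> ?t) i < (w \<circ> ?t) (i + 1)"
        using i(2) k(2) far by (auto simp: transpose_def)
      have d1: "disorder m (w \<circ> ?s) < disorder m w" and d2: "disorder m (w \<circ> ?t) < disorder m w"
        using disorder_ascent i k by blast+
      have "disorder m (w \<circ> ?s \<circ> ?t) < disorder m w"
        by (rule less_trans[OF disorder_ascent[OF k(1), of "w \<circ> ?s", OF asc(1)] d1])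
      then obtain h where h: "is_schubert m (w \<circ> ?s \<circ> ?t) h"
        using IH[of "?s \<circ> ?t"] perm3 unfolding comp_assoc by blast
      have "is_schubert m (w \<circ> ?s) (?d k h)"
        by (intro is_schubert_ascent h i(1) k(1) asc)
      then have f: "f = ?d k h" using IH[OF perm1 d1] i(3) by blast
      have "is_schubert m (w \<circ> ?t) (?d i h)"
        by (intro is_schubert_ascent i(1) k(1) asc) (use h eq in simp)
      then have "g = ?d i h" using IH[OF perm2 d2] k(3) by blast
      then show ?thesis using f divided_difference_commute[OF far] by simp
    qed
    have "f = g" if "is_schubert m w f" "is_schubert m w g" for f g
    proof -
      obtain i f' where i: "i \<in> {1..<m}" "w i < w (i + 1)"
          "is_schubert m (w \<circ> transpose i (i + 1)) f'" "f = ?d i f'"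
        using inv[OF \<open>is_schubert m w f\<close>] by blast
      obtain k g' where k: "k \<in> {1..<m}" "w k < w (k + 1)"
          "is_schubert m (w \<circ> transpose k (k + 1)) g'" "g = ?d k g'"
        using inv[OF \<open>is_schubert m w g\<close>] by blast
      consider "i < k" | "k < i" | "i = k" by linarith
      then show ?thesis
      proof cases
        case 3
        then have "f' = g'"
          using IH[OF permutes_comp_adjacent[OF perm i(1)] disorder_ascent[of i m w, OF i(1,2)]] i k
          by blast
        then show ?thesis using 3 i k by simp
      qed (use confl i k in metis)+
    qed
    then show ?thesis using ex by blast
  qed
qed

lemma schubert_eqI: "is_schubert m w f \<Longrightarrow> schubert m w = f"
  unfolding schubert_def using is_schubert_ex1[OF is_schubert_permutes] by blast

section \<open>Codes of vexillary permutations\<close>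

text \<open>Both conditions are inherited by the code of \<open>w \<circ> s\<^sub>a\<close> for a suitable ascent \<open>a\<close>, so that
  pattern avoidance is used only once, to derive them for the given permutation.\<close>

definition vex_code :: "(nat \<Rightarrow> nat) \<Rightarrow> bool" where
  "vex_code c \<longleftrightarrow>
     (\<forall>i j. i < j \<longrightarrow> c j < c i \<longrightarrow> card {z \<in> {i<..<j}. c z < c j} \<le> c i - c j) \<and>
     (\<forall>i z j. i < z \<longrightarrow> z < j \<longrightarrow> c i \<le> c j \<longrightarrow> c i \<le> c z)"

lemma vex_code_card:
  "vex_code c \<Longrightarrow> i < j \<Longrightarrow> c j < c i \<Longrightarrow> card {z \<in> {i<..<j}. c z < c j} \<le> c i - c j"
  by (simp add: vex_code_def)

lemma vex_code_between:
  "vex_code c \<Longrightarrow> i < z \<Longrightarrow> z < j \<Longrightarrow> c i \<le> c j \<Longrightarrow> c i \<le> c z"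
  unfolding vex_code_def by blast

section \<open>From pattern avoidance to conditions on the code\<close>

lemma code_eq_0: "m < i \<Longrightarrow> code m u i = 0"
  by (simp add: code_def)

lemma code_0: "u permutes {1..m} \<Longrightarrow> code m u 0 = 0"
  using permutes_not_in[of u "{1..m}" 0] by (simp add: code_def)

lemma vexillary_no_pattern:
  assumes "vexillary m u" "1 \<le> i" "i < y" "y < j" "j < z" "z \<le> m" "u y < u i" "u i < u z"
  shows "u j \<le> u z"
proof (rule ccontr)
  assume "\<not> u j \<le> u z"
  then have "\<exists>i1\<in>{1..m}. \<exists>i2\<in>{1..m}. \<exists>i3\<in>{1..m}. \<exists>i4\<in>{1..m}.
          i1 < i2 \<and> i2 < i3 \<and> i3 < i4 \<and> u i2 < u i1 \<and> u i1 < u i4 \<and> u i4 < u i3"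
    using assms(2-) by (intro bexI[of _ i] bexI[of _ y] bexI[of _ j] bexI[of _ z]) auto
  then show False using assms(1) unfolding vexillary_def by blast
qed

lemma code_mono_subset:
  assumes "{y \<in> {i<..m}. u y < u i} \<subseteq> {y \<in> {j<..m}. u y < u j}"
  shows "code m u i \<le> code m u j"
  unfolding code_def by (rule card_mono) (use assms in auto)

text \<open>Suppose \<open>u z < u i\<close>. Then \<open>u i < u j\<close> by the codes, and a
  value after \<open>j\<close> below \<open>u j\<close> is even below \<open>u i\<close>, since
  otherwise it completes a 2143 pattern with the positions \<open>i\<close>, \<open>z\<close>,
  \<open>j\<close>. The inversions at \<open>j\<close> are thus inversions at \<open>i\<close>, and
  \<open>z\<close> is a further one.\<close>

lemma vexillary_code_le_between:
  assumes perm: "u permutes {1..m}" and vex: "vexillary m u"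
    and "1 \<le> i" "i < z" "z < j" "j \<le> m" and le: "code m u i \<le> code m u j"
  shows "u i < u z"
proof (rule ccontr)
  have inj: "u a = u b \<Longrightarrow> a = b" for a b
    using permutes_inj[OF perm] by (auto dest: injD)
  assume "\<not> u i < u z"
  then have uz: "u z < u i" using inj[of z i] \<open>i < z\<close> by fastforce
  have uj: "u i < u j"
  proof (rule ccontr)
    assume "\<not> u i < u j"
    then have "u j < u i" using inj[of j i] \<open>i < z\<close> \<open>z < j\<close> by fastforce
    then have "insert j {y \<in> {j<..m}. u y < u j} \<subseteq> {y \<in> {i<..m}. u y < u i}"
      using \<open>i < z\<close> \<open>z < j\<close> \<open>j \<le> m\<close> by auto
    then have "card (insert j {y \<in> {j<..m}. u y < u j}) \<le> code m u i"
      unfolding code_def by (intro card_mono) auto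
    then have "code m u j < code m u i"
      by (simp add: code_def)
    then show False using le by simp
  qed
  have "{y \<in> {j<..m}. u y < u j} \<subseteq> {y \<in> {i<..m}. u y < u i} - {z}"
  proof
    fix y assume y: "y \<in> {y \<in> {j<..m}. u y < u j}"
    then have "\<not> u i < u y"
      using vexillary_no_pattern[OF vex \<open>1 \<le> i\<close> \<open>i < z\<close> \<open>z < j\<close>, of y] uz by fastforce
    moreover have "u y \<noteq> u i" using inj[of y i] y \<open>i < z\<close> \<open>z < j\<close> by auto
    ultimately show "y \<in> {y \<in> {i<..m}. u y < u i} - {z}"
      using y \<open>i < z\<close> \<open>z < j\<close> by auto
  qed
  then have "code m u j \<le> card ({y \<in> {i<..m}. u y < u i} - {z})"
    unfolding code_def by (intro card_mono) auto
  also have "\<dots> < code m u i"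
    unfolding code_def by (rule card_Diff1_less) (use uz \<open>i < z\<close> \<open>z < j\<close> \<open>j \<le> m\<close> in auto)
  finally show False using le by simp
qed

text \<open>For the first condition, the inversions at \<open>j\<close> and the positions counted
  between \<open>i\<close> and \<open>j\<close> are shown to be disjoint sets of inversions at
  \<open>i\<close>.\<close>

lemma vexillary_vex_code:
  assumes perm: "u permutes {1..m}" and vex: "vexillary m u"
  shows "vex_code (code m u)"
  unfolding vex_code_def
proof (intro conjI allI impI)
  let ?c = "code m u"
  have inj: "u a = u b \<Longrightarrow> a = b" for a b
    using permutes_inj[OF perm] by (auto dest: injD)
  have between: "?c i \<le> ?c z" if "i < z" "z < j" "?c i \<le> ?c j" for i z j
  proof (cases "1 \<le> i \<and> j \<le> m")
    case True
    \<comment> \<open>Inversions at \<open>i\<close> can then only lie beyond \<open>z\<close>,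
      where they are inversions at \<open>z\<close> as well.\<close>
    then have "u i < u y" if "i < y" "y \<le> z" for y
      using vexillary_code_le_between[OF perm vex, of i y j] that \<open>i < z\<close> \<open>z < j\<close> \<open>?c i \<le> ?c j\<close> by simp
    then show ?thesis using \<open>i < z\<close> by (intro code_mono_subset) (force simp: not_le)
  next
    case False
    then have "?c i = 0"
      using code_0[OF perm] code_eq_0[of m j u] \<open>?c i \<le> ?c j\<close> by (cases "i = 0") auto
    then show ?thesis by simp
  qed
  show "?c i \<le> ?c z" if "i < z" "z < j" "?c i \<le> ?c j" for i z j
    using between that .
  fix i j assume ij: "i < j" and less: "?c j < ?c i"
  have i: "1 \<le> i" using code_0[OF perm] less by (cases i) auto
  show "card {z \<in> {i<..<j}. ?c z < ?c j} \<le> ?c i - ?c j"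
  proof (cases "j \<le> m")
    case False
    then show ?thesis using code_eq_0[of m j u] by simp
  next
    case j: True
    let ?Z = "{z \<in> {i<..<j}. ?c z < ?c j}" and ?B = "{y \<in> {j<..m}. u y < u j}"
      and ?D = "{y \<in> {j<..m}. u y < u i}" and ?I = "{y \<in> {i<..m}. u y < u i}"
    have ci: "?c i = card ?I" and cj: "?c j = card ?B" by (simp_all add: code_def)
    have Zj: "u z < u j" if "z \<in> ?Z" for z
    proof (rule ccontr)
      assume "\<not> u z < u j"
      then have "?c j \<le> ?c z" using that by (intro code_mono_subset) auto
      then show False using that by auto
    qed
    have sub: "?B \<union> ?Z \<subseteq> ?I"
    proof (cases "u i < u j")
      case True
      \<comment> \<open>The code drops from \<open>i\<close> to \<open>j\<close> although
        \<open>u i < u j\<close>, so some inversion at \<open>i\<close> lies before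
        \<open>j\<close>. By avoidance no value between \<open>u i\<close> and \<open>u j\<close>
        follows \<open>j\<close>, whence \<open>?B = ?D\<close>; a position of \<open>?Z\<close>
        with value above \<open>u i\<close> would have at least \<open>card ?D\<close>
        inversions.\<close>
      obtain y where y: "i < y" "y < j" "u y < u i"
      proof -
        have "\<not> ?I \<subseteq> ?B" using less card_mono[of ?B ?I] by (auto simp: ci cj)
        then obtain y where "y \<in> ?I" "y \<notin> ?B" by blast
        then show thesis using that[of y] True by (cases "y = j") auto
      qed
      have BD: "?B = ?D"
      proof (intro equalityI subsetI)
        fix z assume z: "z \<in> ?B"
        have "\<not> u i < u z"
          using vexillary_no_pattern[OF vex i y(1,2), of z] y z by fastforce
        moreover have "u z \<noteq> u i" using inj[of z i] z ij by auto
        ultimately show "z \<in> ?D" using z by auto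
      qed (use True in auto)
      have "u z < u i" if z: "z \<in> ?Z" for z
      proof (rule ccontr)
        assume "\<not> u z < u i"
        then have "?D \<subseteq> {y \<in> {z<..m}. u y < u z}" using z by auto
        then have "card ?D \<le> ?c z" unfolding code_def by (intro card_mono) auto
        then show False using BD z cj by simp
      qed
      then show ?thesis using ij j BD by auto
    next
      case False
      then show ?thesis using ij j Zj by fastforce
    qed
    have "card ?B + card ?Z = card (?B \<union> ?Z)"
      by (rule card_Un_disjoint[symmetric]) auto
    also have "\<dots> \<le> card ?I" by (rule card_mono) (use sub in auto)
    finally show ?thesis by (simp add: ci cj)
  qed
qed

section \<open>The code along ascents\<close>

lemma code_ascent:
  assumes a: "a \<in> {1..<m}" and asc: "w a < w (a + 1)"
  shows "code m (w \<circ> transpose a (a + 1)) = (code m w)(a := code m w (a + 1) + 1, a + 1 := code m w a)"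
proof
  fix i
  let ?s = "transpose a (a + 1)" let ?v = "w \<circ> ?s"
  consider "i = a" | "i = a + 1" | "i \<noteq> a" "i \<noteq> a + 1" by blast
  then show "code m ?v i = ((code m w)(a := code m w (a + 1) + 1, a + 1 := code m w a)) i"
  proof cases
    case 1
    have "{j \<in> {a<..m}. ?v j < ?v a} = insert (a + 1) {j \<in> {a + 1<..m}. w j < w (a + 1)}"
    proof (intro set_eqI)
      fix x
      consider "x \<le> a" | "x = a + 1" | "a + 1 < x" by linarith
      then show "x \<in> {j \<in> {a<..m}. ?v j < ?v a} \<longleftrightarrow>
          x \<in> insert (a + 1) {j \<in> {a + 1<..m}. w j < w (a + 1)}"
        by cases (use a asc in \<open>auto simp: transpose_def\<close>)
    qed
    then show ?thesis using 1 by (simp add: code_def)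
  next
    case 2
    have "{j \<in> {a + 1<..m}. ?v j < ?v (a + 1)} = {j \<in> {a<..m}. w j < w a}"
    proof (intro set_eqI)
      fix x
      consider "x \<le> a" | "x = a + 1" | "a + 1 < x" by linarith
      then show "x \<in> {j \<in> {a + 1<..m}. ?v j < ?v (a + 1)} \<longleftrightarrow> x \<in> {j \<in> {a<..m}. w j < w a}"
        by cases (use a asc in \<open>auto simp: transpose_def\<close>)
    qed
    then show ?thesis using 2 by (simp add: code_def)
  next
    case 3
    then have "?v i = w i" by simp
    have "bij_betw ?s {j \<in> {i<..m}. ?v j < ?v i} {j \<in> {i<..m}. w j < w i}"
      by (rule bij_betw_byWitness[where f' = ?s])
        (use 3 a in \<open>auto simp: transpose_def\<close>)
    then show ?thesis using 3 bij_betw_same_card by (simp add: code_def)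
  qed
qed

text \<open>Ascents are visible in the code, so that choosing one becomes a question about codes
  alone.\<close>

lemma code_less_iff:
  assumes a: "a \<in> {1..<m}" and perm: "w permutes {1..m}"
  shows "w a < w (a + 1) \<longleftrightarrow> code m w a \<le> code m w (a + 1)"
proof (cases "w a < w (a + 1)")
  case True
  have "code m w a \<le> code m w (a + 1)"
  proof (rule code_mono_subset, rule subsetI)
    fix x assume "x \<in> {y \<in> {a<..m}. w y < w a}"
    moreover from this have "x \<noteq> a + 1" using True by auto
    ultimately show "x \<in> {y \<in> {a + 1<..m}. w y < w (a + 1)}" using True by auto
  qed
  then show ?thesis using True by simp
next
  case False
  moreover have "w a \<noteq> w (a + 1)" using permutes_inj[OF perm] by (metis injD n_not_Suc_n Suc_eq_plus1)
  ultimately have less: "w (a + 1) < w a" by simp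
  have "{j \<in> {a + 1<..m}. w j < w (a + 1)} \<subset> {j \<in> {a<..m}. w j < w a}"
  proof (rule psubsetI)
    show "{j \<in> {a + 1<..m}. w j < w (a + 1)} \<noteq> {j \<in> {a<..m}. w j < w a}"
    proof
      assume "{j \<in> {a + 1<..m}. w j < w (a + 1)} = {j \<in> {a<..m}. w j < w a}"
      moreover have "a + 1 \<in> {j \<in> {a<..m}. w j < w a}" using less a by simp
      ultimately have "a + 1 \<in> {j \<in> {a + 1<..m}. w j < w (a + 1)}" by simp
      then show False by simp
    qed
  qed (use less in auto)
  then have "code m w (a + 1) < code m w a" unfolding code_def by (intro psubset_card_mono) auto
  then show ?thesis using False by simp
qed

text \<open>Write \<open>k = c (a + 1)\<close>. Codes above \<open>k\<close> all lie to the left of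
  \<open>a\<close>, and the codes equal to \<open>k\<close> fill an interval of positions starting
  at \<open>a\<close> or \<open>a + 1\<close>; position 0, of code 0 by convention, is exempt. If
  \<open>k + 1\<close> occurs before \<open>a\<close>, then position \<open>a - 1\<close> has a code
  above \<open>k\<close>. Codes strictly between \<open>c a\<close> and \<open>k\<close> do not
  occur before \<open>a\<close>. These facts determine the flags of all rows near the one that
  changes.\<close>

definition good_ascent :: "(nat \<Rightarrow> nat) \<Rightarrow> nat \<Rightarrow> bool" where
  "good_ascent c a \<longleftrightarrow> c a \<le> c (a + 1) \<and>
     (\<forall>y>a + 1. c y \<le> c (a + 1)) \<and>
     (\<forall>x<a. c x \<le> c a \<or> c (a + 1) < c x) \<and>
     (\<forall>x<a. 1 \<le> x \<longrightarrow> c x \<noteq> c (a + 1)) \<and>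
     (\<forall>x<a. c x = c (a + 1) + 1 \<longrightarrow> c (a + 1) < c (a - 1)) \<and>
     (\<forall>y z. a + 1 < z \<longrightarrow> z < y \<longrightarrow> c y = c (a + 1) \<longrightarrow> c z = c (a + 1))"

text \<open>If the code increases strictly somewhere after position 0, the chosen place has the
  largest top value \<open>c (a + 1)\<close>; otherwise the code is weakly decreasing from 1 on and
  the first repetition is chosen.\<close>

lemma ex_good_ascent:
  assumes c: "vex_code c" and c0: "c 0 = 0" and cm: "\<And>x. m < x \<Longrightarrow> c x = 0"
    and ex: "b \<in> {1..<m}" "c b \<le> c (b + 1)"
  shows "\<exists>a\<in>{1..<m}. good_ascent c a \<and> vex_code (c(a := c (a + 1) + 1, a + 1 := c a))"
proof (cases "\<exists>a\<ge>1. c a < c (a + 1)")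
  case True
  let ?A = "{a. 1 \<le> a \<and> c a < c (a + 1)}"
  have "a \<le> m" if "c a < c (a + 1)" for a using that cm[of "a + 1"] by (cases "m < a + 1") auto
  then have "?A \<subseteq> {..m}" by auto
  then have fin: "finite ?A" by (rule finite_subset) simp
  define k where "k = Max ((\<lambda>a. c (a + 1)) ` ?A)"
  have "k \<in> (\<lambda>a. c (a + 1)) ` ?A" unfolding k_def using True fin by (intro Max_in) auto
  then obtain a where a: "1 \<le> a" "c a < c (a + 1)" "k = c (a + 1)" by blast
  have max: "c (b + 1) \<le> k" if "1 \<le> b" "c b < c (b + 1)" for b
    unfolding k_def using fin that by (intro Max_ge) auto
  define l where "l = c a"
  have lk: "l < k" using a by (simp add: l_def)
  have am: "a < m" using cm[of "a + 1"] a by (cases "a < m") auto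
  \<comment> \<open>Climbing above \<open>k\<close> after \<open>a\<close> would need a strict
    increase with a larger top.\<close>
  have step_le: "c (a + 1 + d) \<le> k" for d
  proof (induction d)
    case (Suc d)
    show ?case
    proof (rule ccontr)
      assume "\<not> ?thesis"
      then show False using max[of "a + 1 + d"] Suc by simp
    qed
  qed (simp add: a)
  have after_le: "c y \<le> k" if "a < y" for y
    using step_le[of "y - (a + 1)"] that by simp
  have after_eq: "c z = k" if "a < z" "z < y" "c y = k" for y z
  proof (cases "z = a + 1")
    case False
    then have "k \<le> c z" using vex_code_between[OF c, of "a + 1" z y] that a by simp
    then show ?thesis using after_le[of z] that by linarith
  qed (simp add: a)
  have before: "c x \<le> l \<or> k < c x" if "x < a" for x
    using vex_code_between[OF c, of x a "a + 1"] that a by (force simp: l_def)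
  have few: "card {z \<in> {x<..<a + 1}. c z < k} \<le> c x - k" if "x < a" "k < c x" for x
    using vex_code_card[OF c, of x "a + 1"] that a by simp
  \<comment> \<open>Position \<open>a\<close> itself is counted by \<open>few\<close>, because
    \<open>c a < k\<close>. This leaves one unit of room for the new code \<open>k + 1\<close> at
    \<open>a\<close>; the gap in \<open>before\<close> allows \<open>c z \<le> k\<close> in place of
    \<open>c z < k\<close>.\<close>
  have few': "card {z \<in> {x<..<a}. c z \<le> k} + 1 \<le> c x - k" if "x < a" "k < c x" for x
  proof -
    have "insert a {z \<in> {x<..<a}. c z \<le> k} \<subseteq> {z \<in> {x<..<a + 1}. c z < k}"
      using before that a lk by (force simp: l_def)
    then have "card (insert a {z \<in> {x<..<a}. c z \<le> k}) \<le> card {z \<in> {x<..<a + 1}. c z < k}"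
      by (intro card_mono) auto
    then show ?thesis using few[OF that] by simp
  qed
  have top_run: "k < c z" if "x < a" "c x = k + 1" "x < z" "z < a" for x z
  proof (rule ccontr)
    assume "\<not> k < c z"
    then have "card {z} \<le> card {z \<in> {x<..<a}. c z \<le> k}"
      using that by (intro card_mono) auto
    then have "1 \<le> card {z \<in> {x<..<a}. c z \<le> k}" by simp
    then show False using few'[of x] that by linarith
  qed
  have good: "good_ascent c a"
    unfolding good_ascent_def
  proof (intro conjI allI impI)
    show "c a \<le> c (a + 1)" using a by simp
    show "c (a + 1) < c (a - 1)" if "x < a" "c x = c (a + 1) + 1" for x
      using top_run[of x "a - 1"] that a by (cases "x = a - 1") auto
    show "c y \<le> c (a + 1)" if "a + 1 < y" for y using after_le[of y] that a by simp
    show "c x \<le> c a \<or> c (a + 1) < c x" if "x < a" for x using before[OF that] a by (simp add: l_def)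
    show "c x \<noteq> c (a + 1)" if "x < a" for x using before[OF that] a lk by auto
    show "c z = c (a + 1)" if "a + 1 < z" "z < y" "c y = c (a + 1)" for y z
      using after_eq[of z y] that a by simp
  qed
  let ?v = "c(a := c (a + 1) + 1, a + 1 := c a)"
  have va: "?v a = k + 1" "?v (a + 1) = l" by (simp_all add: a l_def)
  have vo: "?v x = c x" if "x \<noteq> a" "x \<noteq> a + 1" for x using that by simp
  define v where "v = ?v"
  note va = va[folded v_def] and vo = vo[folded v_def]
  have ca: "c a = l" "c (a + 1) = k" using a l_def by auto
  have "vex_code v"
    unfolding vex_code_def
  proof (intro conjI allI impI)
    fix i z j assume ij: "i < z" "z < j" "v i \<le> v j"
    consider "i = a" | "i = a + 1" | "a + 1 < i" | "i < a" "j < a" | "i < a" "j = a"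
      | "i < a" "j = a + 1" | "i < a" "a + 1 < j" by linarith
    then show "v i \<le> v z"
    proof cases
      case 1
      then show ?thesis using ij after_le[of j] va vo[of j] by (cases "j = a + 1") auto
    next
      case 2
      then show ?thesis using ij va vo vex_code_between[OF c, of a z j] ca by simp
    next
      case 3
      then show ?thesis using ij vo vex_code_between[OF c, of i z j] by simp
    next
      case 4
      then show ?thesis using ij vo vex_code_between[OF c, of i z j] by simp
    next
      case 5
      then have "c i \<le> k + 1" using ij va vo by simp
      then consider "c i = k + 1" | "c i \<le> l" using before[of i] 5 by force
      then show ?thesis
      proof cases
        case 1
        then show ?thesis using \<open>i < a\<close> ij 5 top_run[of i z] vo by simp
      next
        case 2
        then show ?thesis using ij 5 vo vex_code_between[OF c, of i z a] ca by simp
      qed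
    next
      case 6
      then have "c i \<le> l" using ij va vo by simp
      then show ?thesis using ij 6 vo va lk vex_code_between[OF c, of i z a] ca
        by (cases "z = a") auto
    next
      case 7
      have cij: "c i \<le> c j" using ij 7 vo by simp
      then have "c i \<le> k" using after_le[of j] 7 by simp
      moreover have "c i \<le> l" using vex_code_between[OF c, of i a j] ca cij 7 by simp
      ultimately show ?thesis using ij 7 vo va vex_code_between[OF c, of i z j] cij
        by (cases "z = a \<or> z = a + 1") auto
    qed
  next
    fix i j assume ij: "i < j" "v j < v i"
    let ?Z = "{z \<in> {i<..<j}. v z < v j}"
    consider "i = a" "j = a + 1" | "i = a" "a + 1 < j" | "i = a + 1" | "a + 1 < i" | "i < a" "j < a" | "i < a" "j = a"
      | "i < a" "j = a + 1" | "i < a" "a + 1 < j" using ij by linarith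
    then show "card ?Z \<le> v i - v j"
    proof cases
      case 1
      then have "?Z = {}" by auto
      then show ?thesis by (simp only: card.empty)
    next
      case 2
      have vj: "v j = c j" using vo 2 by simp
      have "c j \<le> k" using after_le[of j] 2 by simp
      have "card {z \<in> {a + 1<..<j}. c z < c j} \<le> k - c j"
      proof (cases "c j = k")
        case True
        then have "\<not> c z < c j" if "z \<in> {a + 1<..<j}" for z using after_eq[of z j] that by simp
        then have "{z \<in> {a + 1<..<j}. c z < c j} = {}" by blast
        then show ?thesis by (simp only: card.empty)
      next
        case False
        then show ?thesis using vex_code_card[OF c, of "a + 1" j] ca \<open>c j \<le> k\<close> 2 by simp
      qed
      \<comment> \<open>The new code at \<open>a\<close> is \<open>k + 1\<close> and not
        \<open>k\<close>; the additional unit pays for position \<open>a + 1\<close>.\<close>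
      moreover have "?Z \<subseteq> insert (a + 1) {z \<in> {a + 1<..<j}. c z < c j}"
      proof
        fix z assume "z \<in> ?Z"
        then show "z \<in> insert (a + 1) {z \<in> {a + 1<..<j}. c z < c j}"
          using 2 vo[of z] vj by (cases "z = a + 1") auto
      qed
      then have "card ?Z \<le> card (insert (a + 1) {z \<in> {a + 1<..<j}. c z < c j})"
        by (intro card_mono) auto
      ultimately show ?thesis using 2 va vj \<open>c j \<le> k\<close> by simp
    next
      case 3
      have "?Z \<subseteq> {z \<in> {a<..<j}. c z < c j}" using 3 ij vo by auto
      then have "card ?Z \<le> card {z \<in> {a<..<j}. c z < c j}" by (intro card_mono) auto
      also have "\<dots> \<le> l - c j" using vex_code_card[OF c, of a j] ij 3 va vo ca by simp
      finally show ?thesis using 3 va vo ij by simp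
    next
      case 4
      then have "?Z = {z \<in> {i<..<j}. c z < c j}" using vo ij by auto
      then show ?thesis using vex_code_card[OF c, of i j] ij vo 4 by simp
    next
      case 5
      then have "?Z = {z \<in> {i<..<j}. c z < c j}" using vo ij by auto
      then show ?thesis using vex_code_card[OF c, of i j] ij vo 5 by simp
    next
      case 6
      then have Z: "?Z \<subseteq> {z \<in> {i<..<a}. c z \<le> k}" using vo va ij by auto
      then have "card ?Z \<le> card {z \<in> {i<..<a}. c z \<le> k}" by (intro card_mono) auto
      then show ?thesis using few'[of i] 6 vo va ij by simp
    next
      case 7
      have "?Z \<subseteq> {z \<in> {i<..<a}. c z < l}"
      proof
        fix z assume "z \<in> ?Z"
        then show "z \<in> {z \<in> {i<..<a}. c z < l}"
          using 7 vo[of z] va lk by (cases "z = a") auto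
      qed
      then have "card ?Z \<le> card {z \<in> {i<..<a}. c z < l}" by (intro card_mono) auto
      then show ?thesis using vex_code_card[OF c, of i a] 7 vo va ij ca by simp
    next
      case 8
      \<comment> \<open>The window contains both \<open>a\<close> and \<open>a + 1\<close>. Since
        \<open>c j \<le> k\<close>, neither \<open>k\<close> nor \<open>k + 1\<close> is below
        \<open>c j\<close>, so the exchange of the two positions preserves the count.\<close>
      let ?s = "transpose a (a + 1)"
      have cj: "c j \<le> k" using after_le[of j] 8 by simp
      have vj: "v j = c j" using vo 8 by simp
      have in_range: "?s z \<in> {i<..<j} \<longleftrightarrow> z \<in> {i<..<j}" for z
        using 8 by (simp add: transpose_def)
      have swap: "v z < c j \<longleftrightarrow> c (?s z) < c j" for z
        using va ca cj vo[of z] by (simp add: transpose_def)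
      have "bij_betw ?s ?Z {z \<in> {i<..<j}. c z < c j}"
      proof (rule bij_betw_byWitness[where f' = ?s])
        show "?s ` ?Z \<subseteq> {z \<in> {i<..<j}. c z < c j}"
          unfolding vj swap using in_range by blast
        show "?s ` {z \<in> {i<..<j}. c z < c j} \<subseteq> ?Z"
        proof
          fix y assume "y \<in> ?s ` {z \<in> {i<..<j}. c z < c j}"
          then obtain z where z: "y = ?s z" "z \<in> {i<..<j}" "c z < c j" by blast
          then show "y \<in> ?Z" using in_range[of z] swap[of y] vj by simp
        qed
      qed simp_all
      then have "card ?Z = card {z \<in> {i<..<j}. c z < c j}" by (rule bij_betw_same_card)
      then show ?thesis using vex_code_card[OF c, of i j] ij vo 8 by simp
    qed
  qed
  moreover have "a \<in> {1..<m}" using a(1) am by simp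
  ultimately show ?thesis using good unfolding v_def by blast
next
  case False
  have dec1: "c (x + 1) \<le> c x" if "1 \<le> x" for x using False that by (force simp: not_less)
  have dec: "c y \<le> c x" if "1 \<le> x" "x \<le> y" for x y
    using that(2,1)
  proof (induction y rule: dec_induct)
    case (step n)
    then show ?case using dec1[of n] by simp
  qed simp
  \<comment> \<open>Before the first plateau the code decreases strictly, so raising
    \<open>c a\<close> by one keeps it weakly decreasing and both code conditions become
    immediate.\<close>
  define a where "a = (LEAST a. 1 \<le> a \<and> c a = c (a + 1))"
  have b: "1 \<le> b \<and> c b = c (b + 1)" using ex dec1[of b] by simp
  have a: "1 \<le> a" "c a = c (a + 1)"
    using LeastI[of "\<lambda>a. 1 \<le> a \<and> c a = c (a + 1)", OF b] unfolding a_def by blast+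
  have ab: "a \<le> b"
    unfolding a_def by (rule Least_le) (rule b)
  have min: "c (x + 1) < c x" if "1 \<le> x" "x < a" for x
    using not_less_Least[of x "\<lambda>a. 1 \<le> a \<and> c a = c (a + 1)", folded a_def] that dec1[of x]
    by (simp add: order_less_le)
  have big: "c a < c x" if "1 \<le> x" "x < a" for x
    using min[of x] that dec[of "x + 1" a] by simp
  have low: "c x = 0 \<or> c a < c x" if "x < a" for x
    using that c0 big[of x] by (cases x) auto
  have good: "good_ascent c a"
    unfolding good_ascent_def
  proof (intro conjI allI impI)
    show "c z = c (a + 1)" if "a + 1 < z" "z < y" "c y = c (a + 1)" for y z
      using dec[of "a + 1" z] dec[of z y] that a by simp
    show "c y \<le> c (a + 1)" if "a + 1 < y" for y using dec[of "a + 1" y] that by simp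
    show "c (a + 1) < c (a - 1)" if "x < a" "c x = c (a + 1) + 1" for x
      using big[of "a - 1"] a that c0 by (cases "a = 1") auto
    show "c x \<le> c a \<or> c (a + 1) < c x" if "x < a" for x using low[OF that] a by auto
    show "c x \<noteq> c (a + 1)" if "x < a" "1 \<le> x" for x using big[of x] that a by simp
  qed (use a in auto)
  define v where "v = c(a := c (a + 1) + 1, a + 1 := c a)"
  have v: "v a = c a + 1" "v (a + 1) = c a" "x \<noteq> a \<Longrightarrow> x \<noteq> a + 1 \<Longrightarrow> v x = c x" for x
    using a by (auto simp: v_def)
  have v0: "v 0 = 0" using a c0 by (simp add: v_def)
  have vdec1: "v (x + 1) \<le> v x" if "1 \<le> x" for x
  proof -
    consider "x = a" | "x = a + 1" | "x + 1 = a" | "x \<noteq> a" "x \<noteq> a + 1" "x + 1 \<noteq> a" by blast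
    then show ?thesis
    proof cases
      case 1
      then show ?thesis using v(1,2) by simp
    next
      case 2
      then show ?thesis using v(2) v(3)[of "a + 2"] dec[of a "a + 2"] a(1) by simp
    next
      case 3
      then show ?thesis using v(1) v(3)[of x] big[OF that] by simp
    next
      case 4
      then show ?thesis using v(3)[of x] v(3)[of "x + 1"] dec1[OF that] by simp
    qed
  qed
  have vdec: "v y \<le> v x" if "1 \<le> x" "x \<le> y" for x y
    using that(2,1)
  proof (induction y rule: dec_induct)
    case (step n)
    then show ?case using vdec1[of n] by simp
  qed simp
  have "vex_code v"
    unfolding vex_code_def
  proof (intro conjI allI impI)
    fix i z j assume "i < z" "z < j" "v i \<le> v j"
    then show "v i \<le> v z" using vdec[of z j] v0 by (cases i) auto
  next
    fix i j :: nat assume "i < j" "v j < v i"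
    have "\<not> v z < v j" if "z \<in> {i<..<j}" for z using vdec[of z j] that by simp
    then have "{z \<in> {i<..<j}. v z < v j} = {}" by blast
    then show "card {z \<in> {i<..<j}. v z < v j} \<le> v i - v j" by (simp only: card.empty)
  qed
  moreover have "a \<in> {1..<m}" using a(1) ab ex(1) by simp
  ultimately show ?thesis using good unfolding v_def by blast
qed

section \<open>Flagged Schur functions\<close>

text \<open>Removing the entries \<open>v\<close> from a column-strict tableau of shape \<open>mu\<close> with entries at most \<open>v\<close>
  leaves a shape in \<open>strips phi v mu\<close> if the entries of row \<open>r\<close> are bounded by \<open>phi r\<close>.\<close>

definition strips :: "(nat \<Rightarrow> nat) \<Rightarrow> nat \<Rightarrow> (nat \<Rightarrow> nat) \<Rightarrow> (nat \<Rightarrow> nat) set" where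
  "strips phi v mu =
     {kap. \<forall>r. mu (Suc r) \<le> kap r \<and> kap r \<le> mu r \<and> (phi r < v \<longrightarrow> kap r = mu r)}"

text \<open>The flagged Schur polynomial, given by its branching rule: the letter \<open>v\<close>
  is peeled off as a horizontal strip. \<open>L\<close> is a number of rows beyond which shapes are
  empty. This form isolates two consecutive letters, on which a divided difference acts.\<close>

primrec flagged :: "(nat \<Rightarrow> 'a::comm_ring_1) \<Rightarrow> nat \<Rightarrow> (nat \<Rightarrow> nat) \<Rightarrow> nat \<Rightarrow> (nat \<Rightarrow> nat) \<Rightarrow> 'a"
where
  "flagged x L phi 0 mu = (if \<forall>r. mu r = 0 then 1 else 0)"
| "flagged x L phi (Suc v) mu =
     (\<Sum>kap\<in>strips phi (Suc v) mu. (\<Prod>r<L. x (Suc v) ^ (mu r - kap r)) * flagged x L phi v kap)"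

lemma finite_bounded_rows:
  assumes "\<And>r. L \<le> r \<Longrightarrow> mu r = 0"
  shows "finite {kap::nat \<Rightarrow> nat. \<forall>r. kap r \<le> mu r}"
proof (rule finite_subset)
  show "{kap. \<forall>r. kap r \<le> mu r} \<subseteq> {f. \<forall>x. (x \<in> {..<L} \<longrightarrow> f x \<in> {..Max (mu ` {..<L})}) \<and> (x \<notin> {..<L} \<longrightarrow> f x = 0)}"
  proof (clarify, intro conjI impI)
    fix kap x assume le: "\<forall>r. kap r \<le> mu r"
    show "kap x \<in> {..Max (mu ` {..<L})}" if "x \<in> {..<L}"
    proof -
      have "mu x \<le> Max (mu ` {..<L})" using that by (intro Max_ge) auto
      then show ?thesis using le order_trans by blast
    qed
    show "kap x = 0" if "x \<notin> {..<L}"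
      using assms[of x] le that by (metis le_zero_eq lessThan_iff not_le)
  qed
  show "finite {f. \<forall>x. (x \<in> {..<L} \<longrightarrow> f x \<in> {..Max (mu ` {..<L})}) \<and> (x \<notin> {..<L} \<longrightarrow> f x = (0::nat))}"
    by (rule finite_set_of_finite_funs) auto
qed

lemma finite_strips:
  assumes "\<And>r. L \<le> r \<Longrightarrow> mu r = 0"
  shows "finite (strips phi v mu)"
  by (rule finite_subset[OF _ finite_bounded_rows[OF assms]]) (auto simp: strips_def)

lemma strips_eq_0:
  assumes "kap \<in> strips phi v mu" "mu r = 0"
  shows "kap r = 0"
  using assms by (auto simp: strips_def) (metis le_zero_eq)

text \<open>Applied to the exchange of two variables and to the evaluation at ones.\<close>

lemma flagged_hom:
  assumes "h 0 = 0" "h 1 = 1" "\<And>f g. h (f + g) = h f + h g" "\<And>f g. h (f * g) = h f * h g"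
  shows "h (flagged x L phi v mu) = flagged (\<lambda>i. h (x i)) L phi v mu"
proof -
  have hsum: "h (sum f A) = (\<Sum>a\<in>A. h (f a))" for f and A :: "(nat \<Rightarrow> nat) set"
    by (induction A rule: infinite_finite_induct) (auto simp: assms)
  have hprod: "h (prod f A) = (\<Prod>a\<in>A. h (f a))" for f and A :: "nat set"
    by (induction A rule: infinite_finite_induct) (auto simp: assms)
  have hpow: "h (f ^ k) = h f ^ k" for f k
    by (induction k) (auto simp: assms)
  show ?thesis
    by (induction v arbitrary: mu) (simp_all add: assms hsum hprod hpow)
qed

lemma flagged_cong_vars:
  "(\<And>i. 1 \<le> i \<Longrightarrow> i \<le> v \<Longrightarrow> x i = y i) \<Longrightarrow> flagged x L phi v mu = flagged y L phi v mu"
  by (induction v arbitrary: mu) auto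

text \<open>In two rows of equal length the entries of the upper one are at least one smaller than those
  below, so the upper flag may be lowered to the lower flag minus one.\<close>

lemma flagged_cong_flags:
  assumes "\<And>r. phi r = phi' r \<or> (v \<le> phi r \<and> v \<le> phi' r) \<or> mu r = 0 \<or>
    (mu r = mu (Suc r) \<and>
      (phi (Suc r) \<le> Suc (min (phi r) (phi' r)) \<or> phi' (Suc r) \<le> Suc (min (phi r) (phi' r))))"
  shows "flagged x L phi v mu = flagged x L phi' v mu"
  using assms
proof (induction v arbitrary: mu)
  case (Suc v)
  have iff: "(phi r < Suc v \<longrightarrow> kap r = mu r) \<longleftrightarrow> (phi' r < Suc v \<longrightarrow> kap r = mu r)"
    if "mu (Suc r) \<le> kap r" "kap r \<le> mu r" for kap r
    using Suc.prems[of r] that by (elim disjE) auto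
  then have eq: "strips phi (Suc v) mu = strips phi' (Suc v) mu"
    unfolding strips_def by blast
  have "flagged x L phi v kap = flagged x L phi' v kap" if kap: "kap \<in> strips phi (Suc v) mu" for kap
  proof (rule Suc.IH)
    fix r
    have kap': "kap \<in> strips phi' (Suc v) mu" using kap eq by simp
    from Suc.prems[of r]
    show "phi r = phi' r \<or> (v \<le> phi r \<and> v \<le> phi' r) \<or> kap r = 0 \<or>
      (kap r = kap (Suc r) \<and>
        (phi (Suc r) \<le> Suc (min (phi r) (phi' r)) \<or> phi' (Suc r) \<le> Suc (min (phi r) (phi' r))))"
    proof (elim disjE)
      assume *: "mu r = mu (Suc r) \<and>
        (phi (Suc r) \<le> Suc (min (phi r) (phi' r)) \<or> phi' (Suc r) \<le> Suc (min (phi r) (phi' r)))"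
      then have "kap r = mu (Suc r)" using kap unfolding strips_def by (metis (mono_tags, lifting) le_antisym mem_Collect_eq)
      \<comment> \<open>Row \<open>r\<close> has been cut to \<open>mu (Suc r)\<close>. If the row
        below keeps its length, the two are still equal; if it loses a box, its flags are at least
        \<open>Suc v\<close>, hence both flags of row \<open>r\<close> are at least \<open>v\<close>
        and no longer matter.\<close>
      moreover have "kap (Suc r) = mu (Suc r) \<or> \<not> phi (Suc r) < Suc v \<and> \<not> phi' (Suc r) < Suc v"
        using kap kap' unfolding strips_def by blast
      ultimately show ?thesis using * by auto
    qed (use kap strips_eq_0[OF kap, of r] in auto)
  qed
  then show ?case by (simp add: eq)
qed simp

section \<open>Expansion in two consecutive letters\<close>

lemma sum_prod_rows:
  fixes g :: "nat \<Rightarrow> nat \<Rightarrow> 'a::comm_semiring_1"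
  assumes I: "\<And>r. L \<le> r \<Longrightarrow> I r = {0}" and fin: "\<And>r. finite (I r)"
  shows "(\<Sum>kap\<in>{kap. \<forall>r. kap r \<in> I r}. \<Prod>r<L. g r (kap r)) = (\<Prod>r<L. \<Sum>n\<in>I r. g r n)"
proof -
  have "(\<Prod>r<L. \<Sum>n\<in>I r. g r n) = (\<Sum>kap\<in>PiE {..<L} I. \<Prod>r<L. g r (kap r))"
    by (rule prod_sum_PiE) (use fin in auto)
  also have "\<dots> = (\<Sum>kap\<in>{kap. \<forall>r. kap r \<in> I r}. \<Prod>r<L. g r (kap r))"
  proof (rule sum.reindex_bij_witness[where i = "\<lambda>kap. restrict kap {..<L}"
        and j = "\<lambda>kap r. if r < L then kap r else 0"])
    fix kap assume kap: "kap \<in> PiE {..<L} I"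
    show "restrict (\<lambda>r. if r < L then kap r else 0) {..<L} = kap"
      using kap by (auto simp: PiE_def extensional_def restrict_def)
    show "(\<lambda>r. if r < L then kap r else 0) \<in> {kap. \<forall>r. kap r \<in> I r}"
      using kap I by (auto simp: PiE_iff not_less)
  next
    fix kap assume kap: "kap \<in> {kap. \<forall>r. kap r \<in> I r}"
    then have "kap r = 0" if "L \<le> r" for r using I[OF that] by blast
    then show "(\<lambda>r. if r < L then restrict kap {..<L} r else 0) = kap"
      by (auto simp: not_less)
    show "restrict kap {..<L} \<in> PiE {..<L} I" using kap by auto
  qed simp
  finally show ?thesis by simp
qed

text \<open>Given the shapes \<open>mu\<close> and \<open>kap\<close> before and after removing the entries \<open>a + 1\<close> and \<open>a\<close>, the
  shape in between can be chosen independently in each row; \<open>two_letter_row\<close> is the set of choices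
  for the length of row \<open>r\<close>.\<close>

definition two_letter_row ::
  "(nat \<Rightarrow> nat) \<Rightarrow> nat \<Rightarrow> (nat \<Rightarrow> nat) \<Rightarrow> (nat \<Rightarrow> nat) \<Rightarrow> nat \<Rightarrow> nat set" where
  "two_letter_row phi a mu kap r =
     {n. mu (Suc r) \<le> n \<and> n \<le> mu r \<and> kap r \<le> n \<and> (0 < r \<longrightarrow> n \<le> kap (r - 1)) \<and>
       (phi r < Suc a \<longrightarrow> n = mu r) \<and> (phi r < a \<longrightarrow> n = kap r)}"

text \<open>For a row of length \<open>m\<close> with \<open>k\<close> boxes of smaller letters,
  \<open>A\<close> marks the smaller and \<open>B\<close> the larger of the two letters. For the
  full interval from \<open>k\<close> to \<open>m\<close> this is the complete homogeneous
  polynomial of degree \<open>m - k\<close>.\<close>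

definition row_weight :: "'a::comm_ring_1 \<Rightarrow> 'a \<Rightarrow> nat \<Rightarrow> nat \<Rightarrow> nat set \<Rightarrow> 'a" where
  "row_weight A B m k I = (\<Sum>n\<in>I. A ^ (n - k) * B ^ (m - n))"

lemma finite_two_letter_row: "finite (two_letter_row phi a mu kap r)"
  by (rule finite_subset[of _ "{..mu r}"]) (auto simp: two_letter_row_def)

text \<open>The two strip conditions bound the intermediate length of row \<open>r\<close> only by
  the outer and inner shapes, never by other intermediate lengths, so the sum factors over rows. The
  bound \<open>box\<close> is separate from \<open>mu\<close> so that two shapes differing by a box
  can be expanded over the same index set.\<close>

lemma flagged_two_letters:
  assumes mu0: "\<And>r. L \<le> r \<Longrightarrow> mu r = 0" and box0: "\<And>r. L \<le> r \<Longrightarrow> box r = 0"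
    and le: "\<And>r. mu r \<le> box r"
  shows "flagged x L phi (Suc (Suc b)) mu =
    (\<Sum>kap\<in>{kap. \<forall>r. kap r \<le> box r}.
      (\<Prod>r<L. row_weight (x (Suc b)) (x (Suc (Suc b))) (mu r) (kap r)
        (two_letter_row phi (Suc b) mu kap r)) * flagged x L phi b kap)"
proof -
  let ?A = "x (Suc b)" and ?B = "x (Suc (Suc b))" and ?Box = "{kap::nat \<Rightarrow> nat. \<forall>r. kap r \<le> box r}"
  let ?w = "\<lambda>kap nu. \<Prod>r<L. ?A ^ (nu r - kap r) * ?B ^ (mu r - nu r)"
  have finB: "finite ?Box" by (rule finite_bounded_rows[OF box0])
  have sub: "strips phi v nu \<subseteq> ?Box" if "\<And>r. nu r \<le> box r" for v nu
    using that by (auto simp: strips_def intro: order_trans)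
  have nu_le: "nu r \<le> box r" if "nu \<in> strips phi v mu" for nu v r
    using that le order_trans unfolding strips_def by blast
  have "flagged x L phi (Suc (Suc b)) mu =
      (\<Sum>nu\<in>strips phi (Suc (Suc b)) mu. \<Sum>kap\<in>strips phi (Suc b) nu. ?w kap nu * flagged x L phi b kap)"
    by (simp add: sum_distrib_left prod.distrib ac_simps)
  also have "\<dots> = (\<Sum>nu\<in>strips phi (Suc (Suc b)) mu.
      \<Sum>kap\<in>{kap. kap \<in> ?Box \<and> kap \<in> strips phi (Suc b) nu}. ?w kap nu * flagged x L phi b kap)"
    by (intro sum.cong refl) (use sub nu_le in blast)
  also have "\<dots> = (\<Sum>kap\<in>?Box. \<Sum>nu\<in>{nu. nu \<in> strips phi (Suc (Suc b)) mu \<and> kap \<in> strips phi (Suc b) nu}.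
      ?w kap nu * flagged x L phi b kap)"
    by (rule sum.swap_restrict[OF finite_strips[OF mu0] finB])
  also have "\<dots> = (\<Sum>kap\<in>?Box. (\<Prod>r<L. row_weight ?A ?B (mu r) (kap r)
        (two_letter_row phi (Suc b) mu kap r)) * flagged x L phi b kap)"
  proof (rule sum.cong[OF refl])
    fix kap assume kap: "kap \<in> ?Box"
    let ?I = "two_letter_row phi (Suc b) mu kap"
    have kap0: "kap r = 0" if "L \<le> r" for r using kap box0[OF that] by (metis le_zero_eq mem_Collect_eq)
    have set_eq: "{nu. nu \<in> strips phi (Suc (Suc b)) mu \<and> kap \<in> strips phi (Suc b) nu} =
        {nu. \<forall>r. nu r \<in> (if r < L then ?I r else {0})}"
    proof (intro equalityI subsetI CollectI allI)
      fix nu r assume nu: "nu \<in> {nu. nu \<in> strips phi (Suc (Suc b)) mu \<and> kap \<in> strips phi (Suc b) nu}"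
      then have s: "mu (Suc r) \<le> nu r" "nu r \<le> mu r" "phi r < Suc (Suc b) \<longrightarrow> nu r = mu r"
        "kap r \<le> nu r" "phi r < Suc b \<longrightarrow> kap r = nu r"
        and *: "\<And>s. nu (Suc s) \<le> kap s"
        by (auto simp: strips_def)
      have "nu r \<le> kap (r - 1)" if "0 < r" using *[of "r - 1"] that by simp
      then show "nu r \<in> (if r < L then ?I r else {0})"
        using s mu0[of r] by (auto simp: two_letter_row_def)
    next
      fix nu assume nu: "nu \<in> {nu. \<forall>r. nu r \<in> (if r < L then ?I r else {0})}"
      have s: "mu (Suc r) \<le> nu r \<and> nu r \<le> mu r \<and> (phi r < Suc (Suc b) \<longrightarrow> nu r = mu r) \<and>
        kap r \<le> nu r \<and> (phi r < Suc b \<longrightarrow> kap r = nu r) \<and> nu (Suc r) \<le> kap r" for r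
      proof -
        have "nu r \<in> (if r < L then ?I r else {0})" "nu (Suc r) \<in> (if Suc r < L then ?I (Suc r) else {0})"
          using nu by blast+
        then show ?thesis using mu0[of r] mu0[of "Suc r"] kap0[of r]
          by (cases "r < L"; cases "Suc r < L") (auto simp: two_letter_row_def)
      qed
      then show "nu \<in> strips phi (Suc (Suc b)) mu \<and> kap \<in> strips phi (Suc b) nu"
        unfolding strips_def by blast
    qed
    have "(\<Sum>nu\<in>{nu. \<forall>r. nu r \<in> (if r < L then ?I r else {0})}. ?w kap nu) =
        (\<Prod>r<L. \<Sum>n\<in>(if r < L then ?I r else {0}). ?A ^ (n - kap r) * ?B ^ (mu r - n))"
      by (rule sum_prod_rows) (auto simp: finite_two_letter_row)
    also have "\<dots> = (\<Prod>r<L. row_weight ?A ?B (mu r) (kap r) (?I r))"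
      by (intro prod.cong) (auto simp: row_weight_def)
    finally show "(\<Sum>nu\<in>{nu. nu \<in> strips phi (Suc (Suc b)) mu \<and> kap \<in> strips phi (Suc b) nu}.
      ?w kap nu * flagged x L phi b kap) = (\<Prod>r<L. row_weight ?A ?B (mu r) (kap r) (?I r)) * flagged x L phi b kap"
      unfolding set_eq by (simp add: sum_distrib_right[symmetric])
  qed
  finally show ?thesis .
qed

lemma row_weight_interval:
  fixes A B :: "'a::comm_ring_1"
  assumes "p \<le> q \<Longrightarrow> k \<le> p" "p \<le> q \<Longrightarrow> q \<le> m"
  shows "row_weight A B m k {p..q} = A ^ (p - k) * B ^ (m - q) * row_weight A B q p {p..q}"
  unfolding row_weight_def sum_distrib_left
proof (rule sum.cong[OF refl])
  fix n assume "n \<in> {p..q}"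
  then have "n - k = (p - k) + (n - p)" "m - n = (m - q) + (q - n)" using assms by auto
  then show "A ^ (n - k) * B ^ (m - n) = A ^ (p - k) * B ^ (m - q) * (A ^ (n - p) * B ^ (q - n))"
    by (simp add: power_add ac_simps)
qed

lemma row_weight_symmetric: "row_weight A B q p {p..q} = row_weight B A q p {p..q}"
  unfolding row_weight_def
  by (rule sum.reindex_bij_witness[where i = "\<lambda>n. p + q - n" and j = "\<lambda>n. p + q - n"])
    (auto simp: mult.commute)

text \<open>A geometric sum. The case \<open>p = Suc q\<close> is included: the interval is empty
  and both sides vanish.\<close>

lemma row_weight_telescope:
  fixes A B :: "'a::comm_ring_1"
  assumes "p \<le> Suc q"
  shows "(A - B) * row_weight A B q p {p..q} = A ^ (Suc q - p) - B ^ (Suc q - p)"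
proof -
  have "row_weight A B q p {p..q} = (\<Sum>i<Suc q - p. B ^ (Suc q - p - Suc i) * A ^ i)"
    unfolding row_weight_def
    by (rule sum.reindex_bij_witness[where i = "\<lambda>i. i + p" and j = "\<lambda>n. n - p"])
      (auto simp: mult.commute)
  then show ?thesis by (simp only: power_diff_sumr2)
qed

text \<open>Where \<open>mu (Suc r)\<close> exceeds \<open>kap r\<close>, the columns contain both
  letters, the smaller in row \<open>r\<close> above the larger in row \<open>r + 1\<close>. Such
  pairs contribute a power of \<open>A * B\<close>, and the rest of each row is symmetric. The first
  row of the tail lacks its partners in row \<open>s\<close>; the power in front supplies them. The
  induction runs from the bottom row upwards.\<close>

lemma tail_rows_symmetric:
  fixes A B :: "'a::comm_ring_1" and kap :: "nat \<Rightarrow> nat"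
  assumes mu0: "mu L = 0" and flags: "\<And>r. s < r \<Longrightarrow> Suc a \<le> phi r" and "s < L"
  defines "R \<equiv> \<lambda>A B r. row_weight A B (mu r) (kap r) (two_letter_row phi a mu kap r)"
  shows "A ^ (mu (Suc s) - kap s) * (\<Prod>r\<in>{Suc s..<L}. R A B r) =
    B ^ (mu (Suc s) - kap s) * (\<Prod>r\<in>{Suc s..<L}. R B A r)"
proof -
  have "t < L \<Longrightarrow> s \<le> L - Suc t \<Longrightarrow>
    A ^ (mu (L - t) - kap (L - Suc t)) * (\<Prod>r\<in>{L - t..<L}. R A B r) =
    B ^ (mu (L - t) - kap (L - Suc t)) * (\<Prod>r\<in>{L - t..<L}. R B A r)" for t
  proof (induction t)
    case 0
    then show ?case using mu0 by simp
  next
    case (Suc t)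
    define r where "r = L - Suc t"
    have r: "L - t = Suc r" "L - Suc (Suc t) = r - 1" "L - Suc t = r" "0 < r" "s < r" "r < L"
      using Suc.prems by (auto simp: r_def)
    define p where "p = max (mu (Suc r)) (kap r)"
    define q where "q = min (mu r) (kap (r - 1))"
    have I: "two_letter_row phi a mu kap r = {p..q}"
      using flags[OF r(5)] r(4) by (auto simp: two_letter_row_def p_def q_def)
    have R: "R A B r = A ^ (mu (Suc r) - kap r) * B ^ (mu r - kap (r - 1)) * row_weight A B q p {p..q}"
      for A B
    proof -
      have "R A B r = A ^ (p - kap r) * B ^ (mu r - q) * row_weight A B q p {p..q}"
        unfolding R_def I by (rule row_weight_interval) (auto simp: p_def q_def)
      moreover have "p - kap r = mu (Suc r) - kap r" "mu r - q = mu r - kap (r - 1)"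
        by (auto simp: p_def q_def)
      ultimately show ?thesis by simp
    qed
    have split: "(\<Prod>r\<in>{r..<L}. R A B r) = R A B r * (\<Prod>r\<in>{Suc r..<L}. R A B r)" for A B
      using r(6) by (rule prod.atLeast_Suc_lessThan)
    have IH: "A ^ (mu (Suc r) - kap r) * (\<Prod>r\<in>{Suc r..<L}. R A B r) =
        B ^ (mu (Suc r) - kap r) * (\<Prod>r\<in>{Suc r..<L}. R B A r)"
      using Suc.IH Suc.prems r(5) unfolding r(1,3) by simp
    let ?e = "mu r - kap (r - 1)"
    have "A ^ ?e * (\<Prod>r\<in>{r..<L}. R A B r) = (A * B) ^ ?e * row_weight A B q p {p..q} *
        (A ^ (mu (Suc r) - kap r) * (\<Prod>r\<in>{Suc r..<L}. R A B r))"
      unfolding split R power_mult_distrib by (simp only: ac_simps)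
    also have "\<dots> = (A * B) ^ ?e * row_weight B A q p {p..q} *
        (B ^ (mu (Suc r) - kap r) * (\<Prod>r\<in>{Suc r..<L}. R B A r))"
      by (simp only: IH row_weight_symmetric[of A B])
    also have "\<dots> = B ^ ?e * (\<Prod>r\<in>{r..<L}. R B A r)"
      unfolding split R power_mult_distrib by (simp only: ac_simps)
    finally show ?case unfolding r(2,3) .
  qed
  from this[of "L - Suc s"] show ?thesis using \<open>s < L\<close> by (simp add: Suc_diff_Suc)
qed

text \<open>Rows above \<open>i\<close> contain neither letter and are rigid; rows below admit both
  and are symmetric up to a power. In row \<open>i\<close> the lower flag \<open>a\<close> of the
  larger shape leaves only the letter \<open>a\<close>, giving a pure power, and the difference of
  two such powers is \<open>A - B\<close> times the sum that the flag \<open>Suc a\<close>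
  allows.\<close>

lemma two_letter_identity:
  fixes A B :: "'a::comm_ring_1"
  assumes mu0: "mu L = 0" and "i < L" and decr: "mu (Suc i) \<le> mu i"
    and above: "0 < i \<Longrightarrow> mu i < mu (i - 1)"
    and flags: "\<And>r. r < i \<Longrightarrow> phi r < a" "\<And>r. i < r \<Longrightarrow> Suc a \<le> phi r"
    and kap: "kap i \<le> Suc (mu i)"
  defines "R1 \<equiv> \<lambda>A B. \<Prod>r<L. row_weight A B (mu r) (kap r) (two_letter_row (phi(i := Suc a)) a mu kap r)"
  defines "mu' \<equiv> mu(i := Suc (mu i))"
  defines "R2 \<equiv> \<lambda>A B. \<Prod>r<L. row_weight A B (mu' r) (kap r) (two_letter_row (phi(i := a)) a mu' kap r)"
  shows "(A - B) * R1 A B = R2 A B - R2 B A"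
proof -
  let ?I1 = "two_letter_row (phi(i := Suc a)) a mu kap" and ?I2 = "two_letter_row (phi(i := a)) a mu' kap"
  let ?w1 = "\<lambda>A B r. row_weight A B (mu r) (kap r) (?I1 r)"
  let ?w2 = "\<lambda>A B r. row_weight A B (mu' r) (kap r) (?I2 r)"
  show ?thesis
  proof (cases "\<forall>r<i. kap r = mu r")
    case False
    then obtain r where r: "r < i" "kap r \<noteq> mu r" by blast
    then have "?I1 r = {}" "?I2 r = {}" using flags(1)[of r] by (auto simp: two_letter_row_def mu'_def)
    then have "?w1 A B r = 0" "?w2 A B r = 0" "?w2 B A r = 0" by (simp_all add: row_weight_def)
    then have "R1 A B = 0" "R2 A B = 0" "R2 B A = 0"
      using r \<open>i < L\<close> unfolding R1_def R2_def by (auto intro!: prod_zero bexI[of _ r])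
    then show ?thesis by simp
  next
    case True
    have split: "(\<Prod>r<L. f r) = (\<Prod>r<i. f r) * f i * (\<Prod>r\<in>{Suc i..<L}. f r)" for f :: "nat \<Rightarrow> 'a"
    proof -
      have "(\<Prod>r<L. f r) = (\<Prod>r<i. f r) * (\<Prod>r\<in>{i..<L}. f r)"
        using prod.atLeastLessThan_concat[of 0 i L f] \<open>i < L\<close> by (simp add: atLeast0LessThan)
      then show ?thesis using prod.atLeast_Suc_lessThan[OF \<open>i < L\<close>, of f] by (simp add: ac_simps)
    qed
    define H where "H = (\<Prod>r<i. ?w1 A B r)"
    have head: "?w1 C D r = of_nat (card (?I1 r))" "?w2 C D r = of_nat (card (?I1 r))"
      if "r < i" for r and C D :: 'a
    proof -
      have I: "n = mu r \<and> n = kap r" if "n \<in> ?I1 r" for n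
        using that flags(1)[OF \<open>r < i\<close>] \<open>r < i\<close> by (auto simp: two_letter_row_def)
      have "?I2 r = ?I1 r"
        using flags(1)[OF that] that above True decr
        by (cases "Suc r = i") (auto simp: two_letter_row_def mu'_def)
      moreover have "row_weight C D (mu r) (kap r) (?I1 r) = (\<Sum>n\<in>?I1 r. 1)"
        unfolding row_weight_def by (rule sum.cong[OF refl]) (use I in force)
      ultimately show "?w1 C D r = of_nat (card (?I1 r))" "?w2 C D r = of_nat (card (?I1 r))"
        using that by (simp_all add: mu'_def)
    qed
    have H: "(\<Prod>r<i. ?w1 C D r) = H" "(\<Prod>r<i. ?w2 C D r) = H" for C D :: 'a
      unfolding H_def by (auto intro!: prod.cong simp: head simp del: fun_upd_apply)
    have tail: "?w2 C D r = ?w1 C D r" if "i < r" for C D :: 'a and r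
    proof -
      have "?I2 r = ?I1 r" using that by (auto simp: two_letter_row_def mu'_def)
      then show ?thesis using that by (simp add: mu'_def)
    qed
    define T where "T = (\<lambda>C D :: 'a. \<Prod>r\<in>{Suc i..<L}. ?w1 C D r)"
    have T1: "(\<Prod>r\<in>{Suc i..<L}. ?w1 C D r) = T C D" for C D :: 'a
      by (simp add: T_def)
    have T2: "(\<Prod>r\<in>{Suc i..<L}. ?w2 C D r) = T C D" for C D :: 'a
      unfolding T_def by (rule prod.cong) (auto simp: tail simp del: fun_upd_apply)
    let ?e = "mu (Suc i) - kap i"
    have sym: "A ^ ?e * T A B = B ^ ?e * T B A"
      unfolding T_def
      by (rule tail_rows_symmetric) (use mu0 \<open>i < L\<close> flags(2) in auto)
    define p where "p = max (mu (Suc i)) (kap i)"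
    have p: "p \<le> Suc (mu i)" "p - kap i = ?e" "kap i \<le> p" using kap decr by (auto simp: p_def)
    \<comment> \<open>The row above is full and strictly longer than row \<open>i\<close>, so it
      leaves room for the additional box.\<close>
    have up: "n \<le> Suc (mu i) \<Longrightarrow> 0 < i \<Longrightarrow> n \<le> kap (i - 1)" for n
      using True above by force
    have I1: "?I1 i = {p..mu i}"
      using up by (auto simp: two_letter_row_def p_def)
    have w1: "?w1 A B i = A ^ ?e * row_weight A B (mu i) p {p..mu i}"
      using row_weight_interval[of p "mu i" "kap i" "mu i" A B] p unfolding I1 by simp
    have I2: "?I2 i = {Suc (mu i)}"
      using up kap decr by (auto simp: two_letter_row_def mu'_def)
    have w2: "?w2 C D i = C ^ ?e * C ^ (Suc (mu i) - p)" for C D :: 'a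
    proof -
      have "Suc (mu i) - kap i = ?e + (Suc (mu i) - p)" using p by simp
      then show ?thesis unfolding I2 by (simp add: row_weight_def mu'_def flip: power_add)
    qed
    have "(A - B) * R1 A B = H * (A ^ ?e * T A B) * ((A - B) * row_weight A B (mu i) p {p..mu i})"
      unfolding R1_def split[of "?w1 A B"] H(1) w1 T1 by (simp only: ac_simps)
    also have "\<dots> = H * (A ^ ?e * T A B) * (A ^ (Suc (mu i) - p) - B ^ (Suc (mu i) - p))"
      by (simp only: row_weight_telescope[OF p(1)])
    also have "\<dots> = H * (A ^ ?e * T A B) * A ^ (Suc (mu i) - p) - H * (B ^ ?e * T B A) * B ^ (Suc (mu i) - p)"
      by (simp only: right_diff_distrib sym)
    also have "\<dots> = R2 A B - R2 B A"
      unfolding R2_def split[of "?w2 A B"] split[of "?w2 B A"] H(2) w2 T2 by (simp only: ac_simps)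
    finally show ?thesis .
  qed
qed

text \<open>Letters beyond \<open>Suc a\<close> cannot occur in rows up to \<open>i\<close> on
  either side, so peeling them off commutes with adding the box in row \<open>i\<close>. This
  reduces the claim to the letters \<open>a\<close> and \<open>Suc a\<close>, which are the largest
  in the base case.\<close>

lemma flagged_divided_difference:
  fixes x :: "nat \<Rightarrow> 'a::comm_ring_1"
  assumes "1 \<le> a" "Suc a \<le> v" and mu0: "\<And>r. L \<le> r \<Longrightarrow> mu r = 0" and "i < L"
    and decr: "\<And>r. mu (Suc r) \<le> mu r" and above: "0 < i \<Longrightarrow> mu i < mu (i - 1)"
    and flags: "\<And>r. r < i \<Longrightarrow> phi r < a" "\<And>r. i < r \<Longrightarrow> Suc a \<le> phi r"
  shows "(x a - x (Suc a)) * flagged x L (phi(i := Suc a)) v mu =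
    flagged x L (phi(i := a)) v (mu(i := Suc (mu i))) -
    flagged (x \<circ> transpose a (Suc a)) L (phi(i := a)) v (mu(i := Suc (mu i)))"
  using \<open>Suc a \<le> v\<close> mu0 decr above
proof (induction v arbitrary: mu rule: dec_induct)
  case base
  note mu0 = base(1) and decr = base(2) and above = base(3)
  obtain b where a: "a = Suc b" using \<open>1 \<le> a\<close> by (cases a) auto
  let ?mu' = "mu(i := Suc (mu i))" and ?s = "transpose a (Suc a)"
  let ?p1 = "phi(i := Suc a)" and ?p2 = "phi(i := a)"
  let ?A = "x a" and ?B = "x (Suc a)" and ?Box = "{kap. \<forall>r. kap r \<le> ?mu' r}"
  let ?R1 = "\<lambda>kap A B. \<Prod>r<L. row_weight A B (mu r) (kap r) (two_letter_row ?p1 a mu kap r)"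
  let ?R2 = "\<lambda>kap A B. \<Prod>r<L. row_weight A B (?mu' r) (kap r) (two_letter_row ?p2 a ?mu' kap r)"
  let ?F = "flagged x L ?p2 b"
  have mu'0: "?mu' r = 0" if "L \<le> r" for r using mu0[OF that] that \<open>i < L\<close> by simp
  have F1: "flagged x L ?p1 b kap = ?F kap" for kap
    by (rule flagged_cong_flags) (simp add: a)
  have F2: "flagged (x \<circ> ?s) L ?p2 b kap = ?F kap" for kap
    by (rule flagged_cong_vars) (simp add: a transpose_def)
  have 1: "flagged x L ?p1 (Suc a) mu = (\<Sum>kap\<in>?Box. ?R1 kap ?A ?B * ?F kap)"
    unfolding a by (subst flagged_two_letters[where box = ?mu'])
      (use mu0 mu'0 F1 in \<open>auto simp: a\<close>)
  have 2: "flagged x L ?p2 (Suc a) ?mu' = (\<Sum>kap\<in>?Box. ?R2 kap ?A ?B * ?F kap)"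
    unfolding a by (rule flagged_two_letters) (use mu'0 in auto)
  have 3: "flagged (x \<circ> ?s) L ?p2 (Suc a) ?mu' = (\<Sum>kap\<in>?Box. ?R2 kap ?B ?A * ?F kap)"
  proof -
    have "flagged (x \<circ> ?s) L ?p2 (Suc (Suc b)) ?mu' = (\<Sum>kap\<in>?Box. (\<Prod>r<L. row_weight ((x \<circ> ?s) (Suc b)) ((x \<circ> ?s) (Suc (Suc b)))
        (?mu' r) (kap r) (two_letter_row ?p2 (Suc b) ?mu' kap r)) * flagged (x \<circ> ?s) L ?p2 b kap)"
      by (rule flagged_two_letters) (use mu'0 in auto)
    moreover have "(x \<circ> ?s) (Suc b) = ?B" "(x \<circ> ?s) (Suc (Suc b)) = ?A" by (simp_all add: a)
    ultimately show ?thesis by (simp only: F2 a[symmetric])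
  qed
  have "(?A - ?B) * ?R1 kap ?A ?B = ?R2 kap ?A ?B - ?R2 kap ?B ?A" if "kap \<in> ?Box" for kap
  proof (rule two_letter_identity)
    show "kap i \<le> Suc (mu i)" using that by (auto dest: spec[of _ i])
  qed (use mu0 \<open>i < L\<close> decr above flags in auto)
  then show ?case
    unfolding 1 2 3 sum_distrib_left sum_subtractf[symmetric]
    by (intro sum.cong refl) (simp only: mult.assoc[symmetric] left_diff_distrib[symmetric])
next
  case (step v)
  let ?mu' = "\<lambda>mu. mu(i := Suc (mu i))" and ?s = "transpose a (Suc a)"
  let ?p1 = "phi(i := Suc a)" and ?p2 = "phi(i := a)"
  note mu0 = step.prems(1) and decr = step.prems(2) and above = step.prems(3)
  have fix_i: "kap i = mu i" and fix_above: "r < i \<Longrightarrow> kap r = mu r" and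
    kap0: "L \<le> r \<Longrightarrow> kap r = 0" and kap_decr: "kap (Suc r) \<le> kap r"
    if "kap \<in> strips ?p1 (Suc v) mu" for kap r
  proof -
    have *: "mu (Suc r) \<le> kap r" "kap r \<le> mu r" "?p1 r < Suc v \<Longrightarrow> kap r = mu r" for r
      using that unfolding strips_def by blast+
    show "kap i = mu i" using *(3)[of i] step.hyps by simp
    show "kap r = mu r" if "r < i" using *(3)[of r] step.hyps flags(1)[OF that] that by simp
    show "kap r = 0" if "L \<le> r" using *(2)[of r] mu0[OF that] by simp
    show "kap (Suc r) \<le> kap r" using *(1)[of r] *(2)[of "Suc r"] by simp
  qed
  have in_iff: "?mu' kap \<in> strips ?p2 (Suc v) (?mu' mu)" if kap: "kap \<in> strips ?p1 (Suc v) mu" for kap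
  proof -
    have "?mu' mu (Suc r) \<le> ?mu' kap r \<and> ?mu' kap r \<le> ?mu' mu r \<and> (?p2 r < Suc v \<longrightarrow> ?mu' kap r = ?mu' mu r)" for r
    proof -
      have *: "mu (Suc r) \<le> kap r" "kap r \<le> mu r" "?p1 r < Suc v \<Longrightarrow> kap r = mu r"
        using kap unfolding strips_def by blast+
      consider "r = i" | "Suc r = i" | "r \<noteq> i" "Suc r \<noteq> i" by blast
      then show ?thesis
      proof cases
        case 1
        then show ?thesis using * fix_i[OF kap] by simp
      next
        case 2
        then show ?thesis using * above fix_above[OF kap, of r] by auto
      next
        case 3
        then show ?thesis using * by simp
      qed
    qed
    then show ?thesis unfolding strips_def by blast
  qed
  have in_iff': "kap(i := mu i) \<in> strips ?p1 (Suc v) mu \<and> kap i = Suc (mu i)"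
    if kap: "kap \<in> strips ?p2 (Suc v) (?mu' mu)" for kap
  proof -
    have *: "?mu' mu (Suc r) \<le> kap r" "kap r \<le> ?mu' mu r" "?p2 r < Suc v \<Longrightarrow> kap r = ?mu' mu r" for r
      using kap unfolding strips_def by blast+
    have i: "kap i = Suc (mu i)" using *(3)[of i] step.hyps by simp
    have "mu (Suc r) \<le> (kap(i := mu i)) r \<and> (kap(i := mu i)) r \<le> mu r \<and> (?p1 r < Suc v \<longrightarrow> (kap(i := mu i)) r = mu r)" for r
    proof -
      consider "r = i" | "Suc r = i" | "r \<noteq> i" "Suc r \<noteq> i" by blast
      then show ?thesis
      proof cases
        case 1
        then show ?thesis using decr by simp
      next
        case 2
        then show ?thesis using *[of r] by auto
      next
        case 3
        then show ?thesis using *[of r] by simp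
      qed
    qed
    then show ?thesis using i unfolding strips_def by blast
  qed
  have reindex: "(\<Sum>kap\<in>strips ?p2 (Suc v) (?mu' mu). g kap) =
      (\<Sum>kap\<in>strips ?p1 (Suc v) mu. g (?mu' kap))" for g :: "(nat \<Rightarrow> nat) \<Rightarrow> 'a"
  proof (rule sum.reindex_bij_witness[where i = "?mu'" and j = "\<lambda>kap. kap(i := mu i)"])
    fix kap assume kap: "kap \<in> strips ?p2 (Suc v) (?mu' mu)"
    have "kap i = Suc (mu i)" using in_iff'[OF kap] by blast
    then show eq: "?mu' (kap(i := mu i)) = kap" by auto
    show "g (?mu' (kap(i := mu i))) = g kap" by (simp only: eq)
    show "kap(i := mu i) \<in> strips ?p1 (Suc v) mu" using in_iff'[OF kap] by blast
  next
    fix kap assume kap: "kap \<in> strips ?p1 (Suc v) mu"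
    show "(?mu' kap)(i := mu i) = kap" using fix_i[OF kap] by auto
    show "?mu' kap \<in> strips ?p2 (Suc v) (?mu' mu)" by (rule in_iff[OF kap])
  qed
  have weight: "(\<Prod>r<L. y ^ (?mu' mu r - ?mu' kap r)) = (\<Prod>r<L. y ^ (mu r - kap r))"
    for y :: 'a and kap
    by (rule prod.cong) auto
  have xs: "(x \<circ> ?s) (Suc v) = x (Suc v)" using step.hyps by (simp add: transpose_def)
  have "(x a - x (Suc a)) * flagged x L ?p1 (Suc v) mu =
      (\<Sum>kap\<in>strips ?p1 (Suc v) mu. (\<Prod>r<L. x (Suc v) ^ (mu r - kap r)) *
        ((x a - x (Suc a)) * flagged x L ?p1 v kap))"
    by (simp add: sum_distrib_left ac_simps)
  also have "\<dots> = (\<Sum>kap\<in>strips ?p1 (Suc v) mu. (\<Prod>r<L. x (Suc v) ^ (mu r - kap r)) *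
        (flagged x L ?p2 v (?mu' kap) - flagged (x \<circ> ?s) L ?p2 v (?mu' kap)))"
  proof (intro sum.cong refl arg_cong2[where f = "(*)"])
    fix kap assume kap: "kap \<in> strips ?p1 (Suc v) mu"
    show "(x a - x (Suc a)) * flagged x L ?p1 v kap =
        flagged x L ?p2 v (?mu' kap) - flagged (x \<circ> ?s) L ?p2 v (?mu' kap)"
    proof (rule step.IH)
      show "kap i < kap (i - 1)" if "0 < i" using above[OF that] fix_i[OF kap] fix_above[OF kap, of "i - 1"] that by simp
    qed (use kap0[OF kap] kap_decr[OF kap] in auto)
  qed
  also have "\<dots> = flagged x L ?p2 (Suc v) (?mu' mu) - flagged (x \<circ> ?s) L ?p2 (Suc v) (?mu' mu)"
    unfolding flagged.simps reindex weight xs by (simp only: right_diff_distrib sum_subtractf)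
  finally show ?case .
qed

section \<open>Schubert polynomials of vexillary permutations\<close>

definition row_count :: "(nat \<Rightarrow> nat) \<Rightarrow> nat \<Rightarrow> nat" where
  "row_count c e = card {x. e \<le> c x}"

text \<open>The conjugate of the partition with columns \<open>row_count c e\<close>, which is the
  sorted code padded with zeros. Counting instead of sorting makes the effect of a single changed
  code easy to follow.\<close>

definition row_len :: "(nat \<Rightarrow> nat) \<Rightarrow> nat \<Rightarrow> nat" where
  "row_len c r = card {e. 1 \<le> e \<and> r < row_count c e}"

definition last_pos :: "(nat \<Rightarrow> nat) \<Rightarrow> nat \<Rightarrow> nat" where
  "last_pos c e = Max {x. e \<le> c x}"

text \<open>For an empty row the set behind \<open>last_pos\<close> is infinite and the value
  unspecified; flags are therefore compared on nonempty rows only.\<close>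

definition flag :: "(nat \<Rightarrow> nat) \<Rightarrow> nat \<Rightarrow> nat" where
  "flag c r = last_pos c (row_len c r)"

definition code_support :: "nat \<Rightarrow> (nat \<Rightarrow> nat) \<Rightarrow> bool" where
  "code_support m c \<longleftrightarrow> c 0 = 0 \<and> (\<forall>x>m. c x = 0)"

lemma code_support_code: "u permutes {1..m} \<Longrightarrow> code_support m (code m u)"
  by (simp add: code_support_def code_0 code_eq_0)

lemma code_support_subset:
  assumes "code_support m c" "1 \<le> e"
  shows "{x. e \<le> c x} \<subseteq> {1..m}"
proof
  fix x assume "x \<in> {x. e \<le> c x}"
  then have "c x \<noteq> 0" using assms(2) by auto
  then have "x \<noteq> 0" "\<not> m < x" using assms(1) by (auto simp: code_support_def intro: ccontr)
  then show "x \<in> {1..m}" by auto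
qed

lemma finite_code_ge: "code_support m c \<Longrightarrow> 1 \<le> e \<Longrightarrow> finite {x. e \<le> c x}"
  by (rule finite_subset[OF code_support_subset]) auto

lemma row_count_antimono:
  assumes "code_support m c" "1 \<le> e" "e \<le> e'"
  shows "row_count c e' \<le> row_count c e"
  unfolding row_count_def by (rule card_mono[OF finite_code_ge[OF assms(1,2)]]) (use assms(3) in auto)

lemma row_count_le:
  assumes "code_support m c" "1 \<le> e"
  shows "row_count c e \<le> m"
  using card_mono[OF _ code_support_subset[OF assms]] by (simp add: row_count_def)

lemma row_count_eventually_0:
  assumes "code_support m c"
  obtains b where "\<And>e. b < e \<Longrightarrow> row_count c e = 0"
proof -
  define b where "b = Max (c ` {..m})"
  have "c x \<le> b" for x
  proof (cases "x \<le> m")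
    case True
    then show ?thesis unfolding b_def by (intro Max_ge) auto
  next
    case False
    then show ?thesis using assms by (simp add: code_support_def)
  qed
  then have "{x. e \<le> c x} = {}" if "b < e" for e using that by (auto simp: not_le intro: le_less_trans)
  then show thesis using that[of b] by (simp add: row_count_def)
qed

text \<open>Column lengths decrease, so the set counted by \<open>row_len\<close> is an initial
  interval; this is the duality of conjugate partitions.\<close>

lemma row_len_ge_iff:
  assumes "code_support m c" "1 \<le> e"
  shows "e \<le> row_len c r \<longleftrightarrow> r < row_count c e"
proof -
  obtain b where b: "\<And>e. b < e \<Longrightarrow> row_count c e = 0" using row_count_eventually_0[OF assms(1)] by blast
  let ?S = "{e. 1 \<le> e \<and> r < row_count c e}"
  have "e \<le> b" if "e \<in> ?S" for e using b[of e] that by (cases "b < e") auto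
  then have sub: "?S \<subseteq> {..b}" by blast
  then have fin: "finite ?S" by (rule finite_subset) simp
  show ?thesis
  proof
    assume "r < row_count c e"
    then have "e' \<in> ?S" if "e' \<in> {1..e}" for e'
      using row_count_antimono[OF assms(1), of e' e] that by simp
    then have "{1..e} \<subseteq> ?S" by blast
    then have "card {1..e} \<le> row_len c r" unfolding row_len_def by (rule card_mono[OF fin])
    then show "e \<le> row_len c r" by simp
  next
    assume le: "e \<le> row_len c r"
    show "r < row_count c e"
    proof (rule ccontr)
      assume not: "\<not> r < row_count c e"
      have "?S \<subseteq> {1..<e}"
      proof
        fix e' assume e': "e' \<in> ?S"
        then have "\<not> e \<le> e'" using row_count_antimono[OF assms, of e'] not by auto
        then show "e' \<in> {1..<e}" using e' by auto
      qed
      then have "row_len c r \<le> card {1..<e}" unfolding row_len_def by (intro card_mono) auto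
      then show False using le assms(2) by simp
    qed
  qed
qed

lemma row_len_eqI:
  assumes "code_support m c" "\<And>e. 1 \<le> e \<Longrightarrow> r < row_count c e \<longleftrightarrow> e \<le> n"
  shows "row_len c r = n"
proof (rule antisym)
  show "row_len c r \<le> n"
    using assms(2)[of "row_len c r"] row_len_ge_iff[OF assms(1), of "row_len c r" r]
    by (cases "row_len c r") auto
  show "n \<le> row_len c r"
    using assms(2)[of n] row_len_ge_iff[OF assms(1), of n r] by (cases n) auto
qed

lemma row_len_eq_0:
  assumes "code_support m c" "m \<le> r"
  shows "row_len c r = 0"
proof (rule row_len_eqI[OF assms(1)])
  fix e :: nat assume "1 \<le> e"
  then show "r < row_count c e \<longleftrightarrow> e \<le> 0" using row_count_le[OF assms(1), of e] assms(2) by simp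
qed

lemma row_len_antimono:
  assumes "code_support m c" "r \<le> s"
  shows "row_len c s \<le> row_len c r"
proof (cases "row_len c s = 0")
  case False
  then have "s < row_count c (row_len c s)"
    using row_len_ge_iff[OF assms(1), of "row_len c s" s] by simp
  then have "r < row_count c (row_len c s)" using assms(2) by simp
  then show ?thesis using row_len_ge_iff[OF assms(1), of "row_len c s" r] False by simp
qed simp

text \<open>If no code equalled the length \<open>e\<close> of a row, columns \<open>e\<close> and
  \<open>e + 1\<close> would be equally long and the row would extend further.\<close>

lemma row_len_attained:
  assumes "code_support m c" "1 \<le> row_len c r"
  shows "\<exists>x. c x = row_len c r"
proof (rule ccontr)
  let ?e = "row_len c r"
  assume "\<nexists>x. c x = ?e"
  then have "{x. ?e \<le> c x} = {x. Suc ?e \<le> c x}" by (metis Suc_le_eq order_le_less)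
  then have "row_count c ?e = row_count c (Suc ?e)" by (simp add: row_count_def)
  then show False
    using row_len_ge_iff[OF assms, of r] row_len_ge_iff[OF assms(1), of "Suc ?e" r] by simp
qed

lemma last_pos_ge:
  assumes "code_support m c" "1 \<le> e" "e \<le> c x"
  shows "x \<le> last_pos c e"
  unfolding last_pos_def by (rule Max_ge[OF finite_code_ge[OF assms(1,2)]]) (use assms(3) in simp)

lemma last_pos_in:
  assumes "code_support m c" "1 \<le> e" "e \<le> c y"
  shows "e \<le> c (last_pos c e)"
proof -
  have "last_pos c e \<in> {x. e \<le> c x}"
    unfolding last_pos_def by (rule Max_in[OF finite_code_ge[OF assms(1,2)]]) (use assms(3) in auto)
  then show ?thesis by simp
qed

lemma last_pos_eqI:
  assumes "code_support m c" "1 \<le> e" "e \<le> c x" "\<And>y. x < y \<Longrightarrow> c y < e"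
  shows "last_pos c e = x"
  using last_pos_ge[OF assms(1-3)] last_pos_in[OF assms(1-3)] assms(4)[of "last_pos c e"]
  by linarith

text \<open>A column of more than \<open>v\<close> boxes cannot increase strictly with entries up to
  \<open>v\<close>.\<close>

lemma flagged_too_many_rows: "kap v \<noteq> 0 \<Longrightarrow> flagged x L phi v kap = 0"
proof (induction v arbitrary: kap)
  case (Suc v)
  have "flagged x L phi v nu = 0" if "nu \<in> strips phi (Suc v) kap" for nu
  proof (rule Suc.IH)
    have "kap (Suc v) \<le> nu v" using that unfolding strips_def by blast
    then show "nu v \<noteq> 0" using Suc.prems by simp
  qed
  then show ?case by simp
qed auto

text \<open>Row \<open>r\<close> can contain only \<open>r + 1\<close>: no less by
  column-strictness, no more by its flag. Peeling off \<open>v + 1\<close> removes all of row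
  \<open>v\<close>; any other strip leaves \<open>v + 1\<close> nonempty rows for \<open>v\<close>
  letters.\<close>

lemma flagged_staircase:
  assumes flags: "\<And>r. Suc r < m \<Longrightarrow> phi r = Suc r" and "m \<le> L"
  shows "v \<le> m \<Longrightarrow> flagged x L phi v (\<lambda>r. if r < v then m - Suc r else 0) =
    (\<Prod>i<v. x (Suc i) ^ (m - Suc i))"
proof (induction v)
  case (Suc v)
  let ?mu = "\<lambda>v r. if r < v then m - Suc r else 0"
  have mem: "?mu v \<in> strips phi (Suc v) (?mu (Suc v))"
    using flags[of v] by (cases "Suc v < m") (auto simp: strips_def less_Suc_eq not_less)
  have zero: "flagged x L phi v kap = 0" if kap: "kap \<in> strips phi (Suc v) (?mu (Suc v)) - {?mu v}" for kap
  proof (rule flagged_too_many_rows, rule notI)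
    assume v0: "kap v = 0"
    have *: "kap r \<le> ?mu (Suc v) r" "phi r < Suc v \<Longrightarrow> kap r = ?mu (Suc v) r" for r
      using kap unfolding strips_def by blast+
    have "kap r = ?mu v r" for r
    proof -
      consider "r < v" "Suc r < m" | "r < v" "\<not> Suc r < m" | "r = v" | "v < r" by linarith
      then show ?thesis
      proof cases
        case 1
        then show ?thesis using *(2)[of r] flags[of r] by simp
      qed (use *(1)[of r] v0 in auto)
    qed
    then show False using kap by auto
  qed
  have fin: "finite (strips phi (Suc v) (?mu (Suc v)))"
    by (rule finite_strips[of "Suc v"]) auto
  have "flagged x L phi (Suc v) (?mu (Suc v)) =
      (\<Prod>r<L. x (Suc v) ^ (?mu (Suc v) r - ?mu v r)) * flagged x L phi v (?mu v)"
    unfolding flagged.simps sum.remove[OF fin mem] using zero by (simp add: sum.neutral)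
  also have "(\<Prod>r<L. x (Suc v) ^ (?mu (Suc v) r - ?mu v r)) =
      (\<Prod>r\<in>{v}. x (Suc v) ^ (?mu (Suc v) r - ?mu v r))"
    by (rule prod.mono_neutral_right) (use Suc.prems \<open>m \<le> L\<close> in auto)
  finally show ?case using Suc by (simp add: mult.commute)
qed simp

lemma schubert_longest:
  fixes m :: nat
  defines "c \<equiv> code m (longest_perm m)"
  shows "flagged X m (flag c) m (row_len c) = (\<Prod>i\<in>{1..<m}. X i ^ (m - i))"
proof -
  have supp: "code_support m c"
    unfolding c_def by (rule code_support_code[OF longest_perm_permutes])
  have c: "c x = m - x" if "1 \<le> x" for x
  proof (cases "x \<le> m")
    case True
    then have "{j \<in> {x<..m}. longest_perm m j < longest_perm m x} = {x<..m}"
      using that by (auto simp: longest_perm_def)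
    then show ?thesis by (simp add: c_def code_def)
  qed (simp add: c_def code_eq_0)
  have ge: "{x. e \<le> c x} = {1..m - e}" if "1 \<le> e" for e
  proof (intro equalityI subsetI)
    fix x assume x: "x \<in> {x. e \<le> c x}"
    then have "1 \<le> x" using code_support_subset[OF supp that] by auto
    then show "x \<in> {1..m - e}" using x c[of x] that by auto
  qed (use c that in auto)
  have count: "row_count c e = m - e" if "1 \<le> e" for e
    using ge[OF that] by (simp add: row_count_def)
  have len: "row_len c r = m - Suc r" for r
    by (rule row_len_eqI[OF supp]) (auto simp: count)
  have flags: "flag c r = Suc r" if "Suc r < m" for r
    unfolding flag_def len
    by (rule last_pos_eqI[OF supp]) (use that c in auto)
  have "row_len c = (\<lambda>r. if r < m then m - Suc r else 0)" using len by auto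
  then have "flagged X m (flag c) m (row_len c) = (\<Prod>i<m. X (Suc i) ^ (m - Suc i))"
    using flagged_staircase[where m = m and v = m and L = m and x = X, OF flags] by simp
  also have "\<dots> = (\<Prod>i\<in>{1..m}. X i ^ (m - i))"
    by (rule prod.reindex_bij_witness[where i = "\<lambda>i. i - 1" and j = Suc]) auto
  also have "\<dots> = (\<Prod>i\<in>{1..<m}. X i ^ (m - i))"
    by (rule prod.mono_neutral_right) auto
  finally show ?thesis .
qed

text \<open>The flags of \<open>c\<close> and \<open>c'\<close> need not agree outside the row that
  changes, as \<open>flagged_divided_difference\<close> demands. An auxiliary \<open>phi\<close>,
  adjusted in that row to \<open>Suc a\<close> or \<open>a\<close>, is shown equivalent to the one
  and to the other.\<close>

lemma schubert_ascent:
  assumes supp: "code_support m c" and supp': "code_support m c'"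
    and a: "1 \<le> a" "a < m" and good: "good_ascent c a"
  assumes c': "c' = c(a := c (a + 1) + 1, a + 1 := c a)"
  shows "divided_difference a (flagged X m (flag c') m (row_len c')) =
    flagged X m (flag c) m (row_len c)"
proof -
  define k where "k = c (a + 1)"
  define l where "l = c a"
  have good': "l \<le> k" "\<And>y. a + 1 < y \<Longrightarrow> c y \<le> k" "\<And>x. x < a \<Longrightarrow> c x \<le> l \<or> k < c x"
    "\<And>x. x < a \<Longrightarrow> 1 \<le> x \<Longrightarrow> c x \<noteq> k" "\<And>x. x < a \<Longrightarrow> c x = k + 1 \<Longrightarrow> k < c (a - 1)"
    "\<And>y z. a + 1 < z \<Longrightarrow> z < y \<Longrightarrow> c y = k \<Longrightarrow> c z = k"
    using good unfolding good_ascent_def k_def l_def by blast+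
  have ca: "c a = l" "c (a + 1) = k" "c (Suc a) = k" by (simp_all add: k_def l_def)
  have c'a: "c' a = k + 1" "c' (a + 1) = l" "c' (Suc a) = l" by (simp_all add: c' k_def l_def)
  have c'o: "c' x = c x" if "x \<noteq> a" "x \<noteq> a + 1" for x using that by (simp add: c')
  \<comment> \<open>The codes above \<open>k\<close> account for rows \<open>0\<close> to
    \<open>i - 1\<close>; row \<open>i\<close> has length \<open>k\<close> for \<open>c\<close> and
    \<open>k + 1\<close> for \<open>c'\<close>.\<close>
  define i where "i = row_count c (k + 1)"
  have big: "x < a" if "k + 1 \<le> c x" for x
  proof (rule ccontr)
    assume "\<not> x < a"
    then consider "x = a" | "x = a + 1" | "a + 1 < x" by linarith
    then show False by cases (use ca good'(1) good'(2)[of x] that in auto)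
  qed
  have ge': "{x. e \<le> c' x} = {x. e \<le> c x}" if "e \<le> l \<or> k + 1 < e \<or> (l = k \<and> e = k)" for e
  proof (intro set_eqI)
    fix x
    consider "x = a" | "x = a + 1" | "x \<noteq> a" "x \<noteq> a + 1" by blast
    then show "x \<in> {x. e \<le> c' x} \<longleftrightarrow> x \<in> {x. e \<le> c x}"
      by cases (use that ca c'a c'o good'(1) in auto)
  qed
  have ge_mid: "{x. e \<le> c' x} - {a} = {x. e \<le> c x} - {a + 1}" "e \<le> c' a" "e \<le> c (a + 1)"
    if "l < e" "e \<le> k" for e
  proof -
    show "{x. e \<le> c' x} - {a} = {x. e \<le> c x} - {a + 1}"
    proof (intro set_eqI)
      fix x
      consider "x = a" | "x = a + 1" | "x \<noteq> a" "x \<noteq> a + 1" by blast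
      then show "x \<in> {x. e \<le> c' x} - {a} \<longleftrightarrow> x \<in> {x. e \<le> c x} - {a + 1}"
        by cases (use that ca c'a c'o in auto)
    qed
    show "e \<le> c' a" "e \<le> c (a + 1)" using that ca c'a by auto
  qed
  have ge_top: "{x. k + 1 \<le> c' x} = insert a {x. k + 1 \<le> c x}"
  proof (intro set_eqI)
    fix x
    consider "x = a" | "x = a + 1" | "x \<noteq> a" "x \<noteq> a + 1" by blast
    then show "x \<in> {x. k + 1 \<le> c' x} \<longleftrightarrow> x \<in> insert a {x. k + 1 \<le> c x}"
      by cases (use ca c'a c'o good'(1) in auto)
  qed
  have count: "row_count c' e = row_count c e" if "1 \<le> e" "e \<noteq> k + 1" for e
  proof (cases "l < e \<and> e \<le> k")
    case True
    have "card ({x. e \<le> c' x} - {a}) = card {x. e \<le> c' x} - 1"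
      using ge_mid(2)[of e] True by (intro card_Diff_singleton) auto
    moreover have "card ({x. e \<le> c x} - {a + 1}) = card {x. e \<le> c x} - 1"
      using ge_mid(3)[of e] True by (intro card_Diff_singleton) auto
    moreover have "card {x. e \<le> c' x} \<noteq> 0"
      using finite_code_ge[OF supp' that(1)] ge_mid(2)[of e] True by auto
    moreover have "card {x. e \<le> c x} \<noteq> 0"
      using finite_code_ge[OF supp that(1)] ge_mid(3)[of e] True by auto
    ultimately show ?thesis using ge_mid(1)[of e] True unfolding row_count_def by auto
  next
    case False
    then show ?thesis using ge'[of e] that good'(1) unfolding row_count_def by auto
  qed
  have count_top: "row_count c' (k + 1) = i + 1"
    unfolding row_count_def ge_top i_def
    using finite_code_ge[OF supp, of "k + 1"] ca good'(1) by (subst card_insert_disjoint) auto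
  have count_k: "i < row_count c k" if "1 \<le> k"
  proof -
    have "insert (a + 1) {x. k + 1 \<le> c x} \<subseteq> {x. k \<le> c x}" using ca by auto
    then have "card (insert (a + 1) {x. k + 1 \<le> c x}) \<le> row_count c k"
      unfolding row_count_def by (rule card_mono[OF finite_code_ge[OF supp that]])
    then show ?thesis
      using finite_code_ge[OF supp, of "k + 1"] ca by (simp add: i_def row_count_def)
  qed
  have len_i: "row_len c i = k"
  proof (rule row_len_eqI[OF supp])
    fix e :: nat assume e: "1 \<le> e"
    show "i < row_count c e \<longleftrightarrow> e \<le> k"
      using e count_k row_count_antimono[OF supp e, of k] row_count_antimono[OF supp, of "k + 1" e]
      by (cases "e \<le> k") (auto simp: i_def)
  qed
  have len': "row_len c' = (row_len c)(i := Suc (row_len c i))"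
  proof
    fix r
    show "row_len c' r = ((row_len c)(i := Suc (row_len c i))) r"
    proof (rule row_len_eqI[OF supp'])
      fix e :: nat assume e: "1 \<le> e"
      show "r < row_count c' e \<longleftrightarrow> e \<le> ((row_len c)(i := Suc (row_len c i))) r"
      proof (cases "e = k + 1")
        case True
        then show ?thesis
          using count_top row_len_ge_iff[OF supp e, of r] len_i by (auto simp: i_def)
      next
        case False
        then show ?thesis
          using count[OF e False] row_len_ge_iff[OF supp e, of r] len_i by auto
      qed
    qed
  qed
  have i_small: "i < m"
  proof -
    have "{x. k + 1 \<le> c x} \<subseteq> {1..<a}" using big code_support_subset[OF supp, of "k + 1"] by fastforce
    then have "i \<le> card {1..<a}" unfolding i_def row_count_def by (intro card_mono) auto
    then show ?thesis using a by simp
  qed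
  have len_above: "k + 1 \<le> row_len c r" if "r < i" for r
    using row_len_ge_iff[OF supp, of "k + 1" r] that by (simp add: i_def)
  have len_below: "row_len c r \<le> k" if "i \<le> r" for r
    using row_len_antimono[OF supp that] len_i by simp
  \<comment> \<open>The codes equal to \<open>k\<close> begin at position \<open>a + d\<close>: at
    \<open>a\<close> if \<open>c a = k\<close>, at \<open>a + 1\<close> otherwise.\<close>
  define d where "d = (if l < k then 1 else 0 :: nat)"
  define f where "f = last_pos c k"
  \<comment> \<open>In the rows of length \<open>k\<close> the flags grow by one per row and end at
    \<open>f\<close>, the flag that all these rows have in \<open>c\<close>. The maximum matters
    only for empty rows, whose flag is unspecified, and secures \<open>Suc a \<le> phi r\<close>
    there.\<close>
  define phi where "phi = (\<lambda>r. if r < i then flag c r else if row_len c r = k then a + (r - i) + d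
    else max (a + 1) (flag c r))"
  have f_ge: "a + 1 \<le> f" if "1 \<le> k" unfolding f_def by (rule last_pos_ge[OF supp that]) (simp add: ca)
  have f_k: "c f = k" if "1 \<le> k"
  proof -
    have "k \<le> c f" unfolding f_def by (rule last_pos_in[OF supp that, of "a + 1"]) (simp add: ca)
    moreover have "c f \<le> k" using f_ge[OF that] good'(2)[of f] ca by (cases "f = a + 1") auto
    ultimately show ?thesis by simp
  qed
  have block: "row_count c k = i + (f + 1 - (a + d))" if "1 \<le> k"
  proof -
    have "{x. k \<le> c x} = {x. k + 1 \<le> c x} \<union> {a + d..f}"
    proof (intro equalityI subsetI)
      fix x assume x: "x \<in> {x. k \<le> c x}"
      then have "x \<le> f" unfolding f_def using last_pos_ge[OF supp that] by simp
      moreover have "1 \<le> x" using code_support_subset[OF supp that] x by auto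
      moreover have "a + d \<le> x" if "c x = k"
      proof -
        have "\<not> x < a" using good'(4)[of x] that \<open>1 \<le> x\<close> by blast
        moreover have "x \<noteq> a" if "l < k" using \<open>c x = k\<close> ca that by auto
        ultimately show ?thesis by (auto simp: d_def)
      qed
      ultimately show "x \<in> {x. k + 1 \<le> c x} \<union> {a + d..f}" using x by (cases "c x = k") auto
    next
      fix x assume "x \<in> {x. k + 1 \<le> c x} \<union> {a + d..f}"
      then show "x \<in> {x. k \<le> c x}"
      proof
        assume x: "x \<in> {a + d..f}"
        consider "x = a" | "x = a + 1" | "x = f" | "a + 1 < x" "x < f"
          using x by (auto simp: d_def split: if_splits) linarith+
        then have "c x = k"
        proof cases
          case 1
          then show ?thesis using x good'(1) ca by (simp add: d_def split: if_splits)
        qed (use ca f_k[OF that] good'(6)[of x f] in auto)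
        then show ?thesis by simp
      qed auto
    qed
    moreover have "{x. k + 1 \<le> c x} \<inter> {a + d..f} = {}" using big by fastforce
    ultimately show ?thesis
      unfolding row_count_def i_def using finite_code_ge[OF supp, of "k + 1"]
      by (simp add: card_Un_disjoint)
  qed
  have block_end: "row_len c (Suc r) = k \<or> a + (r - i) + d = f" if "1 \<le> k" "i \<le> r" "row_len c r = k" for r
  proof -
    have "r < row_count c k" using row_len_ge_iff[OF supp that(1), of r] that(3) by simp
    then have r: "r < i + (f + 1 - (a + d))" using block[OF that(1)] by simp
    have "row_len c (Suc r) = k" if "Suc r < row_count c k"
      using row_len_ge_iff[OF supp \<open>1 \<le> k\<close>, of "Suc r"] len_below[of "Suc r"] \<open>i \<le> r\<close> that by simp
    then show ?thesis using r block[OF that(1)] \<open>i \<le> r\<close> by (cases "Suc r < row_count c k") auto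
  qed
  have flag_low: "a + 1 \<le> flag c r" if "i \<le> r" "1 \<le> row_len c r" for r
    unfolding flag_def by (rule last_pos_ge[OF supp that(2)]) (use len_below[OF that(1)] ca in simp)
  have flag_high: "flag c r < a" if "r < i" for r
    unfolding flag_def
  proof (rule big)
    have e: "1 \<le> row_len c r" using len_above[OF that] by simp
    obtain x where "c x = row_len c r" using row_len_attained[OF supp e] by blast
    then have "row_len c r \<le> c (last_pos c (row_len c r))" by (intro last_pos_in[OF supp e, of x]) simp
    then show "k + 1 \<le> c (last_pos c (row_len c r))" using len_above[OF that] by simp
  qed
  have d_le: "d \<le> 1" by (simp add: d_def)
  have F: "flagged X m (phi(i := Suc a)) m (row_len c) = flagged X m (flag c) m (row_len c)"
  proof (rule flagged_cong_flags)
    fix r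
    let ?p = "phi(i := Suc a)" and ?q = "flag c" and ?mu = "row_len c"
    show "?p r = ?q r \<or> (m \<le> ?p r \<and> m \<le> ?q r) \<or> ?mu r = 0 \<or> (?mu r = ?mu (Suc r) \<and>
      (?p (Suc r) \<le> Suc (min (?p r) (?q r)) \<or> ?q (Suc r) \<le> Suc (min (?p r) (?q r))))"
    proof (cases "?mu r = k \<and> 1 \<le> k \<and> i \<le> r")
      case True
      have q: "?q r = f" using True by (simp add: flag_def f_def)
      show ?thesis
      proof (cases "?mu (Suc r) = k")
        case next_k: True
        then have "?q (Suc r) = f" by (simp add: flag_def f_def)
        moreover have "?p (Suc r) \<le> Suc (?p r)"
          using True next_k d_le by (auto simp: phi_def)
        ultimately show ?thesis using True next_k q by (auto simp: min_def)
      next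
        case False
        then have "a + (r - i) + d = f" using block_end[of r] True by blast
        moreover have "r \<noteq> i \<or> d = 1" using calculation f_ge True by (auto simp: d_def)
        ultimately have "?p r = f" using True by (auto simp: phi_def)
        then show ?thesis using q by simp
      qed
    next
      case False
      have "?p r = ?q r" if "?mu r \<noteq> 0"
      proof (cases "r < i")
        case True
        then show ?thesis by (simp add: phi_def)
      next
        case ge: False
        then have "?mu r \<noteq> k" using False that by auto
        moreover have "r \<noteq> i" using calculation len_i by auto
        ultimately show ?thesis using ge flag_low[of r] that by (simp add: phi_def)
      qed
      then show ?thesis by blast
    qed
  qed
  have F': "flagged X m (phi(i := a)) m (row_len c') = flagged X m (flag c') m (row_len c')"
  proof (rule flagged_cong_flags)
    fix r
    let ?p = "phi(i := a)" and ?q = "flag c'" and ?mu = "row_len c'"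
    have top: "last_pos c' (k + 1) = a"
    proof (rule last_pos_eqI[OF supp'])
      fix y assume "a < y"
      then show "c' y < k + 1" using c'a c'o[of y] good'(1) good'(2)[of y] by (cases "y = a + 1") auto
    qed (use c'a in auto)
    consider "r = i" | "r < i" "row_len c r = k + 1" | "r < i" "row_len c r \<noteq> k + 1" | "i < r" "row_len c r = 0"
      | "i < r" "row_len c r = k" "1 \<le> k" | "i < r" "1 \<le> row_len c r" "row_len c r < k"
      using len_below[of r] by linarith
    then show "?p r = ?q r \<or> (m \<le> ?p r \<and> m \<le> ?q r) \<or> ?mu r = 0 \<or> (?mu r = ?mu (Suc r) \<and>
      (?p (Suc r) \<le> Suc (min (?p r) (?q r)) \<or> ?q (Suc r) \<le> Suc (min (?p r) (?q r))))"
    proof cases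
      case 1
      then show ?thesis using top by (simp add: flag_def len' len_i)
    next
      case 2
      \<comment> \<open>In \<open>c'\<close> the rows of length \<open>k + 1\<close> extend down to
        row \<open>i\<close> and have flag \<open>a\<close>, while in \<open>c\<close> their flag is
        \<open>a - 1\<close>. The latter is the flag of the next row minus one or smaller by no more
        than that, so the two are equivalent.\<close>
      have "?mu r = k + 1" using 2 by (simp add: len')
      then have q: "?q r = a" using top by (simp add: flag_def)
      obtain x where x: "c x = k + 1" using row_len_attained[OF supp, of r] 2 by auto
      then have "x < a" using big[of x] by simp
      then have "k < c (a - 1)" using good'(5) x by blast
      then have "a - 1 \<le> flag c r" unfolding flag_def 2
        by (intro last_pos_ge[OF supp]) auto
      then have p: "?p r = a - 1" using flag_high[of r] 2 by (simp add: phi_def)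
      have mu_next: "?mu (Suc r) = k + 1"
      proof (cases "Suc r = i")
        case True
        then show ?thesis by (simp add: len' len_i)
      next
        case False
        then show ?thesis
          using len_above[of "Suc r"] row_len_antimono[OF supp, of r "Suc r"] 2 by (simp add: len')
      qed
      then have "?q (Suc r) = a" using top by (simp add: flag_def)
      then show ?thesis using q p \<open>?mu r = k + 1\<close> mu_next by auto
    next
      case 3
      then have "k + 1 < row_len c r" using len_above[of r] by simp
      then have "?q r = flag c r" using 3 ge'[of "row_len c r"] by (simp add: flag_def last_pos_def len')
      then show ?thesis using 3 by (simp add: phi_def)
    next
      case 4
      then show ?thesis by (simp add: len')
    next
      case 5
      have mu: "?mu r = k" using 5 by (simp add: len')
      show ?thesis
      proof (cases "row_len c (Suc r) = k")
        case True
        then have mu_next: "?mu (Suc r) = k" using 5 by (simp add: len')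
        then have "?q (Suc r) = ?q r" using mu by (simp add: flag_def)
        moreover have "?p (Suc r) = Suc (?p r)" using 5 True by (simp add: phi_def)
        ultimately show ?thesis using mu mu_next by (auto simp: min_def)
      next
        case False
        then have f: "a + (r - i) + d = f" using block_end[of r] 5 by auto
        then have p: "?p r = f" using 5 by (simp add: phi_def)
        have "?q r = f"
        proof (cases "l < k")
          case True
          then have "a + 1 < f" using f 5 by (simp add: d_def)
          have "last_pos c' k = f"
          proof (rule last_pos_eqI[OF supp' 5(3)])
            show "k \<le> c' f" using c'o[of f] f_k[OF 5(3)] \<open>a + 1 < f\<close> by simp
            fix y assume "f < y"
            then have "\<not> k \<le> c y" using last_pos_ge[OF supp 5(3), of y] by (auto simp: f_def)
            then show "c' y < k" using c'o[of y] \<open>f < y\<close> \<open>a + 1 < f\<close> by simp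
          qed
          then show ?thesis by (simp add: flag_def mu)
        next
          case False
          then have "{x. k \<le> c' x} = {x. k \<le> c x}" using good'(1) by (intro ge') auto
          then show ?thesis by (simp add: flag_def mu f_def last_pos_def)
        qed
        then show ?thesis using p by simp
      qed
    next
      case 6
      let ?e = "row_len c r"
      have mu: "?mu r = ?e" using 6 by (simp add: len')
      have p: "?p r = flag c r" using 6 flag_low[of r] by (simp add: phi_def)
      have "last_pos c' ?e = last_pos c ?e"
      proof (cases "?e \<le> l")
        case True
        then show ?thesis using ge'[of ?e] by (simp add: last_pos_def)
      next
        case False
        \<comment> \<open>A code strictly between \<open>l\<close> and \<open>k\<close> is attained
          only beyond \<open>a + 1\<close>, so the last position is untouched by the change at
          \<open>a\<close> and \<open>a + 1\<close>.\<close>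
        obtain x where x: "c x = ?e" using row_len_attained[OF supp 6(2)] by blast
        have "\<not> x < a" using good'(3)[of x] x False 6 by auto
        moreover have "x \<noteq> a" "x \<noteq> a + 1" using x False 6 ca by auto
        ultimately have "a + 1 < x" by simp
        then have g: "a + 1 < last_pos c ?e" using last_pos_ge[OF supp 6(2), of x] x by simp
        show ?thesis
        proof (rule last_pos_eqI[OF supp' 6(2)])
          show "?e \<le> c' (last_pos c ?e)" using c'o g last_pos_in[OF supp 6(2), of x] x by simp
          fix y assume y: "last_pos c ?e < y"
          then have "\<not> ?e \<le> c y" using last_pos_ge[OF supp 6(2), of y] by auto
          then show "c' y < ?e" using c'o[of y] y g by simp
        qed
      qed
      then show ?thesis using p mu by (simp add: flag_def)
    qed
  qed
  have swap: "swap_vars a (flagged X m psi m mu) = flagged (X \<circ> transpose a (Suc a)) m psi m mu" for psi mu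
    by (subst flagged_hom[where h = "swap_vars a"])
      (simp_all add: swap_vars_add swap_vars_mult comp_def)
  have "(X a - X (Suc a)) * flagged X m (phi(i := Suc a)) m (row_len c) =
      flagged X m (phi(i := a)) m ((row_len c)(i := Suc (row_len c i))) -
      flagged (X \<circ> transpose a (Suc a)) m (phi(i := a)) m ((row_len c)(i := Suc (row_len c i)))"
  proof (rule flagged_divided_difference)
    show "row_len c i < row_len c (i - 1)" if "0 < i" using len_above[of "i - 1"] len_i that by simp
    show "phi r < a" if "r < i" for r using flag_high[OF that] that by (simp add: phi_def)
    show "Suc a \<le> phi r" if "i < r" for r using that by (auto simp: phi_def)
    show "row_len c (Suc r) \<le> row_len c r" for r by (rule row_len_antimono[OF supp]) simp
  qed (use a i_small row_len_eq_0[OF supp] in auto)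
  then have "(X a - X (Suc a)) * flagged X m (flag c) m (row_len c) =
      flagged X m (flag c') m (row_len c') - swap_vars a (flagged X m (flag c') m (row_len c'))"
    by (simp only: F F'[symmetric] swap len'[symmetric])
  then show ?thesis by (rule divided_difference_eqI[folded Suc_eq_plus1])
qed

theorem is_schubert_flagged:
  assumes "w permutes {1..m}" "vex_code (code m w)"
  shows "is_schubert m w (flagged X m (flag (code m w)) m (row_len (code m w)))"
  using assms
proof (induction "disorder m w" arbitrary: w rule: less_induct)
  case less
  note perm = less.prems(1)
  let ?c = "code m w"
  show ?case
  proof (cases "\<exists>i\<in>{1..<m}. w i < w (i + 1)")
    case False
    have "w i \<noteq> w (i + 1)" for i using permutes_inj[OF perm] by (metis injD n_not_Suc_n Suc_eq_plus1)
    then have "w = longest_perm m"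
      using False by (intro longest_perm_unique[OF perm]) (metis linorder_neqE_nat)
    then show ?thesis using schubert_longest[of m] is_schubert.longest[of m] by simp
  next
    case True
    then obtain b where b: "b \<in> {1..<m}" "?c b \<le> ?c (b + 1)" using code_less_iff[OF _ perm] by blast
    obtain a where a: "a \<in> {1..<m}" "good_ascent ?c a" "vex_code (?c(a := ?c (a + 1) + 1, a + 1 := ?c a))"
      using ex_good_ascent[OF less.prems(2) code_0[OF perm] code_eq_0 b] by blast
    have "?c a \<le> ?c (a + 1)" using a(2) by (simp add: good_ascent_def)
    then have asc: "w a < w (a + 1)" using code_less_iff[OF a(1) perm] by blast
    let ?v = "w \<circ> transpose a (a + 1)"
    have cv: "code m ?v = ?c(a := ?c (a + 1) + 1, a + 1 := ?c a)" by (rule code_ascent[where w = w, OF a(1) asc])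
    have perm': "?v permutes {1..m}" by (rule permutes_comp_adjacent[OF perm a(1)])
    have "is_schubert m ?v (flagged X m (flag (code m ?v)) m (row_len (code m ?v)))"
      by (rule less.hyps[OF disorder_ascent[where w = w, OF a(1) asc] perm']) (use cv a(3) in simp)
    then have "is_schubert m w (divided_difference a (flagged X m (flag (code m ?v)) m (row_len (code m ?v))))"
      using a(1) asc by (rule is_schubert_ascent)
    then show ?thesis
      using schubert_ascent[OF code_support_code[OF perm] code_support_code[OF perm'] _ _ a(2) cv] a(1) by simp
  qed
qed

section \<open>Counting flagged tableaux\<close>

text \<open>The value 0 outside the shape is not a legal entry, so a tableau is one function and
  deleting boxes means setting them to 0.\<close>

definition tableaux :: "(nat \<Rightarrow> nat) \<Rightarrow> nat \<Rightarrow> (nat \<Rightarrow> nat) \<Rightarrow> (nat \<times> nat \<Rightarrow> nat) set" where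
  "tableaux phi v mu =
     {T. (\<forall>r c. c < mu r \<longrightarrow> 1 \<le> T (r, c) \<and> T (r, c) \<le> v \<and> T (r, c) \<le> phi r) \<and>
         (\<forall>r c. \<not> c < mu r \<longrightarrow> T (r, c) = 0) \<and>
         (\<forall>r c. Suc c < mu r \<longrightarrow> T (r, c) \<le> T (r, Suc c)) \<and>
         (\<forall>r c. c < mu (Suc r) \<longrightarrow> T (r, c) < T (Suc r, c))}"

lemma tableauxD:
  assumes "T \<in> tableaux phi v mu"
  shows "c < mu r \<Longrightarrow> 1 \<le> T (r, c)" "c < mu r \<Longrightarrow> T (r, c) \<le> v" "c < mu r \<Longrightarrow> T (r, c) \<le> phi r"
    "\<not> c < mu r \<Longrightarrow> T (r, c) = 0" "Suc c < mu r \<Longrightarrow> T (r, c) \<le> T (r, Suc c)"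
    "c < mu (Suc r) \<Longrightarrow> T (r, c) < T (Suc r, c)"
  using assms unfolding tableaux_def by blast+

lemma tableauxI:
  assumes "\<And>r c. c < mu r \<Longrightarrow> 1 \<le> T (r, c) \<and> T (r, c) \<le> v \<and> T (r, c) \<le> phi r"
    "\<And>r c. \<not> c < mu r \<Longrightarrow> T (r, c) = 0" "\<And>r c. Suc c < mu r \<Longrightarrow> T (r, c) \<le> T (r, Suc c)"
    "\<And>r c. c < mu (Suc r) \<Longrightarrow> T (r, c) < T (Suc r, c)"
  shows "T \<in> tableaux phi v mu"
  using assms unfolding tableaux_def by blast

lemma tableaux_row_mono:
  assumes T: "T \<in> tableaux phi v mu" and "c \<le> d" "d < mu r"
  shows "T (r, c) \<le> T (r, d)"
  using assms(2,3)
proof (induction d rule: dec_induct)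
  case (step n)
  then show ?case using tableauxD(5)[OF T, of n r] by simp
qed simp

lemma less_card_iff:
  fixes n :: nat
  assumes "\<And>c d. c \<le> d \<Longrightarrow> d < n \<Longrightarrow> Q d \<Longrightarrow> Q c"
  shows "c < card {c. c < n \<and> Q c} \<longleftrightarrow> c < n \<and> Q c"
proof
  assume c: "c < n \<and> Q c"
  have "{..c} \<subseteq> {c. c < n \<and> Q c}" using assms c by auto
  then have "card {..c} \<le> card {c. c < n \<and> Q c}" by (intro card_mono) auto
  then show "c < card {c. c < n \<and> Q c}" by simp
next
  assume less: "c < card {c. c < n \<and> Q c}"
  show "c < n \<and> Q c"
  proof (rule ccontr)
    assume not: "\<not> (c < n \<and> Q c)"
    have "d < c" if "d < n" "Q d" for d using assms[of c d] that not by (cases "d < c") auto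
    then have "card {c. c < n \<and> Q c} \<le> card {..<c}" by (intro card_mono) auto
    then show False using less by simp
  qed
qed

text \<open>The boxes with entry \<open>Suc v\<close> form a horizontal strip at the row ends;
  \<open>sh\<close> records the remaining shape, \<open>cut\<close> erases the strip and
  \<open>glue\<close> refills it.\<close>

lemma tableaux_Suc_bij:
  assumes decr: "\<And>r. mu (Suc r) \<le> mu r"
  shows "\<exists>h. bij_betw h (tableaux phi (Suc v) mu) (SIGMA kap:strips phi (Suc v) mu. tableaux phi v kap)"
proof -
  define sh where "sh = (\<lambda>(T :: nat \<times> nat \<Rightarrow> nat) r. card {c. c < mu r \<and> T (r, c) \<le> v})"
  define cut where "cut = (\<lambda>(T :: nat \<times> nat \<Rightarrow> nat) p. if T p \<le> v then T p else 0)"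
  define glue where "glue = (\<lambda>(kap, T). \<lambda>(r, c). if c < mu r \<and> \<not> c < kap r then Suc v else (T (r, c) :: nat))"
  have sh_iff: "c < sh T r \<longleftrightarrow> c < mu r \<and> T (r, c) \<le> v" if T: "T \<in> tableaux phi (Suc v) mu" for T r c
    unfolding sh_def
    by (rule less_card_iff) (use tableaux_row_mono[OF T] le_trans in blast)
  have S: "kap r \<le> mu r" "mu (Suc r) \<le> kap r" "phi r < Suc v \<Longrightarrow> kap r = mu r"
    if "kap \<in> strips phi (Suc v) mu" for kap r
    using that unfolding strips_def by blast+
  have "bij_betw (\<lambda>T. (sh T, cut T)) (tableaux phi (Suc v) mu)
      (SIGMA kap:strips phi (Suc v) mu. tableaux phi v kap)"
  proof (rule bij_betw_byWitness[where f' = glue])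
    show "\<forall>T\<in>tableaux phi (Suc v) mu. glue (sh T, cut T) = T"
    proof (intro ballI ext)
      fix T and p :: "nat \<times> nat" assume T: "T \<in> tableaux phi (Suc v) mu"
      obtain r c where p: "p = (r, c)" by (cases p)
      show "glue (sh T, cut T) p = T p"
        using tableauxD(2)[OF T, of c r] tableauxD(4)[OF T, of c r]
        unfolding p glue_def prod.case sh_iff[OF T] cut_def by auto
    qed
    show "\<forall>q\<in>SIGMA kap:strips phi (Suc v) mu. tableaux phi v kap. (sh (glue q), cut (glue q)) = q"
    proof
      fix q assume "q \<in> (SIGMA kap:strips phi (Suc v) mu. tableaux phi v kap)"
      then obtain kap T where q: "q = (kap, T)" and kap: "kap \<in> strips phi (Suc v) mu"
        and T: "T \<in> tableaux phi v kap" by blast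
      have le_iff: "c < mu r \<and> glue (kap, T) (r, c) \<le> v \<longleftrightarrow> c < kap r" for r c
        using S(1)[OF kap, of r] tableauxD(2)[OF T, of c r] by (auto simp: glue_def)
      have "sh (glue q) r = kap r" for r
        unfolding q sh_def le_iff by simp
      moreover have "cut (glue q) p = T p" for p
      proof -
        obtain r c where p: "p = (r, c)" by (cases p)
        show ?thesis
          using tableauxD(2,4)[OF T, of c r] S(1)[OF kap, of r] by (auto simp: p q cut_def glue_def)
      qed
      ultimately show "(sh (glue q), cut (glue q)) = q" unfolding q by (auto intro!: ext)
    qed
    show "(\<lambda>T. (sh T, cut T)) ` tableaux phi (Suc v) mu
        \<subseteq> (SIGMA kap:strips phi (Suc v) mu. tableaux phi v kap)"
    proof (intro image_subsetI SigmaI)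
      fix T assume T: "T \<in> tableaux phi (Suc v) mu"
      have "mu (Suc r) \<le> sh T r \<and> sh T r \<le> mu r \<and> (phi r < Suc v \<longrightarrow> sh T r = mu r)" for r
      proof (intro conjI impI)
        have "c < sh T r" if "c < mu (Suc r)" for c
          using that decr[of r] tableauxD(2,6)[OF T that] sh_iff[OF T, of c r] by simp
        then show "mu (Suc r) \<le> sh T r" by (meson le_less_linear less_irrefl)
        show le: "sh T r \<le> mu r"
          using sh_iff[OF T, of "mu r" r] by simp
        show "sh T r = mu r" if "phi r < Suc v"
        proof (rule ccontr)
          assume "sh T r \<noteq> mu r"
          then have less: "sh T r < mu r" using le by simp
          then have "T (r, sh T r) \<le> v" using tableauxD(3)[OF T less] that by simp
          then show False using sh_iff[OF T, of "sh T r" r] less by simp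
        qed
      qed
      then show "sh T \<in> strips phi (Suc v) mu" unfolding strips_def by blast
      show "cut T \<in> tableaux phi v (sh T)"
      proof (rule tableauxI)
        show "1 \<le> cut T (r, c) \<and> cut T (r, c) \<le> v \<and> cut T (r, c) \<le> phi r" if "c < sh T r" for r c
          using that tableauxD(1,3)[OF T, of c r] by (simp add: sh_iff[OF T] cut_def)
        show "cut T (r, c) = 0" if "\<not> c < sh T r" for r c
          using that tableauxD(4)[OF T, of c r] by (auto simp: sh_iff[OF T] cut_def)
        show "cut T (r, c) \<le> cut T (r, Suc c)" if "Suc c < sh T r" for r c
          using that tableauxD(5)[OF T, of c r] by (simp add: sh_iff[OF T] cut_def)
        show "cut T (r, c) < cut T (Suc r, c)" if "c < sh T (Suc r)" for r c
          using that tableauxD(6)[OF T, of c r] by (simp add: sh_iff[OF T] cut_def)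
      qed
    qed
    show "glue ` (SIGMA kap:strips phi (Suc v) mu. tableaux phi v kap) \<subseteq> tableaux phi (Suc v) mu"
    proof (intro image_subsetI)
      fix q assume "q \<in> (SIGMA kap:strips phi (Suc v) mu. tableaux phi v kap)"
      then obtain kap T where q: "q = (kap, T)" and kap: "kap \<in> strips phi (Suc v) mu"
        and T: "T \<in> tableaux phi v kap" by blast
      have old: "glue q (r, c) = T (r, c)" if "c < kap r" for r c using that by (simp add: q glue_def)
      have new: "glue q (r, c) = Suc v" if "\<not> c < kap r" "c < mu r" for r c using that by (simp add: q glue_def)
      show "glue q \<in> tableaux phi (Suc v) mu"
      proof (rule tableauxI)
        show "1 \<le> glue q (r, c) \<and> glue q (r, c) \<le> Suc v \<and> glue q (r, c) \<le> phi r" if "c < mu r" for r c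
        proof (cases "c < kap r")
          case True
          then show ?thesis using tableauxD(1-3)[OF T True] old[OF True] by simp
        next
          case False
          then have "\<not> phi r < Suc v" using S(3)[OF kap, of r] that by auto
          then show ?thesis using new[OF False that] by simp
        qed
        show "glue q (r, c) = 0" if "\<not> c < mu r" for r c
          using that S(1)[OF kap, of r] tableauxD(4)[OF T, of c r] by (simp add: q glue_def)
        show "glue q (r, c) \<le> glue q (r, Suc c)" if "Suc c < mu r" for r c
        proof (cases "Suc c < kap r")
          case True
          then show ?thesis using tableauxD(5)[OF T True] old[of c r] old[OF True] by simp
        next
          case False
          have "glue q (r, c) \<le> Suc v"
            using old[of c r] new[of c r] tableauxD(2)[OF T, of c r] that by (cases "c < kap r") auto
          then show ?thesis using new[OF False that] by simp
        qed
        show "glue q (r, c) < glue q (Suc r, c)" if "c < mu (Suc r)" for r c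
        proof -
          have c: "c < kap r" using that S(2)[OF kap, of r] by simp
          show ?thesis
          proof (cases "c < kap (Suc r)")
            case True
            then show ?thesis using tableauxD(6)[OF T True] old[OF c] old[OF True] by simp
          next
            case False
            then show ?thesis using old[OF c] new[OF False that] tableauxD(2)[OF T c] by simp
          qed
        qed
      qed
    qed
  qed
  then show ?thesis by blast
qed

theorem flagged_eq_card_tableaux:
  assumes "\<And>r. L \<le> r \<Longrightarrow> mu r = 0" and "\<And>r. mu (Suc r) \<le> mu r"
  shows "finite (tableaux phi v mu) \<and> flagged (\<lambda>_. 1 :: int) L phi v mu = int (card (tableaux phi v mu))"
  using assms
proof (induction v arbitrary: mu)
  case 0
  show ?case
  proof (cases "\<forall>r. mu r = 0")
    case True
    then have "tableaux phi 0 mu = {\<lambda>_. 0}" by (auto simp: tableaux_def)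
    moreover have "flagged (\<lambda>_. 1 :: int) L phi 0 mu = 1" using True by simp
    ultimately show ?thesis by simp
  next
    case False
    then obtain r where "0 < mu r" by auto
    then have "T \<notin> tableaux phi 0 mu" for T using tableauxD(1,2)[of T phi 0 mu 0 r] by fastforce
    then have "tableaux phi 0 mu = {}" by blast
    then show ?thesis using False by simp
  qed
next
  case (Suc v)
  have S: "finite (tableaux phi v kap) \<and> flagged (\<lambda>_. 1 :: int) L phi v kap = int (card (tableaux phi v kap))"
    if kap: "kap \<in> strips phi (Suc v) mu" for kap
  proof (rule Suc.IH)
    show "kap r = 0" if "L \<le> r" for r using strips_eq_0[OF kap] Suc.prems(1)[OF that] by blast
    show "kap (Suc r) \<le> kap r" for r using kap unfolding strips_def by (metis (mono_tags, lifting) le_trans mem_Collect_eq)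
  qed
  obtain h where h: "bij_betw h (tableaux phi (Suc v) mu) (SIGMA kap:strips phi (Suc v) mu. tableaux phi v kap)"
    using tableaux_Suc_bij[of mu phi v, OF Suc.prems(2)] by blast
  have fin: "finite (strips phi (Suc v) mu)" by (rule finite_strips[OF Suc.prems(1)])
  have "finite (SIGMA kap:strips phi (Suc v) mu. tableaux phi v kap)"
    by (rule finite_SigmaI[OF fin]) (use S in blast)
  then have 1: "finite (tableaux phi (Suc v) mu)" using bij_betw_finite[OF h] by blast
  have "card (tableaux phi (Suc v) mu) = (\<Sum>kap\<in>strips phi (Suc v) mu. card (tableaux phi v kap))"
    unfolding bij_betw_same_card[OF h] by (rule card_SigmaI[OF fin]) (use S in blast)
  then have "flagged (\<lambda>_. 1 :: int) L phi (Suc v) mu = int (card (tableaux phi (Suc v) mu))"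
    using S by simp
  then show ?case using 1 by blast
qed

section \<open>The generating function of \<open>(P, \<omega>)\<close>-partitions\<close>

text \<open>With the lexicographic key (value, label) this is standardization.\<close>

definition rank :: "'a set \<Rightarrow> ('a \<Rightarrow> 'k::linorder) \<Rightarrow> 'a \<Rightarrow> nat" where
  "rank P key x = card {y \<in> P. key y \<le> key x}"

lemma rank_less_iff:
  assumes "finite P" "x \<in> P" "y \<in> P"
  shows "rank P key x < rank P key y \<longleftrightarrow> key x < key y"
proof -
  have mono: "rank P key x \<le> rank P key y" if "key x \<le> key y" for x y
    unfolding rank_def using assms(1) that by (intro card_mono) auto
  have less: "rank P key x < rank P key y" if "key x < key y"
  proof -
    have "{z \<in> P. key z \<le> key x} \<subseteq> {z \<in> P. key z \<le> key y} - {y}" using that by auto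
    then have "rank P key x \<le> card ({z \<in> P. key z \<le> key y} - {y})"
      unfolding rank_def using assms(1) by (intro card_mono) auto
    also have "\<dots> < rank P key y"
      unfolding rank_def by (rule card_Diff1_less) (use assms in auto)
    finally show ?thesis .
  qed
  show ?thesis
  proof (cases "key x < key y")
    case True
    then show ?thesis using less by blast
  next
    case False
    then have "rank P key y \<le> rank P key x" by (intro mono) (simp add: not_less)
    then show ?thesis using False by simp
  qed
qed

lemma rank_bij_betw:
  assumes fin: "finite P" and inj: "inj_on key P"
  shows "bij_betw (rank P key) P {1..card P}"
proof -
  have "inj_on (rank P key) P"
  proof (rule inj_onI)
    fix x y assume xy: "x \<in> P" "y \<in> P" "rank P key x = rank P key y"
    then have "key x = key y"
      using rank_less_iff[OF fin xy(1,2), of key] rank_less_iff[OF fin xy(2,1), of key] by simp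
    then show "x = y" using xy(1,2) inj by (rule inj_onD[rotated])
  qed
  moreover have sub: "rank P key ` P \<subseteq> {1..card P}"
  proof (intro image_subsetI)
    fix x assume x: "x \<in> P"
    have "card {x} \<le> rank P key x" unfolding rank_def using fin x by (intro card_mono) auto
    moreover have "rank P key x \<le> card P" unfolding rank_def using fin by (intro card_mono) auto
    ultimately show "rank P key x \<in> {1..card P}" by simp
  qed
  ultimately show ?thesis
    using card_subset_eq[OF _ sub] card_image[of "rank P key" P] by (simp add: bij_betw_def)
qed

lemma rank_unique:
  assumes bij: "bij_betw T P {1..card P}" and x: "x \<in> P"
    and key: "\<And>x y. x \<in> P \<Longrightarrow> y \<in> P \<Longrightarrow> T x < T y \<Longrightarrow> key x < key y"
  shows "T x = rank P key x"
proof -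
  have le_iff: "key y \<le> key x \<longleftrightarrow> T y \<le> T x" if "y \<in> P" for y
  proof
    show "T y \<le> T x" if "key y \<le> key x"
      using key[OF x \<open>y \<in> P\<close>] that by (cases "T x < T y") auto
    show "key y \<le> key x" if "T y \<le> T x"
    proof (cases "T y = T x")
      case True
      then show ?thesis using bij x \<open>y \<in> P\<close> by (metis bij_betw_def inj_onD order_refl)
    next
      case False
      then show ?thesis using key[OF \<open>y \<in> P\<close> x] that by simp
    qed
  qed
  have "T ` {y \<in> P. key y \<le> key x} = {1..T x}"
  proof (intro equalityI subsetI)
    fix k assume "k \<in> T ` {y \<in> P. key y \<le> key x}"
    then show "k \<in> {1..T x}" using le_iff bij by (auto simp: bij_betw_def)
  next
    fix k assume k: "k \<in> {1..T x}"
    moreover have "T x \<in> {1..card P}" using bij x by (auto simp: bij_betw_def)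
    ultimately have "k \<in> T ` P" using bij by (auto simp: bij_betw_def)
    then show "k \<in> T ` {y \<in> P. key y \<le> key x}" using le_iff k by auto
  qed
  moreover have "inj_on T {y \<in> P. key y \<le> key x}"
    using bij by (auto simp: bij_betw_def inj_on_def)
  ultimately have "card {y \<in> P. key y \<le> key x} = card {1..T x}" by (metis card_image)
  then show ?thesis by (simp add: rank_def)
qed

definition linear_extensions :: "'a set \<Rightarrow> ('a \<times> 'a) set \<Rightarrow> ('a \<Rightarrow> nat) set" where
  "linear_extensions P R =
     {T \<in> extensional P. bij_betw T P {1..card P} \<and> (\<forall>(x, y)\<in>R. T x < T y)}"

text \<open>Testing the pairs in \<open>R\<close> is enough when \<open>R\<close> is a cover
  relation: if the label drops from the first to the last element of a chain, it drops at some
  step.\<close>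

definition p_partitions :: "'a set \<Rightarrow> ('a \<times> 'a) set \<Rightarrow> ('a \<Rightarrow> nat) \<Rightarrow> nat \<Rightarrow> ('a \<Rightarrow> nat) set" where
  "p_partitions P R \<omega> M =
     {f \<in> P \<rightarrow>\<^sub>E {..M}. \<forall>(x, y)\<in>R. f x \<le> f y \<and> (\<omega> y < \<omega> x \<longrightarrow> f x < f y)}"

definition descent_set :: "'a set \<Rightarrow> ('a \<Rightarrow> nat) \<Rightarrow> ('a \<Rightarrow> nat) \<Rightarrow> nat set" where
  "descent_set P \<omega> T = {k \<in> {1..<card P}. \<omega> (inv_into P T (k + 1)) < \<omega> (inv_into P T k)}"

text \<open>\<open>T\<close> lists the elements in lexicographic order of value and label.\<close>

definition compatible :: "'a set \<Rightarrow> ('a \<Rightarrow> nat) \<Rightarrow> ('a \<Rightarrow> nat) \<Rightarrow> ('a \<Rightarrow> nat) \<Rightarrow> bool" where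
  "compatible P \<omega> T f \<longleftrightarrow> (\<forall>x\<in>P. \<forall>y\<in>P. T x < T y \<longrightarrow> (f x, \<omega> x) < (f y, \<omega> y))"

definition chains :: "nat set \<Rightarrow> nat \<Rightarrow> nat \<Rightarrow> (nat \<Rightarrow> nat) set" where
  "chains D k M =
     {a \<in> {1..k} \<rightarrow>\<^sub>E {..M}. \<forall>j\<in>{1..<k}. a j \<le> a (j + 1) \<and> (j \<in> D \<longrightarrow> a j < a (j + 1))}"

lemma finite_chains: "finite (chains D k M)"
  unfolding chains_def by (rule finite_subset[of _ "{1..k} \<rightarrow>\<^sub>E {..M}"]) (auto intro: finite_PiE)

lemma linear_extensions_disjoint:
  assumes "T \<in> linear_extensions P R" "T' \<in> linear_extensions P R"
    and "compatible P \<omega> T f" "compatible P \<omega> T' f"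
  shows "T = T'"
proof (rule extensionalityI)
  fix x assume x: "x \<in> P"
  have "T x = rank P (\<lambda>x. (f x, \<omega> x)) x" "T' x = rank P (\<lambda>x. (f x, \<omega> x)) x"
    using assms x by (auto intro!: rank_unique simp: linear_extensions_def compatible_def)
  then show "T x = T' x" by simp
qed (use assms in \<open>auto simp: linear_extensions_def\<close>)

text \<open>The fundamental lemma of P-partitions. Sorting by value and then by label respects
  \<open>R\<close>, because two related elements with equal values have increasing labels.\<close>

lemma p_partitions_Union:
  assumes fin: "finite P" and R: "R \<subseteq> P \<times> P" "irrefl R" and inj: "inj_on \<omega> P"
  shows "p_partitions P R \<omega> M =
    (\<Union>T\<in>linear_extensions P R. {f \<in> P \<rightarrow>\<^sub>E {..M}. compatible P \<omega> T f})"
proof (intro equalityI subsetI)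
  fix f assume f: "f \<in> p_partitions P R \<omega> M"
  let ?key = "\<lambda>x. (f x, \<omega> x)"
  define T where "T = restrict (rank P ?key) P"
  have "inj_on ?key P" using inj by (auto simp: inj_on_def)
  then have "bij_betw T P {1..card P}"
    using rank_bij_betw[OF fin] unfolding T_def by (metis bij_betw_restrict_eq)
  moreover have "T x < T y" if "(x, y) \<in> R" for x y
  proof -
    have xy: "x \<in> P" "y \<in> P" "x \<noteq> y" using that R by (auto simp: irrefl_def)
    then have "\<omega> x \<noteq> \<omega> y" using inj by (auto dest: inj_onD)
    then have "?key x < ?key y" using f that by (fastforce simp: p_partitions_def)
    then have "rank P ?key x < rank P ?key y" by (rule iffD2[OF rank_less_iff[OF fin xy(1,2)]])
    then show ?thesis using xy by (simp add: T_def)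
  qed
  moreover have "T \<in> extensional P" by (simp add: T_def)
  ultimately have "T \<in> linear_extensions P R" unfolding linear_extensions_def by blast
  moreover have "compatible P \<omega> T f"
    unfolding compatible_def
  proof (intro ballI impI)
    fix x y assume "x \<in> P" "y \<in> P" "T x < T y"
    then show "?key x < ?key y"
      using rank_less_iff[OF fin \<open>x \<in> P\<close> \<open>y \<in> P\<close>, of ?key] by (simp only: T_def restrict_apply' if_True)
  qed
  ultimately show "f \<in> (\<Union>T\<in>linear_extensions P R. {f \<in> P \<rightarrow>\<^sub>E {..M}. compatible P \<omega> T f})"
    using f by (auto simp: p_partitions_def)
next
  fix f assume "f \<in> (\<Union>T\<in>linear_extensions P R. {f \<in> P \<rightarrow>\<^sub>E {..M}. compatible P \<omega> T f})"
  then obtain T where T: "T \<in> linear_extensions P R" and f: "f \<in> P \<rightarrow>\<^sub>E {..M}" "compatible P \<omega> T f"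
    by blast
  have "f x \<le> f y \<and> (\<omega> y < \<omega> x \<longrightarrow> f x < f y)" if "(x, y) \<in> R" for x y
  proof -
    have "T x < T y" using T that by (auto simp: linear_extensions_def)
    then have "(f x, \<omega> x) < (f y, \<omega> y)" using f(2) R(1) that unfolding compatible_def by blast
    then show ?thesis by auto
  qed
  then show "f \<in> p_partitions P R \<omega> M" using f(1) by (auto simp: p_partitions_def)
qed

text \<open>Read along \<open>T\<close>, a compatible \<open>f\<close> is weakly increasing, and
  equal neighbours need increasing labels, which forces strict steps exactly at the
  descents.\<close>

lemma card_compatible:
  assumes bij: "bij_betw T P {1..card P}" and inj: "inj_on \<omega> P"
  shows "card {f \<in> P \<rightarrow>\<^sub>E {..M}. compatible P \<omega> T f} = card (chains (descent_set P \<omega> T) (card P) M)"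
proof -
  let ?n = "card P" and ?g = "inv_into P T" and ?D = "descent_set P \<omega> T"
  have g: "?g k \<in> P" "T (?g k) = k" if "k \<in> {1..?n}" for k
    using bij that by (auto simp: bij_betw_def inv_into_into f_inv_into_f)
  have gT: "?g (T x) = x" "T x \<in> {1..?n}" if "x \<in> P" for x
    using bij that by (auto simp: bij_betw_def)
  have "bij_betw (\<lambda>f. restrict (\<lambda>k. f (?g k)) {1..?n})
      {f \<in> P \<rightarrow>\<^sub>E {..M}. compatible P \<omega> T f} (chains ?D ?n M)"
  proof (rule bij_betw_byWitness[where f' = "\<lambda>a. restrict (\<lambda>x. a (T x)) P"])
    show "\<forall>f\<in>{f \<in> P \<rightarrow>\<^sub>E {..M}. compatible P \<omega> T f}.
        restrict (\<lambda>x. restrict (\<lambda>k. f (?g k)) {1..?n} (T x)) P = f"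
      using gT by (auto intro!: ext simp: PiE_def extensional_def restrict_def)
    show "\<forall>a\<in>chains ?D ?n M. restrict (\<lambda>k. restrict (\<lambda>x. a (T x)) P (?g k)) {1..?n} = a"
      using g by (auto intro!: ext simp: chains_def PiE_def extensional_def restrict_def)
    show "(\<lambda>f. restrict (\<lambda>k. f (?g k)) {1..?n}) ` {f \<in> P \<rightarrow>\<^sub>E {..M}. compatible P \<omega> T f}
        \<subseteq> chains ?D ?n M"
    proof (intro image_subsetI)
      fix f assume f: "f \<in> {f \<in> P \<rightarrow>\<^sub>E {..M}. compatible P \<omega> T f}"
      have step: "f (?g j) \<le> f (?g (j + 1)) \<and> (j \<in> ?D \<longrightarrow> f (?g j) < f (?g (j + 1)))"
        if "j \<in> {1..<?n}" for j
      proof -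
        have "(f (?g j), \<omega> (?g j)) < (f (?g (j + 1)), \<omega> (?g (j + 1)))"
          using f g[of j] g[of "j + 1"] that unfolding compatible_def by auto
        then show ?thesis by (auto simp: descent_set_def)
      qed
      have "f (?g k) \<le> M" if "k \<in> {1..?n}" for k using f g(1)[OF that] by auto
      then show "restrict (\<lambda>k. f (?g k)) {1..?n} \<in> chains ?D ?n M"
        using step by (auto simp: chains_def)
    qed
    show "(\<lambda>a. restrict (\<lambda>x. a (T x)) P) ` chains ?D ?n M
        \<subseteq> {f \<in> P \<rightarrow>\<^sub>E {..M}. compatible P \<omega> T f}"
    proof (intro image_subsetI CollectI conjI)
      fix a assume a: "a \<in> chains ?D ?n M"
      show "restrict (\<lambda>x. a (T x)) P \<in> P \<rightarrow>\<^sub>E {..M}"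
        using a gT(2) by (auto simp: chains_def PiE_iff)
      let ?key = "\<lambda>k. (a k, \<omega> (?g k))"
      have step: "?key k < ?key (k + 1)" if k: "k \<in> {1..<?n}" for k
      proof -
        have "?g k \<noteq> ?g (k + 1)" using g(2)[of k] g(2)[of "k + 1"] k by fastforce
        then have "\<omega> (?g k) \<noteq> \<omega> (?g (k + 1))"
          using inj g(1)[of k] g(1)[of "k + 1"] k by (auto dest: inj_onD)
        then show ?thesis using a k by (auto simp: chains_def descent_set_def)
      qed
      have less: "?key i < ?key j" if "i < j" "1 \<le> i" "j \<le> ?n" for i j
        using that
      proof (induction j)
        case (Suc j)
        show ?case
        proof (cases "i = j")
          case True
          then show ?thesis using step[of i] Suc.prems by simp
        next
          case False
          then have "?key i < ?key j" using Suc by simp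
          also have "?key j < ?key (j + 1)" using Suc.prems by (intro step) auto
          finally show ?thesis by (simp only: Suc_eq_plus1)
        qed
      qed simp
      show "compatible P \<omega> T (restrict (\<lambda>x. a (T x)) P)"
        unfolding compatible_def
      proof (intro ballI impI)
        fix x y assume xy: "x \<in> P" "y \<in> P" "T x < T y"
        then have "?key (T x) < ?key (T y)" using gT(2)[of x] gT(2)[of y] by (intro less) auto
        then show "(restrict (\<lambda>x. a (T x)) P x, \<omega> x) < (restrict (\<lambda>x. a (T x)) P y, \<omega> y)"
          using xy by (simp only: gT restrict_apply' if_True)
      qed
    qed
  qed
  then show ?thesis by (rule bij_betw_same_card)
qed

text \<open>The last value \<open>v\<close> is split off. A strict step at \<open>k\<close> bounds
  the rest by \<open>v - 1\<close> and excludes \<open>v = 0\<close>; \<open>0 \<notin> D\<close>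
  ensures that such a step has a predecessor.\<close>

lemma card_chains_Suc:
  assumes "0 \<notin> D"
  shows "card (chains D (Suc k) M) =
    (\<Sum>v\<le>M. if k \<in> D then (if v = 0 then 0 else card (chains D k (v - 1))) else card (chains D k v))"
proof -
  define S where "S v = (if k \<in> D then (if v = 0 then {} else chains D k (v - 1)) else chains D k v)" for v
  have S: "b \<in> S v \<longleftrightarrow> b \<in> chains D k v \<and> (k \<in> D \<longrightarrow> b k < v)" for b v
  proof (cases "k \<in> D")
    case True
    then have k: "1 \<le> k" using assms by (cases k) auto
    show ?thesis
    proof
      assume "b \<in> S v"
      then have "b \<in> chains D k (v - 1)" "v \<noteq> 0" using True by (auto simp: S_def split: if_splits)
      then have "b j < v" if "j \<in> {1..k}" for j using that by (force simp: chains_def PiE_iff)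
      then show "b \<in> chains D k v \<and> (k \<in> D \<longrightarrow> b k < v)"
        using \<open>b \<in> chains D k (v - 1)\<close> k by (simp add: chains_def PiE_iff order_less_imp_le)
    next
      assume b: "b \<in> chains D k v \<and> (k \<in> D \<longrightarrow> b k < v)"
      have "b (k - d) < v" if "1 \<le> k - d" for d
        using that
      proof (induction d)
        case 0
        then show ?case using b True by simp
      next
        case (Suc d)
        then have "k - Suc d \<in> {1..<k}" "k - Suc d + 1 = k - d" by auto
        then have "b (k - Suc d) \<le> b (k - d)" using b unfolding chains_def by fastforce
        moreover have "b (k - d) < v" using Suc.prems by (intro Suc.IH) auto
        ultimately show ?case by simp
      qed
      note * = this
      have "b j \<le> v - 1" if "j \<in> {1..k}" for j using *[of "k - j"] that by simp
      moreover have "v \<noteq> 0" using b True by auto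
      ultimately show "b \<in> S v" using True b by (auto simp: S_def chains_def PiE_iff)
    qed
  qed (simp add: S_def)
  have "bij_betw (\<lambda>a. (a (Suc k), restrict a {1..k})) (chains D (Suc k) M) (SIGMA v:{..M}. S v)"
  proof (rule bij_betw_byWitness[where f' = "\<lambda>(v, b). b(Suc k := v)"])
    show "\<forall>a\<in>chains D (Suc k) M. (case (a (Suc k), restrict a {1..k}) of (v, b) \<Rightarrow> b(Suc k := v)) = a"
      by (auto intro!: ext simp: chains_def PiE_def extensional_def le_Suc_eq)
    show "\<forall>p\<in>SIGMA v:{..M}. S v. ((case p of (v, b) \<Rightarrow> b(Suc k := v)) (Suc k),
        restrict (case p of (v, b) \<Rightarrow> b(Suc k := v)) {1..k}) = p"
      by (auto intro!: ext simp: S chains_def PiE_def extensional_def)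
    show "(\<lambda>a. (a (Suc k), restrict a {1..k})) ` chains D (Suc k) M \<subseteq> (SIGMA v:{..M}. S v)"
    proof (intro image_subsetI)
      fix a assume a: "a \<in> chains D (Suc k) M"
      then have mono: "a j \<le> a (j + 1)" if "j \<in> {1..k}" for j
        using that by (auto simp: chains_def)
      have "a (Suc k - d) \<le> a (Suc k)" if "d \<le> k" for d
        using that
      proof (induction d)
        case (Suc d)
        then have "Suc k - Suc d \<in> {1..k}" "Suc k - Suc d + 1 = Suc k - d" by auto
        then show ?case using Suc mono by fastforce
      qed simp
      note * = this
      have le: "a j \<le> a (Suc k)" if "j \<in> {1..k}" for j
        using *[of "Suc k - j"] that by fastforce
      have "k \<in> D \<Longrightarrow> 1 \<le> k" using assms by (cases k) auto
      then have "restrict a {1..k} \<in> S (a (Suc k))"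
        using a le by (auto simp: S chains_def)
      then show "(a (Suc k), restrict a {1..k}) \<in> (SIGMA v:{..M}. S v)"
        using a by (auto simp: chains_def PiE_iff)
    qed
    show "(\<lambda>(v, b). b(Suc k := v)) ` (SIGMA v:{..M}. S v) \<subseteq> chains D (Suc k) M"
    proof (intro image_subsetI)
      fix p assume "p \<in> (SIGMA v:{..M}. S v)"
      then obtain v b where p: "p = (v, b)" and v: "v \<in> {..M}" and b: "b \<in> S v" by blast
      then have bv: "b j \<le> v" if "j \<in> {1..k}" for j using that by (auto simp: S chains_def PiE_iff)
      have bM: "b j \<le> M" if "j \<in> {1..k}" for j using bv[OF that] v by simp
      have "b(Suc k := v) \<in> {1..Suc k} \<rightarrow>\<^sub>E {..M}"
        using b v bM by (auto simp: S chains_def PiE_def extensional_def)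
      moreover have "(b(Suc k := v)) j \<le> (b(Suc k := v)) (j + 1) \<and>
          (j \<in> D \<longrightarrow> (b(Suc k := v)) j < (b(Suc k := v)) (j + 1))" if "j \<in> {1..<Suc k}" for j
        using that b bv by (cases "j = k") (auto simp: S chains_def)
      ultimately show "(case p of (v, b) \<Rightarrow> b(Suc k := v)) \<in> chains D (Suc k) M"
        by (simp add: chains_def p)
    qed
  qed
  then have "card (chains D (Suc k) M) = card (SIGMA v:{..M}. S v)" by (rule bij_betw_same_card)
  also have "\<dots> = (\<Sum>v\<le>M. card (S v))"
    by (rule card_SigmaI) (auto simp: S_def finite_chains)
  also have "\<dots> = (\<Sum>v\<le>M. if k \<in> D then (if v = 0 then 0 else card (chains D k (v - 1))) else card (chains D k v))"
    by (rule sum.cong) (auto simp: S_def)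
  finally show ?thesis .
qed

text \<open>The factor \<open>1 - fps_X\<close> undoes the summation over the last value, and each
  strict step contributes a factor \<open>fps_X\<close>. The empty chain exists for every bound,
  which gives the geometric series at the start.\<close>

lemma fps_chains:
  assumes "0 \<notin> D"
  shows "Abs_fps (\<lambda>M. of_nat (card (chains D k M)) :: rat) * (1 - fps_X) ^ Suc k =
    fps_X ^ card (D \<inter> {..<k})"
proof (induction k)
  case 0
  have "chains D 0 M = {\<lambda>_. undefined}" for M by (simp add: chains_def)
  then have "Abs_fps (\<lambda>M. of_nat (card (chains D 0 M)) :: rat) * (1 - fps_X) = 1"
    by (intro fps_ext) (simp add: right_diff_distrib)
  then show ?case by simp
next
  case (Suc k)
  let ?G = "\<lambda>k. Abs_fps (\<lambda>M. of_nat (card (chains D k M)) :: rat)"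
  have "?G (Suc k) * (1 - fps_X) = fps_X ^ (if k \<in> D then 1 else 0) * ?G k"
  proof (rule fps_ext)
    fix M
    show "fps_nth (?G (Suc k) * (1 - fps_X)) M = fps_nth (fps_X ^ (if k \<in> D then 1 else 0) * ?G k) M"
      by (cases M) (simp_all add: right_diff_distrib card_chains_Suc[OF assms])
  qed
  then have "?G (Suc k) * (1 - fps_X) ^ Suc (Suc k) =
      fps_X ^ (if k \<in> D then 1 else 0) * (?G k * (1 - fps_X) ^ Suc k)"
    by (metis (no_types, lifting) mult.assoc power_Suc)
  also have "\<dots> = fps_X ^ card (D \<inter> {..<Suc k})"
    unfolding Suc by (simp add: lessThan_Suc Int_insert_right)
  finally show ?case .
qed

theorem fps_p_partitions:
  assumes fin: "finite P" and R: "R \<subseteq> P \<times> P" "irrefl R" and inj: "inj_on \<omega> P"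
  shows "Abs_fps (\<lambda>M. of_nat (card (p_partitions P R \<omega> M)) :: rat) * (1 - fps_X) ^ (card P + 1) =
    (\<Sum>T\<in>linear_extensions P R. fps_X ^ card (descent_set P \<omega> T))"
proof -
  have finL: "finite (linear_extensions P R)"
  proof (rule finite_subset)
    show "linear_extensions P R \<subseteq> P \<rightarrow>\<^sub>E {1..card P}"
      by (auto simp: linear_extensions_def bij_betw_def PiE_def)
    show "finite (P \<rightarrow>\<^sub>E {1..card P})" using fin by (intro finite_PiE) auto
  qed
  let ?C = "\<lambda>T M. card (chains (descent_set P \<omega> T) (card P) M)"
  have card: "card (p_partitions P R \<omega> M) = (\<Sum>T\<in>linear_extensions P R. ?C T M)" for M
  proof -
    have "card (p_partitions P R \<omega> M) =
        (\<Sum>T\<in>linear_extensions P R. card {f \<in> P \<rightarrow>\<^sub>E {..M}. compatible P \<omega> T f})"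
      unfolding p_partitions_Union[OF fin R inj]
    proof (rule card_UN_disjoint[OF finL], intro ballI)
      show "finite {f \<in> P \<rightarrow>\<^sub>E {..M}. compatible P \<omega> T f}" for T
        by (rule finite_subset[of _ "P \<rightarrow>\<^sub>E {..M}"]) (use fin in \<open>auto intro: finite_PiE\<close>)
      show "\<forall>T\<in>linear_extensions P R. \<forall>T'\<in>linear_extensions P R. T \<noteq> T' \<longrightarrow>
          {f \<in> P \<rightarrow>\<^sub>E {..M}. compatible P \<omega> T f} \<inter> {f \<in> P \<rightarrow>\<^sub>E {..M}. compatible P \<omega> T' f} = {}"
        using linear_extensions_disjoint by blast
    qed
    also have "\<dots> = (\<Sum>T\<in>linear_extensions P R. ?C T M)"
      by (intro sum.cong refl card_compatible inj) (auto simp: linear_extensions_def)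
    finally show ?thesis .
  qed
  have "Abs_fps (\<lambda>M. of_nat (card (p_partitions P R \<omega> M)) :: rat) =
      (\<Sum>T\<in>linear_extensions P R. Abs_fps (\<lambda>M. of_nat (?C T M)))"
    by (rule fps_ext) (simp add: card fps_sum_nth)
  also have "\<dots> * (1 - fps_X) ^ (card P + 1) =
      (\<Sum>T\<in>linear_extensions P R. Abs_fps (\<lambda>M. of_nat (?C T M)) * (1 - fps_X) ^ Suc (card P))"
    by (simp add: sum_distrib_right)
  also have "\<dots> = (\<Sum>T\<in>linear_extensions P R. fps_X ^ card (descent_set P \<omega> T))"
  proof (rule sum.cong[OF refl])
    fix T
    have "descent_set P \<omega> T \<inter> {..<card P} = descent_set P \<omega> T" "0 \<notin> descent_set P \<omega> T"
      by (auto simp: descent_set_def)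
    then show "Abs_fps (\<lambda>M. of_nat (?C T M)) * (1 - fps_X) ^ Suc (card P) =
        (fps_X ^ card (descent_set P \<omega> T) :: rat fps)"
      using fps_chains[of "descent_set P \<omega> T" "card P"] by simp
  qed
  finally show ?thesis .
qed

section \<open>Flagged tableaux as \<open>(P, \<omega>)\<close>-partitions\<close>

definition diagram :: "(nat \<Rightarrow> nat) \<Rightarrow> (nat \<times> nat) set" where
  "diagram mu = {(r, c). c < mu r}"

definition diagram_covers :: "(nat \<Rightarrow> nat) \<Rightarrow> ((nat \<times> nat) \<times> (nat \<times> nat)) set" where
  "diagram_covers mu = {((r, c), (r, Suc c)) | r c. Suc c < mu r} \<union> {((r, c), (Suc r, c)) | r c. c < mu (Suc r)}"

definition end_content :: "(nat \<Rightarrow> nat) \<Rightarrow> nat \<Rightarrow> int" where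
  "end_content mu r = int (mu r) - 1 - int r"

text \<open>Only the flags of the corner rows \<open>mu (r + 1) < mu r\<close> restrict a column-strict tableau. The
  function \<open>shift\<close> of the content equals minus the flag at the corners and increases by \<open>0\<close> or
  \<open>1\<close> from one content to the next. Adding it to the entries of a tableau turns the flags into a
  common upper bound, while the condition along an edge of the diagram becomes weak or strict
  depending only on that increment.\<close>

locale flagged_shape =
  fixes mu phi :: "nat \<Rightarrow> nat" and L :: nat
  assumes mu_zero: "\<And>r. L \<le> r \<Longrightarrow> mu r = 0"
    and mu_decr: "\<And>r. mu (Suc r) \<le> mu r"
    and mu_pos: "0 < mu 0"
    and flag_pos: "\<And>r. mu (Suc r) < mu r \<Longrightarrow> 1 \<le> phi r"
    and flag_block: "\<And>r. 0 < mu r \<Longrightarrow> mu (Suc r) = mu r \<Longrightarrow> phi (Suc r) \<le> Suc (phi r)"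
    and flag_compat: "\<And>r s. mu (Suc r) < mu r \<Longrightarrow> mu (Suc s) < mu s \<Longrightarrow>
      int (phi r) - int (phi s) \<le> max 0 (end_content mu s - end_content mu r)"
begin

definition corners :: "nat set" where
  "corners = {r. mu (Suc r) < mu r}"

text \<open>The least function of the content with increments 0 or 1 that is at least
  \<open>- phi s\<close> at the end of each corner row \<open>s\<close>, as in the extension of
  Lipschitz functions from a subset.\<close>

definition shift :: "int \<Rightarrow> int" where
  "shift k = Max ((\<lambda>s. - int (phi s) - max 0 (end_content mu s - k)) ` corners)"

abbreviation content_shift :: "nat \<times> nat \<Rightarrow> int" where
  "content_shift p \<equiv> shift (int (snd p) - int (fst p))"

text \<open>A tableau entry at \<open>p\<close> is replaced by itself minus 1 plus
  \<open>content_shift p - shift 0\<close>, so the origin, of content 0, can reach 0. At a corner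
  the bound \<open>phi r + j\<close> becomes \<open>j - 1 - shift 0\<close>.\<close>

definition N :: int where
  "N = - 1 - shift 0"

text \<open>Let \<open>d\<close> be the increment of \<open>shift\<close> between neighbouring
  contents. The first component changes by \<open>1 - 2 * d\<close> to the right and by
  \<open>2 * d - 1\<close> downwards, never by 0. So the label drops to the right iff
  \<open>d = 1\<close> and downwards iff \<open>d = 0\<close>, exactly where the transformed entries
  must increase strictly. The second component only breaks ties.\<close>

definition key :: "nat \<times> nat \<Rightarrow> int \<times> (nat \<times> nat)" where
  "key p = (int (snd p) - int (fst p) - 2 * content_shift p, p)"

definition omega :: "nat \<times> nat \<Rightarrow> nat" where
  "omega = rank (diagram mu) key"

section \<open>The content shift and the labels\<close>

lemma mu_antimono: "r \<le> s \<Longrightarrow> mu s \<le> mu r"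
  by (rule lift_Suc_antimono_le[of mu, OF mu_decr])

lemma finite_corners: "finite corners"
proof (rule finite_subset)
  show "corners \<subseteq> {..<L}" using mu_zero by (force simp: corners_def not_le[symmetric])
qed simp

lemma corner_below:
  assumes "0 < mu r"
  shows "\<exists>s\<ge>r. s \<in> corners \<and> mu s = mu r"
proof -
  have "\<exists>s\<ge>r. mu s = mu r \<and> mu (Suc s) \<noteq> mu r"
  proof (rule ccontr)
    assume *: "\<not> (\<exists>s\<ge>r. mu s = mu r \<and> mu (Suc s) \<noteq> mu r)"
    have "mu (r + d) = mu r" for d
      using * by (induction d) auto
    then show False using mu_zero[of "r + L"] assms by simp
  qed
  then obtain s where "r \<le> s" "mu s = mu r" "mu (Suc s) \<noteq> mu r" by blast
  then show ?thesis using mu_decr[of s] by (intro exI[of _ s]) (auto simp: corners_def)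
qed

lemma corners_nonempty: "corners \<noteq> {}"
  using corner_below[OF mu_pos] by blast

lemma shift_ge: "s \<in> corners \<Longrightarrow> - int (phi s) - max 0 (end_content mu s - k) \<le> shift k"
  unfolding shift_def using finite_corners by (intro Max_ge) auto

lemma shift_leI:
  assumes "\<And>s. s \<in> corners \<Longrightarrow> - int (phi s) - max 0 (end_content mu s - k) \<le> x"
  shows "shift k \<le> x"
  unfolding shift_def using finite_corners corners_nonempty assms by (subst Max_le_iff) auto

lemma shift_step: "shift k \<le> shift (k + 1)" "shift (k + 1) \<le> shift k + 1"
proof -
  show "shift k \<le> shift (k + 1)"
  proof (rule shift_leI)
    fix s assume "s \<in> corners"
    then show "- int (phi s) - max 0 (end_content mu s - k) \<le> shift (k + 1)"
      using shift_ge[of s "k + 1"] by linarith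
  qed
  show "shift (k + 1) \<le> shift k + 1"
  proof (rule shift_leI)
    fix s assume "s \<in> corners"
    then show "- int (phi s) - max 0 (end_content mu s - (k + 1)) \<le> shift k + 1"
      using shift_ge[of s k] by linarith
  qed
qed

text \<open>The term of \<open>r\<close> itself attains the value; \<open>flag_compat\<close> says
  that no other corner gives more.\<close>

lemma shift_corner: "r \<in> corners \<Longrightarrow> shift (end_content mu r) = - int (phi r)"
proof (rule antisym)
  assume r: "r \<in> corners"
  show "shift (end_content mu r) \<le> - int (phi r)"
  proof (rule shift_leI)
    fix s assume "s \<in> corners"
    then show "- int (phi s) - max 0 (end_content mu s - end_content mu r) \<le> - int (phi r)"
      using flag_compat[of r s] r by (simp add: corners_def)
  qed
  show "- int (phi r) \<le> shift (end_content mu r)"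
    using shift_ge[OF r, of "end_content mu r"] by simp
qed

lemma N_nonneg: "0 \<le> N"
proof -
  have "shift 0 \<le> - 1"
  proof (rule shift_leI)
    fix s assume "s \<in> corners"
    then have "1 \<le> phi s" using flag_pos by (simp add: corners_def)
    then show "- int (phi s) - max 0 (end_content mu s - 0) \<le> - 1" by linarith
  qed
  then show ?thesis by (simp add: N_def)
qed

lemma finite_diagram: "finite (diagram mu)"
proof (rule finite_subset)
  show "diagram mu \<subseteq> {..<L} \<times> {..<mu 0}"
  proof
    fix p assume "p \<in> diagram mu"
    then obtain r c where p: "p = (r, c)" "c < mu r" by (auto simp: diagram_def)
    then have "r < L" "c < mu 0" using mu_zero[of r] mu_antimono[of 0 r] by (auto simp: not_le[symmetric])
    then show "p \<in> {..<L} \<times> {..<mu 0}" using p by simp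
  qed
qed simp

lemma covers_subset: "diagram_covers mu \<subseteq> diagram mu \<times> diagram mu"
  using mu_decr by (auto simp: diagram_covers_def diagram_def intro: less_le_trans)

lemma inj_key: "inj_on key (diagram mu)"
  by (auto simp: key_def inj_on_def)

lemma omega_bij: "bij_betw omega (diagram mu) {1..card (diagram mu)}"
  unfolding omega_def by (rule rank_bij_betw[OF finite_diagram inj_key])

lemma omega_less_iff:
  assumes "p \<in> diagram mu" "q \<in> diagram mu"
  shows "omega p < omega q \<longleftrightarrow> key p < key q"
  unfolding omega_def by (rule rank_less_iff[OF finite_diagram assms])

lemma omega_right:
  assumes "Suc c < mu r"
  shows "content_shift (r, Suc c) - content_shift (r, c) = of_bool (omega (r, Suc c) < omega (r, c))"
proof -
  define k where "k = int c - int r"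
  have k: "int (Suc c) - int r = k + 1" by (simp add: k_def)
  have "omega (r, Suc c) < omega (r, c) \<longleftrightarrow> key (r, Suc c) < key (r, c)"
    by (rule omega_less_iff) (use assms in \<open>auto simp: diagram_def\<close>)
  also have "\<dots> \<longleftrightarrow> shift (k + 1) - shift k = 1"
    using shift_step[of k] unfolding key_def snd_conv fst_conv k k_def[symmetric] by auto
  finally show ?thesis
    using shift_step[of k] unfolding snd_conv fst_conv k k_def[symmetric] by auto
qed

lemma omega_down:
  assumes "c < mu (Suc r)"
  shows "content_shift (r, c) - content_shift (Suc r, c) = 1 - of_bool (omega (Suc r, c) < omega (r, c))"
proof -
  define k where "k = int c - int (Suc r)"
  have k: "int c - int r = k + 1" by (simp add: k_def)
  have "omega (Suc r, c) < omega (r, c) \<longleftrightarrow> key (Suc r, c) < key (r, c)"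
    by (rule omega_less_iff) (use assms mu_decr[of r] in \<open>auto simp: diagram_def\<close>)
  also have "\<dots> \<longleftrightarrow> shift (k + 1) - shift k = 0"
    using shift_step[of k] unfolding key_def snd_conv fst_conv k k_def[symmetric] by auto
  finally show ?thesis
    using shift_step[of k] unfolding snd_conv fst_conv k k_def[symmetric] by auto
qed

section \<open>Translation between tableaux and partitions\<close>

lemma cover_cond_iff:
  fixes x y :: int
  shows "(x \<le> y \<and> (b \<longrightarrow> x < y)) \<longleftrightarrow> of_bool b \<le> y - x"
  by auto

text \<open>Every path of steps right and down ends in a corner, so upper bounds spread from the
  corners back to all boxes.\<close>

lemma cell_induct_up:
  assumes cell: "c < mu r"
    and corner: "\<And>r. r \<in> corners \<Longrightarrow> Q r (mu r - 1)"
    and right: "\<And>r c. Suc c < mu r \<Longrightarrow> Q r (Suc c) \<Longrightarrow> Q r c"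
    and down: "\<And>r c. c < mu (Suc r) \<Longrightarrow> Q (Suc r) c \<Longrightarrow> Q r c"
  shows "Q r c"
  using cell
proof (induction "(L - r) + (mu 0 - c)" arbitrary: r c rule: less_induct)
  case less
  have r: "r < L" "c < mu 0"
    using less.prems mu_zero[of r] mu_antimono[of 0 r] by (auto simp: not_le[symmetric])
  consider "Suc c < mu r" | "c < mu (Suc r)" | "mu r \<le> Suc c" "mu (Suc r) \<le> c" by linarith
  then show ?case
  proof cases
    case 1
    then show ?thesis using right[OF 1] less.hyps[of r "Suc c"] r mu_antimono[of 0 r] by simp
  next
    case 2
    then show ?thesis using down[OF 2] less.hyps[of "Suc r" c] r by simp
  next
    case 3
    then have "r \<in> corners" "c = mu r - 1" using less.prems by (auto simp: corners_def)
    then show ?thesis using corner by simp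
  qed
qed

lemma cell_induct_down:
  assumes cell: "c < mu r"
    and origin: "Q 0 0"
    and right: "\<And>r c. Suc c < mu r \<Longrightarrow> Q r c \<Longrightarrow> Q r (Suc c)"
    and down: "\<And>r c. c < mu (Suc r) \<Longrightarrow> Q r c \<Longrightarrow> Q (Suc r) c"
  shows "Q r c"
  using cell
proof (induction "r + c" arbitrary: r c rule: less_induct)
  case less
  show ?case
  proof (cases c)
    case (Suc c')
    then show ?thesis using right[of c' r] less.hyps[of r c'] less.prems by simp
  next
    case c: 0
    show ?thesis
    proof (cases r)
      case (Suc r')
      then show ?thesis using down[of c r'] less.hyps[of r' c] less.prems mu_decr[of r'] by simp
    qed (use c origin in simp)
  qed
qed

text \<open>The inverse translation, kept in the integers and for an arbitrary bound
  \<open>M\<close>: it serves the bijection at \<open>M = j + N\<close> and the emptiness for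
  \<open>M < N\<close>.\<close>

lemma p_partition_int:
  assumes F: "F \<in> p_partitions (diagram mu) (diagram_covers mu) omega M"
  defines "t \<equiv> \<lambda>p. int (F p) + 1 - content_shift p + shift 0"
  shows "Suc c < mu r \<Longrightarrow> t (r, c) \<le> t (r, Suc c)" "c < mu (Suc r) \<Longrightarrow> t (r, c) < t (Suc r, c)"
    "1 \<le> t (0, 0)" "r \<in> corners \<Longrightarrow> t (r, mu r - 1) \<le> int M + 1 + shift 0 + int (phi r)"
proof -
  have cov: "of_bool (omega q < omega p) \<le> int (F q) - int (F p)" if "(p, q) \<in> diagram_covers mu" for p q
    using F that unfolding p_partitions_def cover_cond_iff[symmetric] by auto
  show "t (r, c) \<le> t (r, Suc c)" if "Suc c < mu r"
    using cov[of "(r, c)" "(r, Suc c)"] omega_right[OF that] that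
    by (auto simp: diagram_covers_def t_def)
  show "t (r, c) < t (Suc r, c)" if "c < mu (Suc r)"
    using cov[of "(r, c)" "(Suc r, c)"] omega_down[OF that] that
    by (auto simp: diagram_covers_def t_def)
  show "1 \<le> t (0, 0)" by (simp add: t_def)
  show "t (r, mu r - 1) \<le> int M + 1 + shift 0 + int (phi r)" if r: "r \<in> corners"
  proof -
    have pos: "0 < mu r" using r by (simp add: corners_def)
    then have "F (r, mu r - 1) \<le> M" using F by (auto simp: p_partitions_def diagram_def)
    moreover have "int (mu r - 1) - int r = end_content mu r" using pos by (simp add: end_content_def)
    ultimately show ?thesis using shift_corner[OF r] by (simp add: t_def)
  qed
qed

lemma row_weak:
  assumes "\<And>c. Suc c < mu r \<Longrightarrow> t (r, c) \<le> (t (r, Suc c) :: int)" and "c \<le> d" "d < mu r"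
  shows "t (r, c) \<le> t (r, d)"
  using assms(2,3)
proof (induction d rule: dec_induct)
  case (step n)
  then show ?case using assms(1)[of n] by simp
qed simp

text \<open>Column-strictness forces at least \<open>r + 1\<close> in the first box of row
  \<open>r\<close>, hence also in its last one, whereas the bound at that corner is
  \<open>M - N + phi r\<close>, which is smaller.\<close>

lemma p_partitions_empty:
  assumes r: "r \<in> corners" "phi r = Suc r" and M: "int M < N"
  shows "p_partitions (diagram mu) (diagram_covers mu) omega M = {}"
proof (rule ccontr)
  assume "p_partitions (diagram mu) (diagram_covers mu) omega M \<noteq> {}"
  then obtain F where F: "F \<in> p_partitions (diagram mu) (diagram_covers mu) omega M" by blast
  let ?t = "\<lambda>p. int (F p) + 1 - content_shift p + shift 0"
  note t = p_partition_int[OF F]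
  have pos: "0 < mu r" using r by (simp add: corners_def)
  have "int s + 1 \<le> ?t (s, 0)" if "s \<le> r" for s
    using that
  proof (induction s)
    case (Suc s)
    have "0 < mu (Suc s)" using mu_antimono[OF Suc.prems] pos by simp
    then show ?case using t(2)[of 0 s] Suc by simp
  qed (use t(3) in simp)
  then have "int r + 1 \<le> ?t (r, 0)" by simp
  also have "\<dots> \<le> ?t (r, mu r - 1)"
    using row_weak[of r ?t 0 "mu r - 1"] t(1) pos by simp
  also have "\<dots> \<le> int M + 1 + shift 0 + int (phi r)" by (rule t(4)[OF r(1)])
  finally show False using M r(2) by (simp add: N_def)
qed

lemma card_tableaux_eq_p_partitions:
  assumes v: "\<And>r. 0 < mu r \<Longrightarrow> phi r + j \<le> v"
  shows "card (tableaux (\<lambda>r. phi r + j) v mu) =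
    card (p_partitions (diagram mu) (diagram_covers mu) omega (j + nat N))"
proof -
  let ?M = "j + nat N"
  have M: "int ?M = int j - 1 - shift 0" using N_nonneg by (simp add: N_def)
  define f where "f = (\<lambda>(T :: nat \<times> nat \<Rightarrow> nat) p. int (T p) - 1 + content_shift p - shift 0)"
  define t where "t = (\<lambda>(F :: nat \<times> nat \<Rightarrow> nat) p. int (F p) + 1 - content_shift p + shift 0)"
  let ?f = "\<lambda>T. restrict (\<lambda>p. nat (f T p)) (diagram mu)"
  let ?t = "\<lambda>F p. if p \<in> diagram mu then nat (t F p) else 0"
  have f_right: "of_bool (omega (r, Suc c) < omega (r, c)) \<le> f T (r, Suc c) - f T (r, c)"
    if T: "T \<in> tableaux (\<lambda>r. phi r + j) v mu" and c: "Suc c < mu r" for T r c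
    using omega_right[OF c] tableauxD(5)[OF T c] by (simp add: f_def)
  have f_down: "of_bool (omega (Suc r, c) < omega (r, c)) \<le> f T (Suc r, c) - f T (r, c)"
    if T: "T \<in> tableaux (\<lambda>r. phi r + j) v mu" and c: "c < mu (Suc r)" for T r c
    using omega_down[OF c] tableauxD(6)[OF T c] by (simp add: f_def)
  have f_nonneg: "0 \<le> f T (r, c)"
    if T: "T \<in> tableaux (\<lambda>r. phi r + j) v mu" and c: "c < mu r" for T r c
    using c
  proof (rule cell_induct_down)
    show "0 \<le> f T (0, 0)" using tableauxD(1)[OF T mu_pos] by (simp add: f_def)
    show "0 \<le> f T (r, Suc c)" if "Suc c < mu r" "0 \<le> f T (r, c)" for r c
      using f_right[OF T that(1)] that(2) by (auto simp: of_bool_def split: if_splits)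
    show "0 \<le> f T (Suc r, c)" if "c < mu (Suc r)" "0 \<le> f T (r, c)" for r c
      using f_down[OF T that(1)] that(2) by (auto simp: of_bool_def split: if_splits)
  qed
  have f_le: "f T (r, c) \<le> int ?M"
    if T: "T \<in> tableaux (\<lambda>r. phi r + j) v mu" and c: "c < mu r" for T r c
    using c
  proof (rule cell_induct_up)
    fix r assume r: "r \<in> corners"
    then have pos: "0 < mu r" by (simp add: corners_def)
    then have "T (r, mu r - 1) \<le> phi r + j" using tableauxD(3)[OF T, of "mu r - 1" r] by simp
    moreover have "int (mu r - 1) - int r = end_content mu r" using pos by (simp add: end_content_def)
    ultimately show "f T (r, mu r - 1) \<le> int ?M"
      unfolding M using shift_corner[OF r] by (simp add: f_def)
  next
    show "f T (r, c) \<le> int ?M" if "Suc c < mu r" "f T (r, Suc c) \<le> int ?M" for r c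
      using f_right[OF T that(1)] that(2) by (auto simp: of_bool_def split: if_splits)
    show "f T (r, c) \<le> int ?M" if "c < mu (Suc r)" "f T (Suc r, c) \<le> int ?M" for r c
      using f_down[OF T that(1)] that(2) by (auto simp: of_bool_def split: if_splits)
  qed
  have t: "Suc c < mu r \<Longrightarrow> t F (r, c) \<le> t F (r, Suc c)" "c < mu (Suc r) \<Longrightarrow> t F (r, c) < t F (Suc r, c)"
    "1 \<le> t F (0, 0)" "r \<in> corners \<Longrightarrow> t F (r, mu r - 1) \<le> int (phi r) + int j"
    if F: "F \<in> p_partitions (diagram mu) (diagram_covers mu) omega ?M" for F r c
  proof -
    show "t F (r, c) \<le> t F (r, Suc c)" if "Suc c < mu r"
      using p_partition_int(1)[OF F that] by (simp only: t_def)
    show "t F (r, c) < t F (Suc r, c)" if "c < mu (Suc r)"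
      using p_partition_int(2)[OF F that] by (simp only: t_def)
    show "1 \<le> t F (0, 0)" using p_partition_int(3)[OF F] by (simp only: t_def)
    show "t F (r, mu r - 1) \<le> int (phi r) + int j" if "r \<in> corners"
      using p_partition_int(4)[OF F that] unfolding M by (simp add: t_def)
  qed
  have t_pos: "1 \<le> t F (r, c)"
    if F: "F \<in> p_partitions (diagram mu) (diagram_covers mu) omega ?M" and c: "c < mu r" for F r c
    using c
  proof (rule cell_induct_down)
    show "1 \<le> t F (0, 0)" by (rule t(3)[OF F])
    show "1 \<le> t F (r, Suc c)" if "Suc c < mu r" "1 \<le> t F (r, c)" for r c
      using t(1)[OF F that(1)] that(2) by simp
    show "1 \<le> t F (Suc r, c)" if "c < mu (Suc r)" "1 \<le> t F (r, c)" for r c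
      using t(2)[OF F that(1)] that(2) by simp
  qed
  have t_le: "t F (r, c) \<le> int (phi r) + int j"
    if F: "F \<in> p_partitions (diagram mu) (diagram_covers mu) omega ?M" and c: "c < mu r" for F r c
    using c
  proof (induction "L - r" arbitrary: r c rule: less_induct)
    case less
    have row: "t F (r, c) \<le> t F (r, mu r - 1)"
      using row_weak[of r "t F" c "mu r - 1"] t(1)[OF F] less.prems by simp
    show ?case
    proof (cases "r \<in> corners")
      case True
      then show ?thesis using row t(4)[OF F True] by simp
    next
      case False
      \<comment> \<open>A row that is not a corner inherits its bound from the row below: the last
        column increases strictly, and \<open>flag_block\<close> says that the flag grows by at most
        one.\<close>
      then have eq: "mu (Suc r) = mu r" using mu_decr[of r] by (simp add: corners_def)
      have "r < L" using less.prems mu_zero[of r] by (auto simp: not_le[symmetric])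
      then have "t F (Suc r, mu r - 1) \<le> int (phi (Suc r)) + int j"
        using less.hyps[of "Suc r" "mu r - 1"] less.prems eq by simp
      moreover have "t F (r, mu r - 1) < t F (Suc r, mu r - 1)"
        using t(2)[OF F, of "mu r - 1" r] eq less.prems by simp
      moreover have "phi (Suc r) \<le> Suc (phi r)" using flag_block[OF _ eq] less.prems by simp
      ultimately show ?thesis using row by simp
    qed
  qed
  have "bij_betw ?f (tableaux (\<lambda>r. phi r + j) v mu)
      (p_partitions (diagram mu) (diagram_covers mu) omega ?M)"
  proof (rule bij_betw_byWitness[where f' = ?t])
    show "\<forall>T\<in>tableaux (\<lambda>r. phi r + j) v mu. ?t (?f T) = T"
    proof (intro ballI ext)
      fix T and p :: "nat \<times> nat" assume T: "T \<in> tableaux (\<lambda>r. phi r + j) v mu"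
      obtain r c where p: "p = (r, c)" by (cases p)
      show "?t (?f T) p = T p"
      proof (cases "c < mu r")
        case True
        then have "t (?f T) p = int (T p)"
          using f_nonneg[OF T True] by (simp add: t_def p diagram_def) (simp add: f_def)
        then show ?thesis using True by (simp add: p diagram_def)
      next
        case False
        then show ?thesis using tableauxD(4)[OF T False] by (simp add: p diagram_def)
      qed
    qed
    show "\<forall>F\<in>p_partitions (diagram mu) (diagram_covers mu) omega ?M. ?f (?t F) = F"
    proof (intro ballI ext)
      fix F and p :: "nat \<times> nat" assume F: "F \<in> p_partitions (diagram mu) (diagram_covers mu) omega ?M"
      obtain r c where p: "p = (r, c)" by (cases p)
      show "?f (?t F) p = F p"
      proof (cases "c < mu r")
        case True
        then have "f (?t F) p = int (F p)"
          using t_pos[OF F True] by (simp add: f_def p diagram_def) (simp add: t_def)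
        then show ?thesis using True by (simp add: p diagram_def)
      next
        case False
        then have "p \<notin> diagram mu" by (simp add: p diagram_def)
        moreover have "F \<in> diagram mu \<rightarrow>\<^sub>E {..?M}" using F by (simp add: p_partitions_def)
        ultimately have "F p = undefined" by (auto dest: PiE_arb)
        then show ?thesis using \<open>p \<notin> diagram mu\<close> by simp
      qed
    qed
    show "?f ` tableaux (\<lambda>r. phi r + j) v mu \<subseteq> p_partitions (diagram mu) (diagram_covers mu) omega ?M"
    proof (intro image_subsetI)
      fix T assume T: "T \<in> tableaux (\<lambda>r. phi r + j) v mu"
      have "?f T \<in> diagram mu \<rightarrow>\<^sub>E {..?M}"
      proof (rule restrict_PiE_iff[THEN iffD2], rule ballI)
        fix p assume "p \<in> diagram mu"
        then obtain r c where p: "p = (r, c)" "c < mu r" by (auto simp: diagram_def)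
        show "nat (f T p) \<in> {..?M}" unfolding atMost_iff nat_le_iff p(1) by (rule f_le[OF T p(2)])
      qed
      moreover have "?f T p \<le> ?f T q \<and> (omega q < omega p \<longrightarrow> ?f T p < ?f T q)"
        if pq: "(p, q) \<in> diagram_covers mu" for p q
      proof -
        have mem: "p \<in> diagram mu" "q \<in> diagram mu" using covers_subset pq by blast+
        have "of_bool (omega q < omega p) \<le> f T q - f T p"
        proof -
          consider r c where "p = (r, c)" "q = (r, Suc c)" "Suc c < mu r"
            | r c where "p = (r, c)" "q = (Suc r, c)" "c < mu (Suc r)"
            using pq unfolding diagram_covers_def by blast
          then show ?thesis
          proof cases
            case 1
            show ?thesis unfolding 1(1,2) by (rule f_right[OF T 1(3)])
          next
            case 2
            show ?thesis unfolding 2(1,2) by (rule f_down[OF T 2(3)])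
          qed
        qed
        then have *: "f T p \<le> f T q \<and> (omega q < omega p \<longrightarrow> f T p < f T q)"
          unfolding cover_cond_iff .
        obtain r c where p: "p = (r, c)" by (cases p)
        then have "0 \<le> f T p" using f_nonneg[OF T, of c r] mem(1) by (simp add: diagram_def)
        then show ?thesis using * mem by auto
      qed
      ultimately show "?f T \<in> p_partitions (diagram mu) (diagram_covers mu) omega ?M"
        unfolding p_partitions_def by blast
    qed
    show "?t ` p_partitions (diagram mu) (diagram_covers mu) omega ?M \<subseteq> tableaux (\<lambda>r. phi r + j) v mu"
    proof (intro image_subsetI)
      fix F assume F: "F \<in> p_partitions (diagram mu) (diagram_covers mu) omega ?M"
      have val: "?t F (r, c) = nat (t F (r, c))" if "c < mu r" for r c using that by (simp add: diagram_def)
      show "?t F \<in> tableaux (\<lambda>r. phi r + j) v mu"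
      proof (rule tableauxI)
        show "1 \<le> ?t F (r, c) \<and> ?t F (r, c) \<le> v \<and> ?t F (r, c) \<le> phi r + j" if c: "c < mu r" for r c
        proof -
          have "phi r + j \<le> v" using v[of r] c by simp
          then show ?thesis unfolding val[OF c] using t_pos[OF F c] t_le[OF F c] by linarith
        qed
        show "?t F (r, c) = 0" if "\<not> c < mu r" for r c using that by (simp add: diagram_def)
        show "?t F (r, c) \<le> ?t F (r, Suc c)" if c: "Suc c < mu r" for r c
          using t(1)[OF F c] val[of c r] val[OF c] c by simp
        show "?t F (r, c) < ?t F (Suc r, c)" if c: "c < mu (Suc r)" for r c
        proof -
          have c': "c < mu r" using c mu_decr[of r] by simp
          show ?thesis unfolding val[OF c] val[OF c'] using t(2)[OF F c] t_pos[OF F c'] by simp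
        qed
      qed
    qed
  qed
  then show ?thesis by (rule bij_betw_same_card)
qed

end

section \<open>Codes and the shape of the tableaux\<close>

lemma last_pos_le:
  assumes "code_support m c" "1 \<le> e" "e \<le> c y"
  shows "1 \<le> last_pos c e" "last_pos c e \<le> m"
  using last_pos_in[OF assms] code_support_subset[OF assms(1,2)] by auto

lemma last_pos_antimono:
  assumes "code_support m c" "1 \<le> e" "e \<le> e'" "e' \<le> c y"
  shows "last_pos c e' \<le> last_pos c e"
proof (rule last_pos_ge[OF assms(1,2)])
  show "e \<le> c (last_pos c e')"
    using last_pos_in[OF assms(1) _ assms(4)] assms(2,3) by simp
qed

lemma last_pos_eq_row_count:
  assumes supp: "code_support m c" and e: "1 \<le> e" "e \<le> c y"
  shows "last_pos c e = row_count c e + card {x \<in> {1..last_pos c e}. c x < e}"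
proof -
  have "{1..last_pos c e} = {x. e \<le> c x} \<union> {x \<in> {1..last_pos c e}. c x < e}"
    using last_pos_ge[OF supp e(1)] code_support_subset[OF supp e(1)] by force
  then have "card {1..last_pos c e} = card ({x. e \<le> c x} \<union> {x \<in> {1..last_pos c e}. c x < e})"
    by (rule arg_cong)
  also have "\<dots> = card {x. e \<le> c x} + card {x \<in> {1..last_pos c e}. c x < e}"
    by (rule card_Un_disjoint) (use finite_code_ge[OF supp e(1)] in auto)
  finally show ?thesis by (simp add: row_count_def)
qed

text \<open>The difference \<open>last_pos c e - row_count c e\<close> counts the smaller codes up
  to the last position. Those counted for \<open>e1\<close> but not for \<open>e2\<close> lie
  between \<open>i\<close> and the last position for \<open>e1\<close>, where
  \<open>vex_code\<close> allows at most \<open>e2 - e1\<close> of them.\<close>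

lemma last_pos_compare:
  assumes supp: "code_support m c" and vex: "vex_code c" and e: "1 \<le> e1" "e1 < e2" "c i = e2"
  shows "last_pos c e1 + row_count c e2 \<le> last_pos c e2 + row_count c e1 + (e2 - e1)"
proof -
  let ?J = "last_pos c e1" and ?K = "last_pos c e2"
  let ?D = "\<lambda>e. {x \<in> {1..last_pos c e}. c x < e}"
  have J: "e1 \<le> c ?J" by (rule last_pos_in[OF supp e(1), of i]) (use e in simp)
  have iK: "i \<le> ?K" by (rule last_pos_ge[OF supp]) (use e in auto)
  have "card (?D e1) \<le> card (?D e2) + (e2 - e1)"
  proof (cases "?K < ?J")
    case False
    then have "?D e1 \<subseteq> ?D e2" using e by auto
    then have "card (?D e1) \<le> card (?D e2)" by (intro card_mono) auto
    then show ?thesis by simp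
  next
    case True
    have cJ: "c ?J < e2"
    proof (rule ccontr)
      assume "\<not> c ?J < e2"
      then have "?J \<le> ?K" by (intro last_pos_ge[OF supp]) (use e in auto)
      then show False using True by simp
    qed
    have "?D e1 \<subseteq> ?D e2 \<union> {x \<in> {i<..<?J}. c x < c ?J}"
    proof
      fix x assume x: "x \<in> ?D e1"
      show "x \<in> ?D e2 \<union> {x \<in> {i<..<?J}. c x < c ?J}"
      proof (cases "x \<le> ?K")
        case True
        then show ?thesis using x e by simp
      next
        case False
        moreover have "x \<noteq> ?J" using x J by auto
        ultimately show ?thesis using x J iK by simp
      qed
    qed
    then have "card (?D e1) \<le> card (?D e2 \<union> {x \<in> {i<..<?J}. c x < c ?J})"
      by (intro card_mono) auto
    also have "\<dots> \<le> card (?D e2) + card {x \<in> {i<..<?J}. c x < c ?J}" by (rule card_Un_le)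
    also have "card {x \<in> {i<..<?J}. c x < c ?J} \<le> c i - c ?J"
      by (rule vex_code_card[OF vex]) (use iK True cJ e in auto)
    also have "c i - c ?J \<le> e2 - e1" using J e by simp
    finally show ?thesis by simp
  qed
  moreover have "?J = row_count c e1 + card (?D e1)"
    by (rule last_pos_eq_row_count[OF supp e(1), of i]) (use e in simp)
  moreover have "?K = row_count c e2 + card (?D e2)"
    by (rule last_pos_eq_row_count[OF supp, of _ i]) (use e in auto)
  ultimately show ?thesis by linarith
qed

lemma corner_row_count:
  assumes "code_support m c" "row_len c (Suc r) < row_len c r"
  shows "row_count c (row_len c r) = Suc r"
proof -
  have "1 \<le> row_len c r" using assms(2) by simp
  then show ?thesis
    using row_len_ge_iff[OF assms(1), of "row_len c r"] assms(2) by (metis Suc_lessI leD order_refl)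
qed

lemma flagged_shape_code:
  assumes supp: "code_support m c" and vex: "vex_code c" and pos: "1 \<le> c y"
  shows "flagged_shape (row_len c) (flag c) m"
proof
  show "row_len c r = 0" if "m \<le> r" for r by (rule row_len_eq_0[OF supp that])
  show "row_len c (Suc r) \<le> row_len c r" for r by (rule row_len_antimono[OF supp]) simp
  have "y \<in> {x. 1 \<le> c x}" using pos by simp
  then have "0 < row_count c 1"
    unfolding row_count_def using finite_code_ge[OF supp, of 1] by (auto simp: card_gt_0_iff)
  then show "0 < row_len c 0" using row_len_ge_iff[OF supp, of 1 0] by simp
  show "1 \<le> flag c r" if "row_len c (Suc r) < row_len c r" for r
  proof -
    have e: "1 \<le> row_len c r" using that by simp
    obtain x where "c x = row_len c r" using row_len_attained[OF supp e] by blast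
    then show ?thesis unfolding flag_def by (intro last_pos_le(1)[OF supp e, of x]) simp
  qed
  show "flag c (Suc r) \<le> Suc (flag c r)" if "row_len c (Suc r) = row_len c r" for r
    using that by (simp add: flag_def)
  fix r s assume r: "row_len c (Suc r) < row_len c r" and s: "row_len c (Suc s) < row_len c s"
  let ?e1 = "row_len c r" and ?e2 = "row_len c s"
  have e: "1 \<le> ?e1" "1 \<le> ?e2" using r s by auto
  obtain x y where x: "c x = ?e1" and y: "c y = ?e2"
    using row_len_attained[OF supp e(1)] row_len_attained[OF supp e(2)] by blast
  show "int (flag c r) - int (flag c s) \<le> max 0 (end_content (row_len c) s - end_content (row_len c) r)"
  proof (cases "?e1 < ?e2")
    case True
    \<comment> \<open>At a corner, \<open>row_count\<close> of the row length is the row index plus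
      one, which turns the comparison of last positions into one of contents.\<close>
    have "flag c r + Suc s \<le> flag c s + Suc r + (?e2 - ?e1)"
      using last_pos_compare[OF supp vex e(1) True y] corner_row_count[OF supp r] corner_row_count[OF supp s]
      by (simp add: flag_def)
    then show ?thesis using True by (simp add: end_content_def)
  next
    case False
    then have "flag c r \<le> flag c s"
      unfolding flag_def using last_pos_antimono[OF supp e(2), of ?e1 x] x by simp
    then show ?thesis by simp
  qed
qed

text \<open>The positions with code at least \<open>c 1\<close> form an initial interval, so the last row of length
  \<open>c 1\<close> has the smallest flag that admits a column-strict tableau.\<close>

lemma ex_tight_corner:
  assumes supp: "code_support m c" and vex: "vex_code c" and pos: "1 \<le> c 1"
  shows "\<exists>r. row_len c (Suc r) < row_len c r \<and> flag c r = Suc r"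
proof -
  let ?e = "c 1"
  let ?f = "last_pos c ?e"
  have f: "?e \<le> c ?f" by (rule last_pos_in[OF supp pos, of 1]) simp
  have f1: "1 \<le> ?f" by (rule last_pos_le[OF supp pos, of 1]) simp
  have "{x. ?e \<le> c x} = {1..?f}"
  proof (intro equalityI subsetI)
    fix x assume "x \<in> {x. ?e \<le> c x}"
    then show "x \<in> {1..?f}"
      using last_pos_ge[OF supp pos, of x] code_support_subset[OF supp pos] by auto
  next
    fix x assume x: "x \<in> {1..?f}"
    consider "x = 1" | "x = ?f" | "1 < x" "x < ?f" using x by fastforce
    then show "x \<in> {x. ?e \<le> c x}"
      by cases (use f vex_code_between[OF vex, of 1 x ?f] in auto)
  qed
  then have count: "row_count c ?e = ?f" by (simp add: row_count_def)
  have less: "row_count c (?e + 1) < ?f"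
  proof -
    have "{x. ?e + 1 \<le> c x} \<subseteq> {x. ?e \<le> c x} - {1}" by auto
    then have "row_count c (?e + 1) \<le> card ({x. ?e \<le> c x} - {1})"
      unfolding row_count_def using finite_code_ge[OF supp pos] by (intro card_mono) auto
    also have "\<dots> < row_count c ?e"
      unfolding row_count_def using finite_code_ge[OF supp pos] by (intro card_Diff1_less) auto
    finally show ?thesis using count by simp
  qed
  have len: "row_len c (?f - 1) = ?e"
  proof (rule antisym)
    show "?e \<le> row_len c (?f - 1)"
      using row_len_ge_iff[OF supp pos, of "?f - 1"] count f1 by simp
    have "\<not> ?e + 1 \<le> row_len c (?f - 1)"
      using row_len_ge_iff[OF supp, of "?e + 1" "?f - 1"] less by simp
    then show "row_len c (?f - 1) \<le> ?e" by simp
  qed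
  have "row_len c ?f < ?e" using row_len_ge_iff[OF supp pos, of ?f] count by simp
  then show ?thesis
    using len f1 by (intro exI[of _ "?f - 1"]) (simp add: flag_def)
qed

section \<open>The permutations \<open>shift_perm j u\<close> and the values of
  \<open>nu\<close>\<close>

lemma shift_perm_permutes:
  assumes "u permutes {1..m}"
  shows "shift_perm j u permutes {1..j + m}"
proof (rule bij_imp_permutes)
  have range: "1 \<le> u (i - j) \<and> u (i - j) \<le> m" if "\<not> i \<le> j" "i \<le> j + m" for i
  proof -
    have "i - j \<in> {1..m}" using that by auto
    then show ?thesis using permutes_in_image[OF assms, of "i - j"] by simp
  qed
  have inv_range: "1 \<le> inv u (i - j) \<and> inv u (i - j) \<le> m" if "\<not> i \<le> j" "i \<le> j + m" for i
  proof -
    have "i - j \<in> {1..m}" using that by auto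
    then show ?thesis using permutes_in_image[OF permutes_inv[OF assms], of "i - j"] by simp
  qed
  show "bij_betw (shift_perm j u) {1..j + m} {1..j + m}"
  proof (rule bij_betw_byWitness[where f' = "shift_perm j (inv u)"])
    show "\<forall>i\<in>{1..j + m}. shift_perm j (inv u) (shift_perm j u i) = i"
    proof
      fix i assume "i \<in> {1..j + m}"
      then show "shift_perm j (inv u) (shift_perm j u i) = i"
        using range[of i] permutes_inverses(2)[OF assms, of "i - j"] by (cases "i \<le> j") (auto simp: shift_perm_def)
    qed
    show "\<forall>i\<in>{1..j + m}. shift_perm j u (shift_perm j (inv u) i) = i"
    proof
      fix i assume "i \<in> {1..j + m}"
      then show "shift_perm j u (shift_perm j (inv u) i) = i"
        using inv_range[of i] permutes_inverses(1)[OF assms, of "i - j"] by (cases "i \<le> j") (auto simp: shift_perm_def)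
    qed
    show "shift_perm j u ` {1..j + m} \<subseteq> {1..j + m}"
    proof (intro image_subsetI)
      fix i assume "i \<in> {1..j + m}"
      then show "shift_perm j u i \<in> {1..j + m}"
        using range[of i] by (cases "i \<le> j") (auto simp: shift_perm_def)
    qed
    show "shift_perm j (inv u) ` {1..j + m} \<subseteq> {1..j + m}"
    proof (intro image_subsetI)
      fix i assume "i \<in> {1..j + m}"
      then show "shift_perm j (inv u) i \<in> {1..j + m}"
        using inv_range[of i] by (cases "i \<le> j") (auto simp: shift_perm_def)
    qed
  qed
  show "shift_perm j u i = i" if "i \<notin> {1..j + m}" for i
  proof (cases "i \<le> j")
    case False
    then have "i - j \<notin> {1..m}" using that by auto
    then show ?thesis using permutes_not_in[OF assms] False by (simp add: shift_perm_def)
  qed (simp add: shift_perm_def)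
qed

lemma code_shift_perm:
  assumes "u permutes {1..m}"
  shows "code (j + m) (shift_perm j u) i = (if i \<le> j then 0 else code m u (i - j))"
proof (cases "i \<le> j")
  case True
  have "\<not> shift_perm j u k < shift_perm j u i" if "i < k" for k
    using True that by (auto simp: shift_perm_def)
  then have "{k \<in> {i<..j + m}. shift_perm j u k < shift_perm j u i} = {}" by auto
  then show ?thesis unfolding code_def using True by simp
next
  case False
  have "bij_betw (\<lambda>k. j + k) {k \<in> {i - j<..m}. u k < u (i - j)}
      {k \<in> {i<..j + m}. shift_perm j u k < shift_perm j u i}"
    by (rule bij_betw_byWitness[where f' = "\<lambda>k. k - j"])
      (use False in \<open>auto simp: shift_perm_def\<close>)
  then have "card {k \<in> {i - j<..m}. u k < u (i - j)} =
      card {k \<in> {i<..j + m}. shift_perm j u k < shift_perm j u i}" by (rule bij_betw_same_card)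
  then show ?thesis using False by (simp add: code_def)
qed

lemma vex_code_shift:
  assumes vex: "vex_code c" and c': "\<And>i. c' i = (if i \<le> j then 0 else c (i - j))"
  shows "vex_code c'"
  unfolding vex_code_def
proof (intro conjI allI impI)
  fix i k assume ik: "i < k" "c' k < c' i"
  then have ij: "j < i" unfolding c' by (cases "i \<le> j") simp_all
  have "bij_betw (\<lambda>z. j + z) {z \<in> {i - j<..<k - j}. c z < c (k - j)} {z \<in> {i<..<k}. c' z < c' k}"
    by (rule bij_betw_byWitness[where f' = "\<lambda>z. z - j"])
      (use ij ik in \<open>auto simp: c' split: if_splits\<close>)
  then have "card {z \<in> {i<..<k}. c' z < c' k} = card {z \<in> {i - j<..<k - j}. c z < c (k - j)}"
    by (rule bij_betw_same_card[symmetric])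
  also have "\<dots> \<le> c (i - j) - c (k - j)"
    by (rule vex_code_card[OF vex]) (use ij ik c'[of i] c'[of k] in simp_all)
  finally show "card {z \<in> {i<..<k}. c' z < c' k} \<le> c' i - c' k"
    using ij ik c'[of i] c'[of k] by simp
next
  fix i z k assume "i < z" "z < k" "c' i \<le> c' k"
  then show "c' i \<le> c' z"
    using vex_code_between[OF vex, of "i - j" "z - j" "k - j"] unfolding c' by (cases "i \<le> j") simp_all
qed

lemma code_shift_rows:
  assumes supp: "code_support m c" and supp': "code_support (j + m) c'"
    and c': "\<And>i. c' i = (if i \<le> j then 0 else c (i - j))"
  shows "row_len c' = row_len c" "0 < row_len c r \<Longrightarrow> flag c' r = flag c r + j"
proof -
  have ge: "{x. e \<le> c' x} = (\<lambda>x. x + j) ` {x. e \<le> c x}" if "1 \<le> e" for e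
  proof (intro equalityI subsetI)
    fix x assume "x \<in> {x. e \<le> c' x}"
    then have "\<not> x \<le> j" "e \<le> c (x - j)" using that by (auto simp: c' split: if_splits)
    then show "x \<in> (\<lambda>x. x + j) ` {x. e \<le> c x}" by (intro image_eqI[of _ _ "x - j"]) auto
  next
    fix x assume "x \<in> (\<lambda>x. x + j) ` {x. e \<le> c x}"
    then obtain y where y: "x = y + j" "e \<le> c y" by blast
    then have "1 \<le> y" using code_support_subset[OF supp that] by auto
    then show "x \<in> {x. e \<le> c' x}" using y by (simp add: c')
  qed
  have count: "row_count c' e = row_count c e" if "1 \<le> e" for e
    unfolding row_count_def ge[OF that] by (rule card_image) (simp add: inj_on_def)
  show len: "row_len c' = row_len c"
  proof
    show "row_len c' r = row_len c r" for r
      by (rule row_len_eqI[OF supp']) (simp add: count row_len_ge_iff[OF supp])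
  qed
  assume "0 < row_len c r"
  then have e: "1 \<le> row_len c r" by simp
  obtain x where x: "c x = row_len c r" using row_len_attained[OF supp e] by blast
  have ne: "{x. row_len c r \<le> c x} \<noteq> {}" using x by (auto intro: exI[of _ x])
  have "mono (\<lambda>x. x + j)" by (simp add: mono_def)
  then have "Max {x. row_len c r \<le> c x} + j = Max ((\<lambda>x. x + j) ` {x. row_len c r \<le> c x})"
    using finite_code_ge[OF supp e] ne by (rule mono_Max_commute)
  then show "flag c' r = flag c r + j"
    unfolding flag_def len last_pos_def ge[OF e] by (rule sym)
qed

lemma nu_eq_card_tableaux:
  assumes perm: "u permutes {1..m}" and vex: "vex_code (code m u)"
  shows "nu m u j = int (card (tableaux (\<lambda>r. flag (code m u) r + j) (j + m) (row_len (code m u))))"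
proof -
  let ?c = "code m u" and ?M = "j + m"
  let ?c' = "code ?M (shift_perm j u)"
  have c': "?c' i = (if i \<le> j then 0 else ?c (i - j))" for i by (rule code_shift_perm[OF perm])
  note perm' = shift_perm_permutes[OF perm, of j]
  note supp = code_support_code[OF perm] and supp' = code_support_code[OF perm']
  note rows = code_shift_rows[OF supp supp' c']
  have "schubert ?M (shift_perm j u) = flagged X ?M (flag ?c') ?M (row_len ?c')"
    by (rule schubert_eqI, rule is_schubert_flagged[OF perm' vex_code_shift[OF vex c']])
  then have "nu m u j = eval_poly (\<lambda>_. 1) (flagged X ?M (flag ?c') ?M (row_len ?c'))"
    by (simp add: nu_def)
  also have "\<dots> = flagged (\<lambda>_. 1) ?M (flag ?c') ?M (row_len ?c')"
    by (subst flagged_hom[where h = "eval_poly (\<lambda>_. 1)"]) (simp_all add: eval_poly_add eval_poly_mult)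
  also have "\<dots> = int (card (tableaux (flag ?c') ?M (row_len ?c')))"
    using flagged_eq_card_tableaux[of ?M "row_len ?c'" "flag ?c'" ?M]
      row_len_eq_0[OF supp'] row_len_antimono[OF supp'] by simp
  also have "tableaux (flag ?c') ?M (row_len ?c') = tableaux (\<lambda>r. flag ?c r + j) ?M (row_len ?c)"
  proof -
    \<comment> \<open>The existence of a box \<open>d\<close> makes the row nonempty; flags of empty
      rows need not correspond.\<close>
    have "flag ?c' r = flag ?c r + j" if "d < row_len ?c r" for r d using rows(2) that by simp
    then show ?thesis unfolding rows(1) tableaux_def by (simp cong: imp_cong)
  qed
  finally show ?thesis .
qed

lemma nu_p_partitions:
  assumes perm: "u permutes {1..p + 1}" and ind: "indecomposable (p + 1) u" and vex: "vexillary (p + 1) u"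
  defines "mu \<equiv> row_len (code (p + 1) u)"
  shows "\<exists>\<omega> N. bij_betw \<omega> (diagram mu) {1..card (diagram mu)} \<and>
    (\<forall>j. nu (p + 1) u j = int (card (p_partitions (diagram mu) (diagram_covers mu) \<omega> (j + N)))) \<and>
    (\<forall>M<N. p_partitions (diagram mu) (diagram_covers mu) \<omega> M = {})"
proof -
  let ?m = "p + 1"
  let ?c = "code ?m u"
  have supp: "code_support ?m ?c" by (rule code_support_code[OF perm])
  have vexc: "vex_code ?c" by (rule vexillary_vex_code[OF perm vex])
  note nu = nu_eq_card_tableaux[OF perm vexc, folded mu_def]
  show ?thesis
  proof (cases "p = 0")
    case True
    \<comment> \<open>On a single point the diagram is empty, outside the scope of
      \<open>flagged_shape\<close>. Here there is one empty tableau, and \<open>N\<close> is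
      0.\<close>
    have "?c i = 0" for i
    proof (cases "i = 0")
      case True
      then show ?thesis using code_0[OF perm] by simp
    next
      case False
      then have "{i<..?m} = {}" using \<open>p = 0\<close> by auto
      then show ?thesis by (simp add: code_def)
    qed
    then have mu: "mu r = 0" for r
      unfolding mu_def by (intro row_len_eqI[OF supp]) (simp add: row_count_def)
    then have D: "diagram mu = {}" "diagram_covers mu = {}" by (auto simp: diagram_def diagram_covers_def)
    have "tableaux phi v mu = {\<lambda>_. 0}" for phi v using mu by (auto simp: tableaux_def)
    then have "nu ?m u j = 1" for j using nu by simp
    moreover have "p_partitions (diagram mu) (diagram_covers mu) (\<lambda>_. 0) M = {\<lambda>_. undefined}" for M
      by (simp add: p_partitions_def D)
    ultimately show ?thesis by (intro exI[of _ "\<lambda>_. 0"] exI[of _ 0]) (simp add: D bij_betw_def)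
  next
    case False
    \<comment> \<open>Indecomposability at 1 gives \<open>u 1 \<noteq> 1\<close>, hence a positive
      first code and with it the tight corner.\<close>
    have "1 \<in> {1..<?m}" using False by simp
    then have "u ` {1..1} \<noteq> {1..1}" using ind unfolding indecomposable_def by blast
    then have u1: "u 1 \<noteq> 1" by auto
    obtain y where y: "y \<in> {1..?m}" "u y = 1"
    proof -
      have "1 \<in> u ` {1..?m}" unfolding permutes_image[OF perm] by simp
      then show thesis using that by (metis (no_types, lifting) imageE)
    qed
    have "1 \<le> u 1" using permutes_in_image[OF perm, of 1] by simp
    moreover have "y \<noteq> 1" using u1 y by auto
    ultimately have "y \<in> {j \<in> {1<..?m}. u j < u 1}" using y u1 by auto
    then have "{j \<in> {1<..?m}. u j < u 1} \<noteq> {}" by blast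
    moreover have "finite {j \<in> {1<..?m}. u j < u 1}" by simp
    ultimately have "0 < card {j \<in> {1<..?m}. u j < u 1}" by (simp only: card_gt_0_iff simp_thms)
    then have pos: "1 \<le> ?c 1" unfolding code_def by linarith
    interpret flagged_shape mu "flag ?c" ?m
      unfolding mu_def by (rule flagged_shape_code[OF supp vexc pos])
    have flag_le: "flag ?c r + j \<le> j + ?m" if "0 < mu r" for r j
    proof -
      have e: "1 \<le> row_len ?c r" using that by (simp add: mu_def)
      obtain x where "?c x = row_len ?c r" using row_len_attained[OF supp e] by blast
      then show ?thesis using last_pos_le(2)[OF supp e, of x] by (simp add: flag_def)
    qed
    obtain r where r: "mu (Suc r) < mu r" "flag ?c r = Suc r"
      using ex_tight_corner[OF supp vexc pos] unfolding mu_def by blast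
    show ?thesis
    proof (intro exI[of _ omega] exI[of _ "nat N"] conjI allI impI)
      show "nu ?m u j = int (card (p_partitions (diagram mu) (diagram_covers mu) omega (j + nat N)))" for j
        unfolding nu using card_tableaux_eq_p_partitions[of j "j + ?m"] flag_le by simp
      show "p_partitions (diagram mu) (diagram_covers mu) omega M = {}" if "M < nat N" for M
        by (rule p_partitions_empty[of r]) (use r that in \<open>auto simp: corners_def\<close>)
    qed (rule omega_bij)
  qed
qed

section \<open>Standard Young tableaux as linear extensions\<close>

text \<open>Sorting and removing zeros do not change the number of parts that are at least
  \<open>e\<close>, for \<open>e \<ge> 1\<close>, and these numbers determine a partition.\<close>

lemma shape_nth:
  assumes perm: "u permutes {1..m}"
  defines "lam \<equiv> shape m u" and "mu \<equiv> row_len (code m u)"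
  shows "mu r = (if r < length lam then lam ! r else 0)"
proof -
  let ?c = "code m u"
  have supp: "code_support m ?c" by (rule code_support_code[OF perm])
  have sorted: "lam ! s \<le> lam ! r" if "r \<le> s" "s < length lam" for r s
  proof -
    have "sorted (rev lam)" by (simp add: lam_def shape_def)
    then show ?thesis using that by (simp add: sorted_rev_iff_nth_mono)
  qed
  have count: "card {r. r < length lam \<and> e \<le> lam ! r} = row_count ?c e" if e: "1 \<le> e" for e
  proof -
    have "card {r. r < length lam \<and> e \<le> lam ! r} = length (filter (\<lambda>c. e \<le> c) lam)"
      by (simp add: length_filter_conv_card)
    also have "\<dots> = size (filter_mset (\<lambda>c. e \<le> c) (mset lam))"
      by (metis mset_filter size_mset)
    also have "mset lam = mset (filter (\<lambda>c. c \<noteq> 0) (map ?c [1..<m + 1]))"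
      by (simp add: lam_def shape_def)
    also have "size (filter_mset (\<lambda>c. e \<le> c) \<dots>) =
        length (filter (\<lambda>c. e \<le> c) (filter (\<lambda>c. c \<noteq> 0) (map ?c [1..<m + 1])))"
      by (metis mset_filter size_mset)
    also have "filter (\<lambda>c. e \<le> c) (filter (\<lambda>c. c \<noteq> 0) (map ?c [1..<m + 1])) =
        filter (\<lambda>c. e \<le> c) (map ?c [1..<m + 1])"
      unfolding filter_filter by (rule filter_cong) (use e in auto)
    also have "\<dots> = map ?c (filter (\<lambda>x. e \<le> ?c x) [1..<m + 1])"
      by (simp only: filter_map comp_def)
    also have "length \<dots> = card (set (filter (\<lambda>x. e \<le> ?c x) [1..<m + 1]))"
      by (subst distinct_card) simp_all
    also have "set (filter (\<lambda>x. e \<le> ?c x) [1..<m + 1]) = {x. e \<le> ?c x}"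
      using code_support_subset[OF supp e] by (auto simp del: upt_Suc)
    finally show ?thesis by (simp add: row_count_def)
  qed
  show ?thesis
    unfolding mu_def
  proof (rule row_len_eqI[OF supp])
    fix e :: nat assume e: "1 \<le> e"
    have "r < card {r. r < length lam \<and> e \<le> lam ! r} \<longleftrightarrow> r < length lam \<and> e \<le> lam ! r"
      by (rule less_card_iff) (use sorted le_trans in blast)
    then show "r < row_count ?c e \<longleftrightarrow> e \<le> (if r < length lam then lam ! r else 0)"
      using count[OF e] e by auto
  qed
qed

lemma cells_shape:
  assumes "u permutes {1..m}"
  shows "cells (shape m u) = diagram (row_len (code m u))"
  unfolding cells_def diagram_def by (auto simp: shape_nth[OF assms] split: if_splits)

lemma card_cells: "card (cells lam) = sum_list lam"
proof -
  have "cells lam = (SIGMA r:{..<length lam}. {..<lam ! r})" by (auto simp: cells_def)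
  then have "card (cells lam) = (\<Sum>r<length lam. lam ! r)" by simp
  then show ?thesis by (simp add: sum_list_sum_nth atLeast0LessThan)
qed

text \<open>Increase along rows and columns follows from increase between neighbouring boxes, as all
  boxes in between belong to the diagram.\<close>

lemma SYT_eq_linear_extensions:
  assumes cells: "cells lam = diagram mu" and decr: "\<And>r. mu (Suc r) \<le> mu r"
  shows "SYT lam = linear_extensions (diagram mu) (diagram_covers mu)"
proof -
  have mem: "(r, c) \<in> cells lam \<longleftrightarrow> c < mu r" for r c by (simp add: cells diagram_def)
  have mono: "mu s \<le> mu r" if "r \<le> s" for r s by (rule lift_Suc_antimono_le[of mu, OF decr that])
  have iff: "(\<forall>r c c'. c < c' \<and> (r, c) \<in> cells lam \<and> (r, c') \<in> cells lam \<longrightarrow> T (r, c) < T (r, c')) \<and>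
      (\<forall>r r' c. r < r' \<and> (r, c) \<in> cells lam \<and> (r', c) \<in> cells lam \<longrightarrow> T (r, c) < T (r', c)) \<longleftrightarrow>
      (\<forall>(x, y)\<in>diagram_covers mu. T x < T y)" (is "?L \<longleftrightarrow> ?R") for T :: "nat \<times> nat \<Rightarrow> nat"
  proof
    assume L: ?L
    have "T (r, c) < T (r, Suc c)" if "Suc c < mu r" for r c using L that unfolding mem by simp
    moreover have "T (r, c) < T (Suc r, c)" if "c < mu (Suc r)" for r c
      using L that decr[of r] unfolding mem by simp
    ultimately show ?R by (auto simp: diagram_covers_def)
  next
    assume R: ?R
    have right: "T (r, c) < T (r, Suc c)" if "Suc c < mu r" for r c
      using bspec[OF R, of "((r, c), (r, Suc c))"] that by (simp add: diagram_covers_def)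
    have down: "T (r, c) < T (Suc r, c)" if "c < mu (Suc r)" for r c
      using bspec[OF R, of "((r, c), (Suc r, c))"] that by (simp add: diagram_covers_def)
    have rights: "T (r, c) < T (r, c')" if "c < c'" "c' < mu r" for r c c'
      using that
    proof (induction c')
      case (Suc c')
      then show ?case using right[of c' r] by (cases "c = c'") auto
    qed simp
    have downs: "T (r, c) < T (r', c)" if "r < r'" "c < mu r'" for r r' c
      using that
    proof (induction r')
      case (Suc r')
      then show ?case using down[of c r'] decr[of r'] by (cases "r = r'") auto
    qed simp
    show ?L unfolding mem using rights downs by blast
  qed
  show ?thesis
    unfolding SYT_def iff unfolding linear_extensions_def card_cells[symmetric] cells by (rule refl)
qed

lemma des_eq_card_descent_set:
  "des lam \<omega> T = card (descent_set (cells lam) \<omega> T)"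
  by (simp add: des_def descent_set_def card_cells)

text \<open>The left side has no coefficient below \<open>N\<close>. On the right the coefficient of
  degree \<open>d\<close> counts the \<open>T\<close> with \<open>d T = d\<close>, and in
  characteristic 0 such counts vanish only if there is no such \<open>T\<close>. Then the power of
  \<open>fps_X\<close> cancels.\<close>

lemma fps_shift_quotient:
  fixes A :: "'a::field_char_0 fps"
  assumes fin: "finite S" and eq: "fps_X ^ N * A * (1 - fps_X) ^ n = (\<Sum>T\<in>S. fps_X ^ d T)"
  shows "\<forall>T\<in>S. N \<le> d T" "A = (\<Sum>T\<in>S. fps_X ^ (d T - N)) / (1 - fps_X) ^ n"
proof -
  show le: "\<forall>T\<in>S. N \<le> d T"
  proof
    fix T assume T: "T \<in> S"
    show "N \<le> d T"
    proof (rule ccontr)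
      assume "\<not> N \<le> d T"
      then have "fps_nth (fps_X ^ N * (A * (1 - fps_X) ^ n)) (d T) = 0"
        by (simp add: fps_X_power_mult_nth)
      then have "(\<Sum>T'\<in>S. fps_nth (fps_X ^ d T') (d T)) = (0 :: 'a)"
        using eq by (simp add: mult.assoc fps_sum_nth)
      moreover have "(\<Sum>T'\<in>S. fps_nth (fps_X ^ d T') (d T)) = (of_nat (card {T' \<in> S. d T = d T'}) :: 'a)"
        by (simp add: fps_X_power_nth sum.If_cases[OF fin] Int_def)
      ultimately have "card {T' \<in> S. d T = d T'} = 0" by simp
      then show False using fin T by auto
    qed
  qed
  have "fps_X ^ N * (A * (1 - fps_X) ^ n) = fps_X ^ N * (\<Sum>T\<in>S. fps_X ^ (d T - N))"
    unfolding sum_distrib_left mult.assoc[symmetric] eq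
    by (rule sum.cong) (use le in \<open>auto simp flip: power_add\<close>)
  then have *: "A * (1 - fps_X) ^ n = (\<Sum>T\<in>S. fps_X ^ (d T - N))" by simp
  have "(1 - fps_X :: 'a fps) \<noteq> 0" by (metis diff_eq_diff_eq diff_zero fps_X_neq_one right_minus_eq)
  then show "A = (\<Sum>T\<in>S. fps_X ^ (d T - N)) / (1 - fps_X) ^ n"
    unfolding *[symmetric] by (intro nonzero_mult_div_cancel_right[symmetric]) simp
qed

theorem theorem1p5:
  fixes p n :: nat and u :: "nat \<Rightarrow> nat" and lam :: "nat list"
  assumes "u permutes {1..p + 1}"
    and "indecomposable (p + 1) u"
    and "vexillary (p + 1) u"
    and "shape (p + 1) u = lam"
    and "n = sum_list lam + 1"
  shows "\<exists>\<omega> N. labeling lam \<omega> \<and> (\<forall>T\<in>SYT lam. N \<le> des lam \<omega> T) \<and>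
           Abs_fps (\<lambda>j. of_int (nu (p + 1) u j) :: rat) =
             (\<Sum>T\<in>SYT lam. fps_X ^ (des lam \<omega> T - N)) / (1 - fps_X) ^ n"
proof -
  define mu where "mu = row_len (code (p + 1) u)"
  let ?P = "diagram mu" and ?R = "diagram_covers mu"
  obtain \<omega> N where \<omega>: "bij_betw \<omega> ?P {1..card ?P}"
    and nu: "\<And>j. nu (p + 1) u j = int (card (p_partitions ?P ?R \<omega> (j + N)))"
    and empty: "\<And>M. M < N \<Longrightarrow> p_partitions ?P ?R \<omega> M = {}"
    using nu_p_partitions[OF assms(1-3)] unfolding mu_def by blast
  have cells: "cells lam = ?P" using cells_shape[OF assms(1)] assms(4) by (simp add: mu_def)
  have card: "card ?P = sum_list lam" using card_cells[of lam] cells by simp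
  have fin: "finite ?P"
  proof -
    have "cells lam \<subseteq> {..<length lam} \<times> {..<sum_list lam}"
      by (auto simp: cells_def) (meson elem_le_sum_list less_le_trans)
    then show ?thesis unfolding cells by (rule finite_subset) simp
  qed
  have decr: "mu (Suc r) \<le> mu r" for r
    unfolding mu_def by (rule row_len_antimono[OF code_support_code[OF assms(1)]]) simp
  have SYT: "SYT lam = linear_extensions ?P ?R"
    by (rule SYT_eq_linear_extensions[OF cells decr])
  have R: "?R \<subseteq> ?P \<times> ?P" "irrefl ?R"
    using decr by (auto simp: diagram_covers_def diagram_def irrefl_def intro: less_le_trans)
  let ?A = "Abs_fps (\<lambda>j. of_int (nu (p + 1) u j) :: rat)"
  \<comment> \<open>Coefficients below \<open>N\<close> vanish by emptiness, and from
    \<open>N\<close> on they are the values of \<open>nu\<close>.\<close>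
  have "Abs_fps (\<lambda>M. of_nat (card (p_partitions ?P ?R \<omega> M)) :: rat) = fps_X ^ N * ?A"
  proof (rule fps_ext)
    fix M
    show "fps_nth (Abs_fps (\<lambda>M. of_nat (card (p_partitions ?P ?R \<omega> M)) :: rat)) M =
        fps_nth (fps_X ^ N * ?A) M"
      using nu[of "M - N"] empty[of M] by (cases "M < N") (simp_all add: fps_X_power_mult_nth)
  qed
  then have eq: "fps_X ^ N * ?A * (1 - fps_X) ^ n = (\<Sum>T\<in>SYT lam. fps_X ^ des lam \<omega> T)"
    using fps_p_partitions[OF fin R bij_betw_imp_inj_on[OF \<omega>]]
    by (simp add: SYT des_eq_card_descent_set cells card assms(5))
  have "SYT lam \<subseteq> cells lam \<rightarrow>\<^sub>E {1..sum_list lam}" by (auto simp: SYT_def bij_betw_def PiE_def)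
  then have "finite (SYT lam)"
    by (rule finite_subset) (use fin cells in \<open>auto intro: finite_PiE\<close>)
  note quotient = fps_shift_quotient[OF this eq]
  have "labeling lam \<omega>" using \<omega> by (simp add: labeling_def cells card)
  then show ?thesis using quotient by blast
qed

end
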